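(* Let $p$ be a prime, $\zeta_p$ a primitive $p$-th root of unity, and $f(x_1,\dots,x_n)\in\mathbb{F}_p[x_1,\dots,x_n]$ a polynomial. For each positive integer $k$ let $$S_k(f)=\sum_{(x_1,\dots,x_n)\in(\mathbb{F}_{p^k})^n}\zeta_p^{\mathrm{Tr}_k(f(x_1,\dots,x_n))}\in\mathbb{Z}[\zeta_p],$$ where $\mathrm{Tr}_k:\mathbb{F}_{p^k}\to\mathbb{F}_p$ is the absolute trace map. Then the sequence $\deg S_k(f)$ ($k=1,2,\dots$) is virtually periodic: there exist positive integers $N$ and $r$ (depending on $f$ and $p$) such that $\deg S_{k+r}(f)=\deg S_k(f)$ for all $k>N$.
   Context: Here $\mathbb{F}_{p^k}$ is the finite field with $p^k$ elements, and $\deg S_k(f)$ denotes the degree of the algebraic number $S_k(f)$ over $\mathbb{Q}$, i.e. $[\mathbb{Q}(S_k(f)):\mathbb{Q}]$. *)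

theory Defs
  imports
    Complex_Main
    "HOL-Library.Poly_Mapping"
    "HOL-Library.FuncSet"
    "HOL-Algebra.Embedded_Algebras"
    "HOL-Algebra.Generated_Fields"
    "HOL-Algebra.Algebraic_Closure_Type"
    "Berlekamp_Zassenhaus.Finite_Field"
begin

text \<open>
  The prime field with \<open>p\<close> elements is \<open>'p mod_ring\<close>, where \<open>p = CARD('p)\<close> is prime by the
  sort constraint \<open>prime_card\<close>. All its finite extensions live in one fixed algebraic closure;
  see \<open>subfield_GF\<close> and \<open>card_GF\<close> below.
\<close>

definition GF :: "nat \<Rightarrow> 'p::prime_card mod_ring alg_closure set" where
  "GF k = {y. y ^ (CARD('p) ^ k) = y}"

text \<open>
  The trace is computed as the sum of the conjugates of \<open>y\<close>; \<^const>\<open>of_ac\<close> reads this element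
  of the prime subfield as an element of \<open>'p mod_ring\<close> (see \<open>to_ac_GF_trace\<close> below).
\<close>

definition GF_trace :: "nat \<Rightarrow> 'p::prime_card mod_ring alg_closure \<Rightarrow> 'p mod_ring" where
  "GF_trace k y = of_ac (\<Sum>i<k. y ^ (CARD('p) ^ i))"

text \<open>
  A polynomial in the variables \<open>x\<^sub>i\<close> (\<open>i :: nat\<close>) is a finitely supported map from exponent
  vectors to coefficients.
\<close>

type_synonym 'a mpoly = "(nat \<Rightarrow>\<^sub>0 nat) \<Rightarrow>\<^sub>0 'a"

definition mpolys :: "nat \<Rightarrow> 'a::zero mpoly set" where
  "mpolys n = {f. \<forall>m \<in> Poly_Mapping.keys f. Poly_Mapping.keys m \<subseteq> {..<n}}"

definition eval_ac :: "'a::field mpoly \<Rightarrow> (nat \<Rightarrow> 'a alg_closure) \<Rightarrow> 'a alg_closure" where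
  "eval_ac f x =
     (\<Sum>m\<in>Poly_Mapping.keys f.
        to_ac (Poly_Mapping.lookup f m) *
        (\<Prod>i\<in>Poly_Mapping.keys m. x i ^ Poly_Mapping.lookup m i))"

text \<open>
  The exponent is the representative in \<open>{0..<p}\<close>, which is immaterial once \<open>\<zeta> ^ p = 1\<close>.
\<close>

definition exp_sum :: "complex \<Rightarrow> nat \<Rightarrow> 'p::prime_card mod_ring mpoly \<Rightarrow> nat \<Rightarrow> complex" where
  "exp_sum \<zeta> n f k =
     (\<Sum>x \<in> {..<n} \<rightarrow>\<^sub>E GF k. \<zeta> powi to_int_mod_ring (GF_trace k (eval_ac f x)))"

definition primitive_root_of_unity :: "nat \<Rightarrow> complex \<Rightarrow> bool" where
  "primitive_root_of_unity m \<zeta> \<longleftrightarrow> \<zeta> ^ m = 1 \<and> (\<forall>j. 0 < j \<and> j < m \<longrightarrow> \<zeta> ^ j \<noteq> 1)"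

definition rat_adjoin :: "complex \<Rightarrow> complex set" where
  "rat_adjoin \<alpha> = generate_field ring_of_type_algebra (insert \<alpha> \<rat>)"

text \<open>
  \<open>ring.dim\<close> is only meaningful for finite-dimensional extensions, i.e. for algebraic \<open>\<alpha>\<close>.
\<close>

definition alg_degree :: "complex \<Rightarrow> nat" where
  "alg_degree \<alpha> = ring.dim ring_of_type_algebra \<rat> (rat_adjoin \<alpha>)"


subsection \<open>\<^const>\<open>GF\<close> \<open>k\<close> is the subfield with \<open>p ^ k\<close> elements, and traces lie in the prime field\<close>

lemma GF_add: "x \<in> GF k \<Longrightarrow> y \<in> GF k \<Longrightarrow> x + y \<in> GF k"
  for x :: "'p::prime_card mod_ring alg_closure"
  using freshmans_dream'[of "CARD('p) ^ k" k x y] prime_card[where 'a='p] by (simp add: GF_def)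

lemma GF_mult: "x \<in> GF k \<Longrightarrow> y \<in> GF k \<Longrightarrow> x * y \<in> GF k"
  by (simp add: GF_def power_mult_distrib)

lemma GF_inverse: "x \<in> GF k \<Longrightarrow> inverse x \<in> GF k"
  by (simp add: GF_def power_inverse)

lemma GF_0: "0 \<in> GF k" and GF_1: "1 \<in> GF k"
  by (simp_all add: GF_def)

lemma to_ac_in_GF: "to_ac a \<in> GF k" for a :: "'p::prime_card mod_ring"
  using finite_field_power_card_power_eq_same[of "CARD('p) ^ k" k a]
  by (simp add: GF_def flip: to_ac_power)

lemma GF_uminus:
  fixes x :: "'p::prime_card mod_ring alg_closure"
  assumes "x \<in> GF k"
  shows "- x \<in> GF k"
  using GF_mult[OF to_ac_in_GF[of "- 1" k] assms] by simp

lemma subfield_GF: "subfield (GF k :: 'p::prime_card mod_ring alg_closure set) ring_of_type_algebra"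
proof -
  let ?R = "ring_of_type_algebra :: 'p mod_ring alg_closure ring"
  interpret R: Ring.field ?R by (rule field_from_type_algebra)
  have car: "carrier ?R = UNIV" and [simp]: "\<one>\<^bsub>?R\<^esub> = 1" "\<zero>\<^bsub>?R\<^esub> = 0"
    "\<And>x y. x \<otimes>\<^bsub>?R\<^esub> y = x * y" "\<And>x y. x \<oplus>\<^bsub>?R\<^esub> y = x + y"
    by (simp_all add: ring_of_type_algebra_def)
  have ainv: "\<ominus>\<^bsub>?R\<^esub> x = - x" for x
    by (rule R.minus_equality) (simp_all add: car)
  have minv: "inv\<^bsub>?R\<^esub> x = inverse x" if "x \<noteq> 0" for x
    by (rule R.inv_unique'[symmetric]) (use that in \<open>simp_all add: car\<close>)
  have "subring (GF k) ?R"
    by (intro R.subringI) (auto simp: car ainv GF_1 GF_uminus GF_mult GF_add)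
  thus ?thesis
    by (rule R.subfieldI') (auto simp: minv GF_inverse)
qed

lemma card_GF:
  assumes "k > 0"
  shows "card (GF k :: 'p::prime_card mod_ring alg_closure set) = CARD('p) ^ k"
proof -
  let ?q = "CARD('p) ^ k"
  define P :: "'p mod_ring alg_closure poly" where "P = monom 1 ?q - monom 1 1"
  have p1: "CARD('p) > 1" using prime_card[where 'a='p] by (rule prime_gt_1_nat)
  have q: "?q > 1" using one_less_power[OF p1 assms] .
  have deg: "degree P = ?q"
  proof (rule antisym)
    show "degree P \<le> ?q"
      unfolding P_def using q by (intro degree_diff_le) (auto intro: order.trans[OF degree_monom_le])
    show "?q \<le> degree P"
      by (rule le_degree) (use q in \<open>simp add: P_def\<close>)
  qed
  hence [simp]: "P \<noteq> 0" using q by force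
  have root: "poly P x = 0 \<longleftrightarrow> x \<in> GF k" for x
    by (simp add: P_def poly_monom GF_def)
  have "CARD('p) dvd ?q" using assms by simp
  hence "(of_nat ?q :: 'p mod_ring alg_closure) = 0"
    unfolding of_nat_eq_0_iff_char_dvd by simp
  hence pd: "pderiv P = - 1"
    by (simp only: P_def pderiv_diff pderiv_monom mult_1_left mult_zero_left monom_eq_0 of_nat_1 diff_self_eq_0
        monom_0 diff_0 one_pCons)
  have ord: "order x P = 1" if x: "x \<in> GF k" for x
  proof (rule ccontr)
    assume "order x P \<noteq> 1"
    moreover have "order x P \<noteq> 0" using x root[of x] order_root[of P x] by simp
    ultimately have "2 \<le> order x P" by linarith
    hence "[:-x, 1:] ^ 2 dvd P" by (rule power_le_dvd[OF order_1])
    then obtain Q where Q: "P = [:-x, 1:] ^ 2 * Q" ..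
    have "poly (pderiv P) x = 0"
      unfolding Q power2_eq_square pderiv_mult by simp
    thus False by (simp add: pd)
  qed
  obtain A where A: "size A = degree P" "P = smult (lead_coeff P) (\<Prod>x\<in>#A. [:-x, 1:])"
    using alg_closed_imp_factorization[of P] by auto
  have "proots P = proots (\<Prod>x\<in>#A. [:-x, 1:])"
    by (subst A(2), subst proots_smult) auto
  also have "\<dots> = A"
  proof (induction A)
    case (add x A)
    have "(\<Prod>x\<in>#A. [:-x, 1:]) \<noteq> 0" by (auto simp: prod_mset_zero_iff)
    hence "proots ([:-x, 1:] * (\<Prod>x\<in>#A. [:-x, 1:])) = add_mset x A"
      using proots_linear_factor[of "-x"] by (subst proots_mult) (simp_all add: add.IH)
    thus ?case by simp
  qed simp
  finally have "proots P = A" .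
  hence "?q = size (proots P)" using A deg by simp
  also have "\<dots> = (\<Sum>x\<in>GF k. order x P)"
    by (simp add: size_multiset_overloaded_eq root)
  also have "\<dots> = card (GF k :: 'p mod_ring alg_closure set)" using ord by simp
  finally show ?thesis by simp
qed

lemma GF_1_eq: "(GF 1 :: 'p::prime_card mod_ring alg_closure set) = range to_ac"
proof (rule sym, rule card_subset_eq)
  have *: "card (GF 1 :: 'p mod_ring alg_closure set) = CARD('p)"
    using card_GF[of 1, where 'p='p] by simp
  thus "finite (GF 1 :: 'p mod_ring alg_closure set)"
    by (intro card_ge_0_finite) simp
  show "range to_ac \<subseteq> (GF 1 :: 'p mod_ring alg_closure set)"
    using to_ac_in_GF by auto
  show "card (range (to_ac :: 'p mod_ring \<Rightarrow> _)) = card (GF 1 :: 'p mod_ring alg_closure set)"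
    by (simp only: * card_image[OF inj_to_ac] CARD_mod_ring)
qed

lemma to_ac_GF_trace:
  fixes y :: "'p::prime_card mod_ring alg_closure"
  assumes "y \<in> GF k"
  shows "to_ac (GF_trace k y) = (\<Sum>i<k. y ^ (CARD('p) ^ i))"
proof -
  let ?t = "\<Sum>i<k. y ^ (CARD('p) ^ i)"
  have "?t ^ CARD('p) = (\<Sum>i<k. (y ^ (CARD('p) ^ i)) ^ CARD('p))"
    by (rule freshmans_dream_sum) (simp_all add: prime_card)
  also have "\<dots> = (\<Sum>i<k. y ^ (CARD('p) ^ Suc i))"
    by (simp only: power_Suc2 power_mult)
  also have "\<dots> + y = ?t + y ^ (CARD('p) ^ k)"
    using sum.lessThan_Suc_shift[of "\<lambda>i. y ^ (CARD('p) ^ i)" k] by (simp add: add.commute)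
  finally have "?t \<in> GF 1" using assms by (simp add: GF_def)
  thus ?thesis unfolding GF_trace_def GF_1_eq by (rule to_ac_of_ac)
qed

end

theory Submission
  imports Defs "Jordan_Normal_Form.Schur_Decomposition"
begin

text \<open>
  Fix a \<open>p\<close>-adic place of the complex numbers. Dwork's splitting function turns the character of
  the trace into a product of values of an overconvergent power series at Teichmueller points, so
  modulo any power of \<open>p\<close> the exponential sums \<open>S\<^sub>k(b f)\<close> are combinations of traces of \<open>k\<close>-th
  powers of matrices whose characteristic polynomials have rapidly decaying coefficients. The
  number \<open>N\<^sub>k(j)\<close> of points at which \<open>Tr\<^sub>k f\<close> equals \<open>j\<close> is a combination of the \<open>S\<^sub>k(b f)\<close>; hence, by the
  Borel--Dwork argument, the Hankel determinants of the integers \<open>N\<^sub>k(i) - N\<^sub>k(j)\<close> are too divisible by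
  \<open>p\<close> for their size and vanish from some size on. So these integers satisfy a linear recurrence, and
  by Skolem--Mahler--Lech the set of \<open>k\<close> with \<open>N\<^sub>k(i) = N\<^sub>k(j)\<close> is eventually periodic. Since
  \<open>S\<^sub>k(f) = (\<Sum>j. N\<^sub>k(j) \<zeta>\<^sup>j)\<close>, these coincidences determine which automorphisms of the cyclotomic
  field fix \<open>S\<^sub>k(f)\<close>, and therefore its degree.
\<close>

section \<open>Extension of places\<close>

text \<open>No completion of an algebraic closure of the p-adic numbers is built: Zorn's lemma
  supplies a place of the complex numbers whose residue field is an algebraic closure of F_p. There
  are then no p-adic limits, so power series are evaluated only after truncation, and each analytic
  identity becomes a congruence modulo a rational power of p. Truncation makes Dwork's operators
  finite matrices, but their size grows with the precision M. Uniformity rescues the argument: the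
  coefficients of the reversed characteristic polynomials have valuation at least B i - C, where B
  is at choice and C does not depend on M, because C comes from counting the exponents of weight
  below B. Accordingly the denominator Q and the series h of the Borel--Dwork step may depend on M,
  but B and C may not. The slope B = 2(n + 2) is dictated by the final comparison: the Hankel
  determinant of size m has valuation about (B/2) m^2, while its absolute value is at most p^((n +
  1) m^2). Only an integer can be compared in this way, hence the detour through point
  counts.\<close>

definition partial_hom :: "('b::field \<times> 'a::field) set \<Rightarrow> bool" where
  "partial_hom G \<longleftrightarrow> (1, 1) \<in> G \<and> (\<forall>y. (0, y) \<in> G \<longrightarrow> y = 0) \<and>
     (\<forall>x y x' y'. (x, y) \<in> G \<longrightarrow> (x', y') \<in> G \<longrightarrow>
        (x + x', y + y') \<in> G \<and> (x * x', y * y') \<in> G \<and> (x - x', y - y') \<in> G)"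

text \<open>The graph of the map induced on polynomials: \<open>B\<close> is the reduction of
  \<open>A\<close>, coefficient by coefficient. Homomorphisms are kept as relations so that
  extending one is plain inclusion, the order to which Zorn's lemma is applied.\<close>

definition poly_pairs :: "('b::field \<times> 'a::field) set \<Rightarrow> ('b poly \<times> 'a poly) set" where
  "poly_pairs G = {(A, B). \<forall>i. (coeff A i, coeff B i) \<in> G}"

context
  fixes G :: "('b::field \<times> 'a::field) set"
  assumes G: "partial_hom G"
begin

lemma partial_hom_1: "(1, 1) \<in> G"
  and partial_hom_add: "(x, y) \<in> G \<Longrightarrow> (x', y') \<in> G \<Longrightarrow> (x + x', y + y') \<in> G"
  and partial_hom_mult: "(x, y) \<in> G \<Longrightarrow> (x', y') \<in> G \<Longrightarrow> (x * x', y * y') \<in> G"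
  and partial_hom_diff: "(x, y) \<in> G \<Longrightarrow> (x', y') \<in> G \<Longrightarrow> (x - x', y - y') \<in> G"
  and partial_hom_zeroD: "(0, y) \<in> G \<Longrightarrow> y = 0"
  using G by (auto simp: partial_hom_def)

lemma partial_hom_0: "(0, 0) \<in> G"
  using partial_hom_diff[OF partial_hom_1 partial_hom_1] by simp

text \<open>Single-valuedness is not part of \<open>partial_hom\<close>; it follows from the
  condition on \<open>0\<close> and closure under differences.\<close>

lemma partial_hom_unique: "(x, y) \<in> G \<Longrightarrow> (x, y') \<in> G \<Longrightarrow> y = y'"
  using partial_hom_diff[of x y x y'] partial_hom_zeroD by fastforce

lemma partial_hom_sum:
  "(\<And>i. i \<in> I \<Longrightarrow> (f i, g i) \<in> G) \<Longrightarrow> (sum f I, sum g I) \<in> G"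
  by (induction I rule: infinite_finite_induct) (auto intro: partial_hom_add partial_hom_0)

lemma partial_hom_power: "(x, y) \<in> G \<Longrightarrow> (x ^ n, y ^ n) \<in> G"
  by (induction n) (auto intro: partial_hom_mult partial_hom_1)

lemma poly_pairs_const: "(x, y) \<in> G \<Longrightarrow> ([:x:], [:y:]) \<in> poly_pairs G"
  by (auto simp: poly_pairs_def coeff_pCons partial_hom_0 split: nat.splits)

lemma poly_pairs_add:
  "(A, B) \<in> poly_pairs G \<Longrightarrow> (A', B') \<in> poly_pairs G \<Longrightarrow> (A + A', B + B') \<in> poly_pairs G"
  by (auto simp: poly_pairs_def partial_hom_add)

lemma poly_pairs_diff:
  "(A, B) \<in> poly_pairs G \<Longrightarrow> (A', B') \<in> poly_pairs G \<Longrightarrow> (A - A', B - B') \<in> poly_pairs G"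
  by (auto simp: poly_pairs_def partial_hom_diff)

lemma poly_pairs_mult:
  "(A, B) \<in> poly_pairs G \<Longrightarrow> (A', B') \<in> poly_pairs G \<Longrightarrow> (A * A', B * B') \<in> poly_pairs G"
  by (auto simp: poly_pairs_def coeff_mult intro!: partial_hom_mult partial_hom_sum)

lemma poly_pairs_monom: "(x, y) \<in> G \<Longrightarrow> (monom x n, monom y n) \<in> poly_pairs G"
  by (auto simp: poly_pairs_def partial_hom_0)

text \<open>The extension evaluates every pair of polynomials at \<alpha> and \<omega>; the
  assumption is exactly its well-definedness at zero, which suffices.\<close>

lemma partial_hom_extend:
  assumes "\<And>A B. (A, B) \<in> poly_pairs G \<Longrightarrow> poly A \<alpha> = 0 \<Longrightarrow> poly B \<omega> = 0"
  shows "\<exists>G'. partial_hom G' \<and> G \<subseteq> G' \<and> (\<alpha>, \<omega>) \<in> G'"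
proof (intro exI conjI)
  let ?G = "(\<lambda>(A, B). (poly A \<alpha>, poly B \<omega>)) ` poly_pairs G"
  have I: "(poly A \<alpha>, poly B \<omega>) \<in> ?G" if "(A, B) \<in> poly_pairs G" for A B
    using that by force
  show "partial_hom ?G"
    unfolding partial_hom_def
  proof (intro conjI allI impI)
    show "(1, 1) \<in> ?G"
      using I[OF poly_pairs_const[OF partial_hom_1]] by simp
  next
    fix y assume "(0, y) \<in> ?G"
    thus "y = 0" using assms by auto
  next
    fix x y x' y' assume "(x, y) \<in> ?G" "(x', y') \<in> ?G"
    then obtain A B A' B' where AB: "(A, B) \<in> poly_pairs G" "(A', B') \<in> poly_pairs G"
      and eq: "x = poly A \<alpha>" "y = poly B \<omega>" "x' = poly A' \<alpha>" "y' = poly B' \<omega>"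
      by auto
    show "(x + x', y + y') \<in> ?G" using I[OF poly_pairs_add[OF AB]] by (simp add: eq)
    show "(x * x', y * y') \<in> ?G" using I[OF poly_pairs_mult[OF AB]] by (simp add: eq)
    show "(x - x', y - y') \<in> ?G" using I[OF poly_pairs_diff[OF AB]] by (simp add: eq)
  qed
  show "G \<subseteq> ?G"
  proof (clarify)
    fix x y assume "(x, y) \<in> G"
    thus "(x, y) \<in> ?G" using I[OF poly_pairs_const[of x y]] by simp
  qed
  show "(\<alpha>, \<omega>) \<in> ?G"
    using I[OF poly_pairs_monom[OF partial_hom_1, of 1]] by (simp add: poly_monom)
qed

end

locale maximal_partial_hom =
  fixes G :: "('b::field \<times> 'a::alg_closed_field) set"
  assumes G: "partial_hom G"
    and maximal: "\<And>H. partial_hom H \<Longrightarrow> G \<subseteq> H \<Longrightarrow> H = G"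
begin

lemma extend:
  "(\<And>A B. (A, B) \<in> poly_pairs G \<Longrightarrow> poly A \<alpha> = 0 \<Longrightarrow> poly B \<omega> = 0) \<Longrightarrow> (\<alpha>, \<omega>) \<in> G"
  using partial_hom_extend[OF G, of \<alpha> \<omega>] maximal by blast

text \<open>A consequence of maximality: multiplied by x^d, a polynomial relation for the inverse of
  x becomes a relation inside \<open>G\<close>, so sending it to the inverse of y is
  consistent.\<close>

lemma inverse_in:
  assumes xy: "(x, y) \<in> G" and "y \<noteq> 0"
  shows "(inverse x, inverse y) \<in> G"
proof (rule extend)
  fix A B assume AB: "(A, B) \<in> poly_pairs G" and A: "poly A (inverse x) = 0"
  have "x \<noteq> 0" using xy \<open>y \<noteq> 0\<close> partial_hom_zeroD[OF G] by auto
  define d where "d = max (degree A) (degree B)"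
  have *: "z ^ d * poly C (inverse z) = (\<Sum>i\<le>d. coeff C i * z ^ (d - i))"
    if "z \<noteq> 0" "degree C \<le> d" for C and z :: "'c::field"
  proof -
    have "poly C (inverse z) = (\<Sum>i\<le>d. coeff C i * inverse z ^ i)"
      unfolding poly_altdef using that(2)
      by (intro sum.mono_neutral_left) (auto simp: coeff_eq_0)
    moreover have "z ^ d * (coeff C i * inverse z ^ i) = coeff C i * z ^ (d - i)" if "i \<le> d" for i
      using that \<open>z \<noteq> 0\<close> by (simp add: power_diff power_inverse field_simps)
    ultimately show ?thesis unfolding sum_distrib_left by (auto simp: sum_distrib_left intro!: sum.cong)
  qed
  have "(x ^ d * poly A (inverse x), y ^ d * poly B (inverse y)) \<in> G"
    using AB \<open>x \<noteq> 0\<close> \<open>y \<noteq> 0\<close>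
    by (subst (1 2) *)
       (auto simp: d_def poly_pairs_def intro!: partial_hom_sum[OF G] partial_hom_mult[OF G]
          partial_hom_power[OF G] xy)
  hence "y ^ d * poly B (inverse y) = 0"
    by (intro partial_hom_zeroD[OF G]) (simp add: A)
  thus "poly B (inverse y) = 0" using \<open>y \<noteq> 0\<close> by (metis mult_eq_0_iff power_not_zero)
qed

text \<open>Chevalley's lemma. A polynomial that reduces to \<open>1\<close> and vanishes at
  \<alpha> says that the elements of zero reduction generate the unit ideal once \<alpha> is
  adjoined. If this held for \<alpha> and for its inverse, subtracting a multiple of the reversed
  shorter relation from the longer one would lower the total degree forever.\<close>

lemma no_double_relation:
  assumes "(A, 1) \<in> poly_pairs G" "poly A \<alpha> = 0"
    and "(A', 1) \<in> poly_pairs G" "poly A' (inverse \<alpha>) = 0" and "\<alpha> \<noteq> 0"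
  shows False
  using assms
proof (induction "degree A + degree A'" arbitrary: A A' \<alpha> rule: less_induct)
  case (less A0 A0' \<alpha>0)
  have core: False
    if le: "degree A' \<le> degree A" "degree A + degree A' = degree A0 + degree A0'"
      and prems: "(A, 1) \<in> poly_pairs G" "poly A \<alpha> = 0"
        "(A', 1) \<in> poly_pairs G" "poly A' (inverse \<alpha>) = 0" "\<alpha> \<noteq> 0" for A A' \<alpha>
  proof -
    define m n where "m = degree A" and "n = degree A'"
    have mn: "n \<le> m" using le(1) by (simp add: m_def n_def)
    have cA: "(coeff A i, of_bool (i = 0)) \<in> G" for i
      using prems(1) by (simp add: poly_pairs_def)
    have cA': "(coeff A' i, of_bool (i = 0)) \<in> G" for i
      using prems(3) by (simp add: poly_pairs_def)
    have nz: "A' \<noteq> 0"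
      using cA'[of 0] partial_hom_zeroD[OF G, of 1] by auto
    have "n > 0"
    proof (rule ccontr)
      assume "\<not> n > 0"
      then obtain c where "A' = [:c:]" using degree_eq_zeroE[of A'] unfolding n_def by blast
      thus False using prems(4) nz by simp
    qed
    define c where "c = coeff A' 0"
    have c: "(inverse c, 1) \<in> G"
      using inverse_in[OF cA'[of 0]] by (simp add: c_def)
    have "c \<noteq> 0" using cA'[of 0] partial_hom_zeroD[OF G, of 1] by (auto simp: c_def)
    \<comment> \<open>The reversal of \<open>A'\<close> made monic: it vanishes at \<alpha> and
      reduces to X^n.\<close>
    define R where "R = (\<Sum>i\<le>n. monom (inverse c * coeff A' i) (n - i))"
    have R_pair: "(R, monom 1 n) \<in> poly_pairs G"
    proof -
      have "coeff R j = (if j \<le> n then inverse c * coeff A' (n - j) else 0)" for j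
      proof -
        have "coeff R j = (\<Sum>i\<le>n. if n - i = j then inverse c * coeff A' i else 0)"
          by (simp add: R_def coeff_sum)
        also have "\<dots> = (\<Sum>i\<in>(if j \<le> n then {n - j} else {}). inverse c * coeff A' i)"
          by (intro sum.mono_neutral_cong_right) (auto split: if_splits)
        finally show ?thesis by simp
      qed
      note cR = this
      have "(coeff R i, coeff (monom 1 n) i) \<in> G" for i
        using partial_hom_mult[OF G c cA'[of "n - i"]] by (auto simp: cR partial_hom_0[OF G])
      thus ?thesis
        by (auto simp: poly_pairs_def)
    qed
    have R_deg: "degree R \<le> n"
      unfolding R_def by (intro degree_sum_le) (auto intro: order.trans[OF degree_monom_le])
    have R_lead: "coeff R n = 1"
      using \<open>c \<noteq> 0\<close> unfolding R_def coeff_sum coeff_monom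
      by (subst sum.mono_neutral_cong_right[of _ "{0}" _ "\<lambda>i. inverse c * coeff A' i"])
         (auto simp: c_def)
    have R_root: "poly R \<alpha> = 0"
    proof -
      have "poly R \<alpha> = (\<Sum>i\<le>n. inverse c * coeff A' i * \<alpha> ^ (n - i))"
        by (simp add: R_def poly_sum poly_monom)
      also have "\<dots> = inverse c * \<alpha> ^ n * (\<Sum>i\<le>n. coeff A' i * inverse \<alpha> ^ i)"
        using \<open>\<alpha> \<noteq> 0\<close> unfolding sum_distrib_left
        by (intro sum.cong) (auto simp: power_diff power_inverse field_simps)
      also have "(\<Sum>i\<le>n. coeff A' i * inverse \<alpha> ^ i) = 0"
        using prems(4) by (simp add: poly_altdef n_def)
      finally show ?thesis by simp
    qed
    \<comment> \<open>The leading coefficient of \<open>A\<close> reduces to 0 because m > 0, so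
      cancelling the leading term leaves the reduction equal to \<open>1\<close>.\<close>
    define A2 where "A2 = A - monom (coeff A m) (m - n) * R"
    have "coeff (monom (coeff A m) (m - n) * R) m = coeff A m"
      using mn R_lead by (simp add: coeff_monom_mult)
    hence "coeff A2 m = 0" by (simp add: A2_def)
    moreover have "degree A2 \<le> m"
      unfolding A2_def
    proof (rule degree_diff_le)
      have "degree (monom (coeff A m) (m - n) * R) \<le> degree (monom (coeff A m) (m - n)) + degree R"
        by (rule degree_mult_le)
      also have "\<dots> \<le> (m - n) + n" by (intro add_mono R_deg degree_monom_le)
      finally show "degree (monom (coeff A m) (m - n) * R) \<le> m" using mn by simp
    qed (simp add: m_def)
    ultimately have deg: "degree A2 < m"
      using \<open>n > 0\<close> mn by (metis degree_0 eq_zero_or_degree_less less_le_trans)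
    have "(monom (coeff A m) (m - n), monom 0 (m - n)) \<in> poly_pairs G"
      using cA[of m] \<open>n > 0\<close> mn by (intro poly_pairs_monom[OF G]) auto
    from poly_pairs_diff[OF G prems(1) poly_pairs_mult[OF G this R_pair]]
    have "(A2, 1) \<in> poly_pairs G" by (simp add: A2_def)
    moreover have "poly A2 \<alpha> = 0" using R_root prems(2) by (simp add: A2_def)
    ultimately show False
      using less.hyps[of A2 A' \<alpha>] prems le deg by (auto simp: m_def)
  qed
  show False
    using core[of A0' A0 \<alpha>0] core[of A0 A0' "inverse \<alpha>0"] less.prems
      nat_le_linear[of "degree A0" "degree A0'"] by (auto simp: add.commute)
qed

text \<open>\<open>I\<close> is the ideal of reductions of relations satisfied by \<alpha>. Leading
  coefficients lift to units, so division with remainder can be carried out on pairs, and a root of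
  a nonzero element of least degree is a root of all of \<open>I\<close>; such a root is an
  admissible image of \<alpha>. If that element is constant, it scales to a relation with reduction
  \<open>1\<close>.\<close>

lemma root_or_unit_relation:
  shows "(\<exists>\<omega>. (\<alpha>, \<omega>) \<in> G) \<or> (\<exists>A. (A, 1) \<in> poly_pairs G \<and> poly A \<alpha> = 0)"
proof -
  define I where "I = {B. \<exists>A. (A, B) \<in> poly_pairs G \<and> poly A \<alpha> = 0}"
  show ?thesis
  proof (cases "I \<subseteq> {0}")
    case True
    \<comment> \<open>No relation constrains the image of \<alpha>, so 0 serves.\<close>
    hence "(\<alpha>, 0) \<in> G" by (intro extend) (auto simp: I_def)
    thus ?thesis by blast
  next
    case False
    then obtain B where B: "B \<in> I" "B \<noteq> 0" and min: "\<And>C. C \<in> I \<Longrightarrow> C \<noteq> 0 \<Longrightarrow> degree B \<le> degree C"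
      using ex_has_least_nat[of "\<lambda>B. B \<in> I \<and> B \<noteq> 0" _ degree] by blast
    then obtain A where A: "(A, B) \<in> poly_pairs G" "poly A \<alpha> = 0" by (auto simp: I_def)
    have lc: "(inverse (coeff A (degree B)), inverse (lead_coeff B)) \<in> G"
      using A B by (intro inverse_in) (auto simp: poly_pairs_def)
    show ?thesis
    proof (cases "degree B = 0")
      case True
      then obtain b where b: "B = [:b:]" using degree_eq_zeroE by blast
      from poly_pairs_mult[OF G poly_pairs_const[OF G lc] A(1)]
      have "([:inverse (coeff A 0):] * A, 1) \<in> poly_pairs G" using B(2) by (simp add: b one_pCons)
      thus ?thesis using A(2) by (intro disjI2 exI[of _ "[:inverse (coeff A 0):] * A"]) auto
    next
      case False
      then obtain \<omega> where \<omega>: "poly B \<omega> = 0" using alg_closed_imp_poly_has_root[of B] by auto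
      have "poly C \<omega> = 0" if "C \<in> I" for C
        using that
      proof (induction "degree C" arbitrary: C rule: less_induct)
        case less
        show ?case
        proof (cases "C = 0")
          case False
          hence dC: "degree B \<le> degree C" using min less.prems by blast
          obtain A' where A': "(A', C) \<in> poly_pairs G" "poly A' \<alpha> = 0"
            using less.prems by (auto simp: I_def)
          define k where "k = degree C - degree B"
          define c c' where "c = lead_coeff C * inverse (lead_coeff B)"
            and "c' = coeff A' (degree C) * inverse (coeff A (degree B))"
          have "(c', c) \<in> G"
            using A'(1) unfolding c_def c'_def
            by (intro partial_hom_mult[OF G] lc) (auto simp: poly_pairs_def)
          from poly_pairs_diff[OF G A'(1) poly_pairs_mult[OF G poly_pairs_monom[OF G this, of k] A(1)]]
          have I': "C - monom c k * B \<in> I"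
            unfolding I_def using A(2) A'(2) by force
          have "degree (monom c k * B) \<le> degree C"
            using degree_mult_le[of "monom c k" B] degree_monom_le[of c k] dC
            by (simp add: k_def)
          moreover have "coeff (C - monom c k * B) (degree C) = 0"
            using dC B(2) by (simp add: coeff_monom_mult k_def c_def)
          ultimately have "degree (C - monom c k * B) < degree C \<or> C - monom c k * B = 0"
            by (metis degree_diff_le eq_zero_or_degree_less le_refl)
          hence "poly (C - monom c k * B) \<omega> = 0"
            using less.hyps[OF _ I'] by auto
          thus ?thesis using \<omega> by simp
        qed simp
      qed
      hence "(\<alpha>, \<omega>) \<in> G" by (intro extend) (auto simp: I_def)
      thus ?thesis by blast
    qed
  qed
qed

lemma valuation_ring: "(\<exists>\<omega>. (\<alpha>, \<omega>) \<in> G) \<or> (inverse \<alpha>, 0) \<in> G"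
proof (cases "\<alpha> = 0")
  case True
  thus ?thesis using partial_hom_0[OF G] by auto
next
  case False
  show ?thesis
  proof (cases "\<exists>\<omega>. (\<alpha>, \<omega>) \<in> G")
    case not: False
    then obtain A where A: "(A, 1) \<in> poly_pairs G" "poly A \<alpha> = 0"
      using root_or_unit_relation[of \<alpha>] by auto
    have "\<nexists>A'. (A', 1) \<in> poly_pairs G \<and> poly A' (inverse \<alpha>) = 0"
      using no_double_relation[OF A _ _ False] by metis
    then obtain \<omega> where \<omega>: "(inverse \<alpha>, \<omega>) \<in> G"
      using root_or_unit_relation[of "inverse \<alpha>"] by metis
    hence "\<omega> = 0" using inverse_in[OF \<omega>] not by auto
    thus ?thesis using \<omega> by simp
  qed auto
qed

end

text \<open>A place of \<open>'b\<close> with values in \<open>'a\<close>; \<open>R\<close> is its valuation ring.\<close>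

locale place =
  fixes R :: "'b::field_char_0 set" and \<phi> :: "'b \<Rightarrow> 'a::field"
  assumes one_in [simp]: "1 \<in> R" and hom_one [simp]: "\<phi> 1 = 1"
    and add_in: "x \<in> R \<Longrightarrow> y \<in> R \<Longrightarrow> x + y \<in> R"
    and mult_in: "x \<in> R \<Longrightarrow> y \<in> R \<Longrightarrow> x * y \<in> R"
    and diff_in: "x \<in> R \<Longrightarrow> y \<in> R \<Longrightarrow> x - y \<in> R"
    and hom_add: "x \<in> R \<Longrightarrow> y \<in> R \<Longrightarrow> \<phi> (x + y) = \<phi> x + \<phi> y"
    and hom_mult: "x \<in> R \<Longrightarrow> y \<in> R \<Longrightarrow> \<phi> (x * y) = \<phi> x * \<phi> y"
    and hom_diff: "x \<in> R \<Longrightarrow> y \<in> R \<Longrightarrow> \<phi> (x - y) = \<phi> x - \<phi> y"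
    and not_in: "x \<notin> R \<Longrightarrow> inverse x \<in> R \<and> \<phi> (inverse x) = 0"

text \<open>Zorn's lemma starts from the graph of the integers, which is a partial homomorphism
  because \<open>'b\<close> has characteristic zero. The valuation ring is the domain of a maximal
  extension.\<close>

lemma place_exists:
  "\<exists>R (\<phi> :: 'b::field_char_0 \<Rightarrow> 'a::alg_closed_field). place R \<phi>"
proof -
  define G0 :: "('b \<times> 'a) set" where "G0 = range (\<lambda>n. (of_int n, of_int n))"
  have I: "(of_int n, of_int n) \<in> G0" for n by (auto simp: G0_def)
  have G0: "partial_hom G0"
    unfolding partial_hom_def
  proof (intro conjI allI impI)
    show "(1, 1) \<in> G0" using I[of 1] by simp
    fix y assume "(0, y) \<in> G0"
    thus "y = 0" by (auto simp: G0_def)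
  next
    fix x y x' y' assume "(x, y) \<in> G0" "(x', y') \<in> G0"
    then obtain m n where "x = of_int m" "y = of_int m" "x' = of_int n" "y' = of_int n"
      by (auto simp: G0_def)
    thus "(x + x', y + y') \<in> G0" "(x * x', y * y') \<in> G0" "(x - x', y - y') \<in> G0"
      using I[of "m + n"] I[of "m * n"] I[of "m - n"] by auto
  qed
  have "\<exists>M\<in>Collect partial_hom. \<forall>N\<in>Collect partial_hom. M \<subseteq> N \<longrightarrow> N = (M :: ('b \<times> 'a) set)"
  proof (rule subset_Zorn_nonempty)
    show "Collect (partial_hom :: ('b \<times> 'a) set \<Rightarrow> bool) \<noteq> {}" using G0 by auto
    fix C :: "('b \<times> 'a) set set"
    assume ne: "C \<noteq> {}" and C: "subset.chain (Collect partial_hom) C"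
    have ph: "partial_hom H" if "H \<in> C" for H using C that by (auto simp: subset.chain_def)
    have two: "\<exists>H\<in>C. a \<in> H \<and> b \<in> H" if "a \<in> \<Union>C" "b \<in> \<Union>C" for a b
    proof -
      obtain H1 H2 where H: "H1 \<in> C" "a \<in> H1" "H2 \<in> C" "b \<in> H2"
        using \<open>a \<in> \<Union>C\<close> \<open>b \<in> \<Union>C\<close> by blast
      hence "H1 \<subseteq> H2 \<or> H2 \<subseteq> H1" using subset.chain_total[OF C, of H1 H2] by blast
      thus ?thesis using H by blast
    qed
    show "\<Union>C \<in> (Collect partial_hom)"
      unfolding mem_Collect_eq partial_hom_def
    proof (intro conjI allI impI)
      show "(1, 1) \<in> \<Union>C" using ne ph partial_hom_1 by blast
      fix y assume "(0, y) \<in> \<Union>C"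
      thus "y = 0" using ph partial_hom_zeroD by blast
    next
      fix x y x' y' assume "(x, y) \<in> \<Union>C" "(x', y') \<in> \<Union>C"
      from two[OF this] obtain H where H: "H \<in> C" "(x, y) \<in> H" "(x', y') \<in> H" by blast
      note HC = UnionI[OF H(1)]
      show "(x + x', y + y') \<in> \<Union>C" "(x * x', y * y') \<in> \<Union>C" "(x - x', y - y') \<in> \<Union>C"
        using partial_hom_add[OF ph[OF H(1)] H(2,3), THEN HC] partial_hom_mult[OF ph[OF H(1)] H(2,3), THEN HC]
          partial_hom_diff[OF ph[OF H(1)] H(2,3), THEN HC] .
    qed
  qed
  then obtain G :: "('b \<times> 'a) set" where "maximal_partial_hom G"
    by (auto simp: maximal_partial_hom_def)
  then interpret maximal_partial_hom G .
  define \<phi> where "\<phi> = (\<lambda>x. THE y. (x, y) \<in> G)"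
  have \<phi>: "\<phi> x = y" if "(x, y) \<in> G" for x y
    unfolding \<phi>_def using that partial_hom_unique[OF G] by blast
  have "place (Domain G) \<phi>"
  proof
    show "1 \<in> Domain G" "\<phi> 1 = 1" using \<phi> partial_hom_1[OF G] by auto
  next
    fix x x' assume "x \<in> Domain G" "x' \<in> Domain G"
    then obtain y y' where *: "(x, y) \<in> G" "(x', y') \<in> G" by auto
    note ** = partial_hom_add[OF G *] partial_hom_mult[OF G *] partial_hom_diff[OF G *]
    show "x + x' \<in> Domain G" "x * x' \<in> Domain G" "x - x' \<in> Domain G" using ** by blast+
    show "\<phi> (x + x') = \<phi> x + \<phi> x'" "\<phi> (x * x') = \<phi> x * \<phi> x'" "\<phi> (x - x') = \<phi> x - \<phi> x'"
      using **[THEN \<phi>] *[THEN \<phi>] by simp_all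
  next
    fix x assume "x \<notin> Domain G"
    thus "inverse x \<in> Domain G \<and> \<phi> (inverse x) = 0"
      using valuation_ring[of x] \<phi> by auto
  qed
  thus ?thesis by blast
qed

section \<open>The valuation of a place above \<open>p\<close>\<close>

text \<open>Legendre's estimate v_p(n!) <= (n - 1)/(p - 1), by induction: the multiples of p up to n
  contribute p^m m! with m = n div p, and all other factors are prime to p.\<close>

lemma fact_multiplicity_bound:
  assumes p: "prime (p :: nat)" and "n \<ge> 1"
  shows "\<exists>v u. fact n = p ^ v * u \<and> \<not> p dvd u \<and> v * (p - 1) \<le> n - 1"
  using \<open>n \<ge> 1\<close>
proof (induction n rule: less_induct)
  case (less n)
  define m where "m = n div p"
  have p1: "p > 1" using p by (rule prime_gt_1_nat)
  have mn: "m < n" using less.prems p1 by (simp add: m_def)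
  define U where "U = {i\<in>{1..n}. \<not> p dvd i}"
  have split: "{1..n} = U \<union> (\<lambda>j. p * j) ` {1..m}"
  proof (intro equalityI subsetI)
    fix i assume i: "i \<in> {1..n}"
    show "i \<in> U \<union> (\<lambda>j. p * j) ` {1..m}"
    proof (cases "p dvd i")
      case True
      then obtain j where j: "i = p * j" ..
      have "j \<in> {1..m}"
        using i p1 unfolding j m_def by (auto simp: less_eq_div_iff_mult_less_eq mult.commute intro: Suc_leI)
      thus ?thesis using j by blast
    qed (use i in \<open>auto simp: U_def\<close>)
  next
    fix i assume "i \<in> U \<union> (\<lambda>j. p * j) ` {1..m}"
    thus "i \<in> {1..n}"
    proof
      assume "i \<in> (\<lambda>j. p * j) ` {1..m}"
      then obtain j where j: "i = p * j" "1 \<le> j" "j \<le> m" using p1 by auto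
      have "p * j \<le> p * m" using j by simp
      also have "\<dots> \<le> n" by (simp add: m_def)
      finally show ?thesis using j p1 by simp
    qed (auto simp: U_def)
  qed
  have "fact n = \<Prod>{1..n}" by (simp add: fact_prod)
  also have "\<dots> = \<Prod>U * \<Prod>((\<lambda>j. p * j) ` {1..m})"
    unfolding split by (rule prod.union_disjoint) (auto simp: U_def)
  also have "\<Prod>((\<lambda>j. p * j) ` {1..m}) = (\<Prod>j\<in>{1..m}. p * j)"
    using p1 by (subst prod.reindex) (auto simp: inj_on_def)
  also have "\<dots> = p ^ m * fact m" by (simp add: prod.distrib fact_prod)
  finally have fact: "fact n = \<Prod>U * (p ^ m * fact m)" .
  have U: "\<not> p dvd \<Prod>U"
  proof
    assume "p dvd \<Prod>U"
    moreover have "finite U" by (simp add: U_def)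
    ultimately obtain i where "i \<in> U" "p dvd i" using prime_dvd_prod_iff[of U p id] p by auto
    thus False by (simp add: U_def)
  qed
  show ?case
  proof (cases "m = 0")
    case True
    thus ?thesis using fact U by (intro exI[of _ 0] exI[of _ "\<Prod>U"]) auto
  next
    case False
    then obtain v u where vu: "fact m = p ^ v * u" "\<not> p dvd u" "v * (p - 1) \<le> m - 1"
      using less.IH[OF mn] by auto
    have "(m + v) * (p - 1) = m * (p - 1) + v * (p - 1)" by (rule add_mult_distrib)
    also have "\<dots> \<le> m * (p - 1) + (m - 1)" using vu by simp
    also have "\<dots> = m * p - 1" using False p1
      by (cases p) (auto simp: algebra_simps)
    also have "\<dots> \<le> n - 1" by (intro diff_le_mono) (simp add: m_def)
    finally show ?thesis
      using fact U vu p by (intro exI[of _ "m + v"] exI[of _ "\<Prod>U * u"])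
        (auto simp: power_add prime_dvd_mult_iff mult_ac)
  qed
qed

context place
begin

lemma zero_in [simp]: "0 \<in> R" and hom_zero [simp]: "\<phi> 0 = 0"
  using diff_in[of 1 1] hom_diff[of 1 1] by simp_all

lemma uminus_in: "x \<in> R \<Longrightarrow> - x \<in> R" and hom_uminus: "x \<in> R \<Longrightarrow> \<phi> (- x) = - \<phi> x"
  using diff_in[of 0 x] hom_diff[of 0 x] by simp_all

lemma sum_in: "(\<And>i. i \<in> I \<Longrightarrow> f i \<in> R) \<Longrightarrow> sum f I \<in> R"
  by (induction I rule: infinite_finite_induct) (auto intro: add_in)

lemma hom_sum: "(\<And>i. i \<in> I \<Longrightarrow> f i \<in> R) \<Longrightarrow> \<phi> (sum f I) = (\<Sum>i\<in>I. \<phi> (f i))"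
  by (induction I rule: infinite_finite_induct) (auto simp: hom_add sum_in)

lemma prod_in: "(\<And>i. i \<in> I \<Longrightarrow> f i \<in> R) \<Longrightarrow> prod f I \<in> R"
  by (induction I rule: infinite_finite_induct) (auto intro: mult_in)

lemma hom_prod: "(\<And>i. i \<in> I \<Longrightarrow> f i \<in> R) \<Longrightarrow> \<phi> (prod f I) = (\<Prod>i\<in>I. \<phi> (f i))"
  by (induction I rule: infinite_finite_induct) (auto simp: hom_mult prod_in)

lemma power_in: "x \<in> R \<Longrightarrow> x ^ n \<in> R"
  by (induction n) (auto intro: mult_in)

lemma hom_power: "x \<in> R \<Longrightarrow> \<phi> (x ^ n) = \<phi> x ^ n"
  by (induction n) (auto simp: hom_mult power_in)

lemma of_nat_in [simp]: "of_nat n \<in> R" and hom_of_nat [simp]: "\<phi> (of_nat n) = of_nat n"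
proof (induction n)
  case (Suc n)
  case 1 show ?case using Suc by (auto intro: add_in)
  case 2 show ?case using Suc by (auto simp: hom_add)
qed auto

lemma of_int_in [simp]: "of_int n \<in> R" and hom_of_int [simp]: "\<phi> (of_int n) = of_int n"
proof -
  have "of_int n \<in> R \<and> \<phi> (of_int n) = of_int n"
  proof (cases "n \<ge> 0")
    case True
    thus ?thesis using of_nat_in[of "nat n"] hom_of_nat[of "nat n"] by simp
  next
    case False
    hence "(of_int n :: 'b) = - of_nat (nat (- n))" "(of_int n :: 'a) = - of_nat (nat (- n))" by auto
    thus ?thesis by (simp only: uminus_in of_nat_in hom_uminus hom_of_nat)
  qed
  thus "of_int n \<in> R" "\<phi> (of_int n) = of_int n" by auto
qed

lemma inverse_in: "x \<in> R \<Longrightarrow> \<phi> x \<noteq> 0 \<Longrightarrow> inverse x \<in> R"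
  using not_in[of "inverse x"] unfolding inverse_inverse_eq by blast

text \<open>Otherwise the inverse of x would reduce to 0, and so would 1 = x^n (1/x)^n.\<close>

lemma root_in:
  assumes "x ^ n \<in> R" "n > 0"
  shows "x \<in> R"
proof (rule ccontr)
  assume "x \<notin> R"
  hence x: "inverse x \<in> R" "\<phi> (inverse x) = 0" using not_in[of x] by simp_all
  have "x \<noteq> 0" using \<open>x \<notin> R\<close> by auto
  have "\<phi> (x ^ n * inverse x ^ n) = \<phi> (x ^ n) * \<phi> (inverse x) ^ n"
    using assms x by (simp add: hom_mult power_in hom_power)
  also have "x ^ n * inverse x ^ n = 1" using \<open>x \<noteq> 0\<close> by (simp add: power_inverse)
  finally show False using assms x by (simp add: power_0_left)
qed

end

text \<open>
  \<open>V r x\<close> says that \<open>x\<close> has valuation at least \<open>r\<close>, where \<open>p\<close> has valuation \<open>1\<close>.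
  The exponents are rational because only rational powers of \<open>p\<close> are algebraic, and
  nothing is known about the position of transcendental numbers with respect to \<open>R\<close>.
\<close>

locale p_place = place R \<phi> for R :: "complex set" and \<phi> :: "complex \<Rightarrow> 'a::field" +
  fixes p :: nat
  assumes prime_p: "prime p" and of_nat_p: "of_nat p = (0 :: 'a)"
begin

lemma p_gt_1: "p > 1"
  using prime_p by (rule prime_gt_1_nat)

definition P :: "rat \<Rightarrow> complex" where
  "P r = of_real (real p powr of_rat r)"

definition V :: "rat \<Rightarrow> complex \<Rightarrow> bool" where
  "V r x \<longleftrightarrow> x * P (- r) \<in> R"

lemma P_0 [simp]: "P 0 = 1" and P_1: "P 1 = of_nat p"
  using p_gt_1 by (simp_all add: P_def)

lemma P_nonzero [simp]: "P r \<noteq> 0"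
  using p_gt_1 by (simp add: P_def)

lemma P_add: "P (r + s) = P r * P s"
  by (simp add: P_def of_rat_add powr_add)

lemma P_minus: "P (- r) = inverse (P r)"
  by (simp add: P_def of_rat_minus powr_minus)

lemma P_of_nat_mult: "P (of_nat n * r) = P r ^ n"
proof (induction n)
  case (Suc n)
  thus ?case by (simp add: distrib_right P_add)
qed simp

lemma P_of_nat: "P (of_nat n) = of_nat p ^ n"
  using P_of_nat_mult[of n 1] by (simp add: P_1)

text \<open>For r = a/b the number \<open>P r\<close> is a b-th root of p^a, so its position is
  decided by \<open>root_in\<close>. This is where the rationality of the exponents enters.\<close>

lemma P_in: "r \<ge> 0 \<Longrightarrow> P r \<in> R" and hom_P: "r > 0 \<Longrightarrow> \<phi> (P r) = 0"
proof -
  obtain a b :: nat where ab: "r \<ge> 0 \<Longrightarrow> r = of_nat a / of_nat b" "b > 0"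
  proof (cases r)
    case (Fract a b)
    thus ?thesis using that[of "nat a" "nat b"] that[of 0 1]
      by (cases "r \<ge> 0") (auto simp: Fract_of_int_quotient zero_le_divide_iff)
  qed
  have eq: "P r ^ b = of_nat p ^ a" if "r \<ge> 0"
  proof -
    have *: "of_nat b * r = of_nat a" using ab(1)[OF that] ab(2) by simp
    show ?thesis by (rule P_of_nat_mult[of b r, unfolded * P_of_nat, symmetric])
  qed
  show *: "P r \<in> R" if "r \<ge> 0"
    by (rule root_in[of _ b]) (use that ab(2) eq in \<open>auto intro: power_in\<close>)
  assume "r > 0"
  hence "a > 0" using ab by (cases a) auto
  have "\<phi> (P r) ^ b = \<phi> (P r ^ b)" using \<open>r > 0\<close> * by (simp add: hom_power)
  also have "\<dots> = of_nat p ^ a" using \<open>r > 0\<close> eq by (simp add: hom_power)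
  finally have "\<phi> (P r) ^ b = 0" using \<open>a > 0\<close> by (simp add: of_nat_p power_0_left)
  thus "\<phi> (P r) = 0" by simp
qed

lemma V_0: "V 0 x \<longleftrightarrow> x \<in> R"
  by (simp add: V_def)

lemma V_zero [simp]: "V r 0"
  by (simp add: V_def)

lemma V_add: "V r x \<Longrightarrow> V r y \<Longrightarrow> V r (x + y)"
  by (simp add: V_def distrib_right add_in)

lemma V_diff: "V r x \<Longrightarrow> V r y \<Longrightarrow> V r (x - y)"
  by (simp add: V_def left_diff_distrib diff_in)

lemma V_minus_iff [simp]: "V r (- x) \<longleftrightarrow> V r x"
  using V_diff[of r 0 x] V_diff[of r 0 "- x"] by auto

lemma V_minus_commute: "V r (x - y) \<longleftrightarrow> V r (y - x)"
  using V_minus_iff[of r "x - y"] by simp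

lemma V_sum: "(\<And>i. i \<in> I \<Longrightarrow> V r (f i)) \<Longrightarrow> V r (sum f I)"
  by (induction I rule: infinite_finite_induct) (auto intro: V_add)

lemma V_mult:
  assumes "V r x" "V s y"
  shows "V (r + s) (x * y)"
proof -
  have "x * y * P (- (r + s)) = (x * P (- r)) * (y * P (- s))"
    using P_add[of "-r" "-s"] by (simp add: mult_ac)
  thus ?thesis using mult_in[OF assms[unfolded V_def]] unfolding V_def by (simp only:)
qed

lemma V_P: "V r (P r)"
  by (simp add: V_def P_minus)

lemma V_mono:
  assumes "V r x" "s \<le> r"
  shows "V s x"
proof -
  have "P (- s) = P (- r) * P (r - s)" by (simp flip: P_add)
  hence eq: "x * P (- s) = (x * P (- r)) * P (r - s)" by simp
  thus ?thesis
    unfolding V_def eq using assms by (intro mult_in[of "x * P (- r)"] P_in) (simp_all add: V_def)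
qed

lemma V_mult_R: "V r x \<Longrightarrow> y \<in> R \<Longrightarrow> V r (x * y)" "V r x \<Longrightarrow> y \<in> R \<Longrightarrow> V r (y * x)"
  using V_mult[of r x 0 y] by (simp_all add: V_0 mult.commute)

lemma V_power: "V r x \<Longrightarrow> V (of_nat n * r) (x ^ n)"
proof (induction n)
  case (Suc n)
  thus ?case using V_mult[of r x "of_nat n * r" "x ^ n"] by (simp add: algebra_simps)
qed (simp add: V_0)

lemma V_prod: "(\<And>i. i \<in> I \<Longrightarrow> V (r i) (f i)) \<Longrightarrow> V (\<Sum>i\<in>I. r i) (\<Prod>i\<in>I. f i)"
  by (induction I rule: infinite_finite_induct) (auto intro: V_mult simp: V_0)

lemma V_root:
  assumes "V (of_nat n * r) (x ^ n)" "n > 0"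
  shows "V r x"
proof -
  have "(x * P (- r)) ^ n \<in> R"
    using assms P_of_nat_mult[of n "- r"] by (simp add: V_def power_mult_distrib)
  thus ?thesis unfolding V_def using assms(2) by (rule root_in)
qed

lemma V_in: "V r x \<Longrightarrow> r \<ge> 0 \<Longrightarrow> x \<in> R"
  using V_mono[of r x 0] by (simp add: V_0)

lemma V_hom_eq_0:
  assumes "V r x" "r > 0"
  shows "\<phi> x = 0"
proof -
  have x: "(x * P (- r)) * P r = x" by (simp add: P_minus)
  have "\<phi> ((x * P (- r)) * P r) = \<phi> (x * P (- r)) * \<phi> (P r)"
    using hom_mult[of "x * P (- r)" "P r"] assms P_in[of r] by (simp add: V_def)
  thus ?thesis using hom_P assms unfolding x by simp
qed

lemma not_V_1: "r > 0 \<Longrightarrow> \<not> V r 1"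
  using V_hom_eq_0[of r 1] by auto

lemma V_p: "V 1 (of_nat p)"
  using V_P[of 1] by (simp add: P_1)

lemma hom_coprime:
  assumes "\<not> p dvd u"
  shows "(of_nat u :: 'a) \<noteq> 0"
proof
  assume 0: "(of_nat u :: 'a) = 0"
  have "coprime p u" using prime_p assms by (simp add: prime_imp_coprime)
  hence "coprime (int p) (int u)" by simp
  then obtain a b where ab: "a * int p + b * int u = 1"
    using bezout_int[of "int p" "int u"] by auto
  have "(of_int (a * int p + b * int u) :: 'a) = 0" by (simp add: 0 of_nat_p)
  thus False by (simp only: ab) simp
qed

text \<open>The bridge from valuations to absolute values. The part of z prime to p is invertible in
  \<open>R\<close>, so the valuation is that of the exact power of p dividing z, and this power is
  at most the absolute value of z.\<close>

lemma V_int_bound: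
  assumes V: "V r (of_int z)" and "z \<noteq> 0"
  shows "real p powr of_rat r \<le> \<bar>of_int z\<bar>"
proof -
  define m where "m = nat \<bar>z\<bar>"
  have m: "m \<noteq> 0" "\<bar>of_int z\<bar> = real m" using \<open>z \<noteq> 0\<close> by (simp_all add: m_def)
  have Vm: "V r (of_nat m)"
    using V by (cases "z \<ge> 0") (auto simp: m_def)
  obtain u where u: "m = p ^ multiplicity p m * u" "\<not> p dvd u"
  proof (rule multiplicity_decompose'[of m p])
    show "m \<noteq> 0" "\<not> is_unit p" using m prime_p by auto
  qed
  have "inverse (of_nat u) \<in> R" using u hom_coprime by (intro inverse_in) auto
  hence "V r (of_nat m * inverse (of_nat u))" using Vm by (intro V_mult_R)
  also have "of_nat m * inverse (of_nat u :: complex) = of_nat p ^ multiplicity p m"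
  proof -
    have "u \<noteq> 0" using u(2) by (cases u) auto
    moreover have "of_nat m = (of_nat p ^ multiplicity p m * of_nat u :: complex)"
      by (subst u(1)) (simp only: of_nat_mult of_nat_power)
    ultimately show ?thesis by (simp add: field_simps)
  qed
  finally have "P (of_nat (multiplicity p m) - r) \<in> R"
    by (simp add: V_def P_add[of _ "- r", simplified] P_of_nat)
  moreover have "of_nat (multiplicity p m) - r \<ge> 0"
  proof (rule ccontr)
    assume neg: "\<not> ?thesis"
    have "V (- (of_nat (multiplicity p m) - r)) 1"
      unfolding V_def minus_minus using calculation by simp
    thus False using neg not_V_1 by auto
  qed
  ultimately have "r \<le> of_nat (multiplicity p m)" by simp
  hence "of_rat r \<le> (of_rat (of_nat (multiplicity p m)) :: real)"
    unfolding of_rat_less_eq .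
  hence "real p powr of_rat r \<le> real p powr real (multiplicity p m)"
    using p_gt_1 by (intro powr_mono) auto
  also have "\<dots> = real (p ^ multiplicity p m)" using p_gt_1 by (simp add: powr_realpow)
  also have "\<dots> \<le> real m"
    using multiplicity_dvd[of p m] m by (intro of_nat_mono dvd_imp_le) auto
  finally show ?thesis using m by simp
qed

lemma V_inverse_fact:
  assumes "n \<ge> 1"
  shows "V (- (of_nat (n - 1) / of_nat (p - 1))) (inverse (fact n))"
proof -
  obtain v u where vu: "fact n = p ^ v * u" "\<not> p dvd u" "v * (p - 1) \<le> n - 1"
    using fact_multiplicity_bound[OF prime_p assms] by blast
  have "inverse (of_nat u) \<in> R" using vu hom_coprime by (intro inverse_in) auto
  hence "V (- of_nat v + 0) (P (- of_nat v) * inverse (of_nat u))"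
    by (intro V_mult) (auto simp: V_P V_0)
  also have "P (- of_nat v) * inverse (of_nat u) = inverse (fact n)"
  proof -
    have "(fact n :: complex) = of_nat (fact n)" by simp
    also have "\<dots> = of_nat p ^ v * of_nat u" by (simp only: vu of_nat_mult of_nat_power)
    finally show ?thesis by (simp add: P_minus P_of_nat)
  qed
  finally show ?thesis
  proof (rule V_mono)
    have "of_nat v * of_nat (p - 1) \<le> (of_nat (n - 1) :: rat)"
      using vu(3) unfolding of_nat_mult[symmetric] of_nat_le_iff .
    moreover have "(of_nat (p - 1) :: rat) > 0" using p_gt_1 by simp
    ultimately show "- (of_nat (n - 1) / of_nat (p - 1)) \<le> (- of_nat v + 0 :: rat)"
      by (simp add: pos_le_divide_eq del: of_nat_diff)
  qed
qed

end

section \<open>The Skolem--Mahler--Lech theorem\<close>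

text \<open>\<open>divisible_at l e q\<close>: the rational number \<open>q\<close> lies in \<open>l\<^sup>e \<int>\<^sub>(\<^sub>l\<^sub>)\<close>.\<close>

definition divisible_at :: "nat \<Rightarrow> nat \<Rightarrow> rat \<Rightarrow> bool" where
  "divisible_at l e q \<longleftrightarrow> (\<exists>a b. \<not> int l dvd b \<and> q * of_int b = of_int (int l ^ e * a))"

lemma divisible_at_0: "prime l \<Longrightarrow> divisible_at l e 0"
  using prime_gt_1_nat[of l] by (auto simp: divisible_at_def intro!: exI[of _ "0::int"] exI[of _ "1::int"])

lemma divisible_at_add:
  assumes "prime l" "divisible_at l e x" "divisible_at l e y"
  shows "divisible_at l e (x + y)"
proof -
  obtain a b a' b' where *: "\<not> int l dvd b" "x * of_int b = of_int (int l ^ e * a)"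
    "\<not> int l dvd b'" "y * of_int b' = of_int (int l ^ e * a')"
    using assms by (auto simp: divisible_at_def)
  have "(x + y) * of_int (b * b') = (x * of_int b) * of_int b' + (y * of_int b') * of_int b"
    by (simp add: algebra_simps)
  also have "\<dots> = of_int (int l ^ e * (a * b' + a' * b))"
    unfolding * by (simp add: algebra_simps)
  finally have "(x + y) * of_int (b * b') = of_int (int l ^ e * (a * b' + a' * b))" .
  moreover have "\<not> int l dvd b * b'" using * assms(1) by (simp add: prime_dvd_mult_iff)
  ultimately show ?thesis unfolding divisible_at_def by blast
qed

lemma divisible_at_mult_int:
  assumes "divisible_at l e x"
  shows "divisible_at l e (of_int z * x)"
proof -
  obtain a b where *: "\<not> int l dvd b" "x * of_int b = of_int (int l ^ e * a)"
    using assms by (auto simp: divisible_at_def)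
  have "of_int z * x * of_int b = of_int (int l ^ e * (z * a))"
    using * by (simp add: mult.assoc mult.left_commute)
  thus ?thesis unfolding divisible_at_def using *(1) by blast
qed

lemma divisible_at_sum:
  assumes "prime l" "\<And>i. i \<in> I \<Longrightarrow> divisible_at l e (f i)"
  shows "divisible_at l e (sum f I)"
  using assms(2) by (induction I rule: infinite_finite_induct)
    (auto intro: divisible_at_0 divisible_at_add assms(1))

lemma divisible_at_int:
  assumes "prime l" "divisible_at l e (of_int z)"
  shows "int l ^ e dvd z"
proof -
  obtain a b where *: "\<not> int l dvd b" "(of_int z :: rat) * of_int b = of_int (int l ^ e * a)"
    using assms by (auto simp: divisible_at_def)
  hence "of_int (z * b) = (of_int (int l ^ e * a) :: rat)" by simp
  hence "z * b = int l ^ e * a" by (simp only: of_int_eq_iff)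
  hence "int l ^ e dvd z * b" by simp
  moreover have "coprime (int l ^ e) b"
    using * assms(1) by (simp add: prime_imp_coprime)
  ultimately show ?thesis by (simp add: coprime_dvd_mult_left_iff)
qed

text \<open>For l >= 3 Legendre's estimate gives v_l(i!) <= (i - 1)/2, so at least half of the power
  of l survives.\<close>

lemma divisible_at_power_div_fact:
  assumes l: "prime l" "l \<ge> 3" and e: "e \<le> i div 2"
  shows "divisible_at l e (of_nat l ^ i / fact i)"
proof (cases "i = 0")
  case True
  thus ?thesis using e l(2) by (auto simp: divisible_at_def intro!: exI[of _ "1::int"])
next
  case False
  then obtain v u where vu: "fact i = l ^ v * u" "\<not> l dvd u" "v * (l - 1) \<le> i - 1"
    using fact_multiplicity_bound[OF l(1), of i] by auto
  have "v * 2 \<le> v * (l - 1)" using l(2) by (intro mult_left_mono) auto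
  hence "v + e \<le> i" using vu(3) e by linarith
  have "(fact i :: rat) = of_nat (fact i)" by simp
  also have "\<dots> = of_nat l ^ v * of_nat u" by (simp only: vu(1) of_nat_mult of_nat_power)
  finally have f: "(fact i :: rat) = of_nat l ^ v * of_nat u" .
  have "u \<noteq> 0" using vu(2) by (cases u) auto
  have "of_nat l ^ i / fact i * of_int (int u) = (of_nat l ^ i / of_nat l ^ v :: rat)"
    using \<open>u \<noteq> 0\<close> by (simp add: f)
  also have "\<dots> = of_nat l ^ (e + (i - v - e))"
    using \<open>v + e \<le> i\<close> l(2) by (simp add: power_diff)
  also have "\<dots> = of_int (int l ^ e * int l ^ (i - v - e))"
    by (simp add: power_add)
  finally show ?thesis unfolding divisible_at_def using vu(2)
    by (intro exI[of _ "int l ^ (i - v - e)"] exI[of _ "int u"]) auto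
qed

text \<open>Coefficients of the quotient obey q_n = a_(n+1) + t q_(n+1), a recursion descending from
  the degree. Each root divided out lowers the threshold index by one.\<close>

lemma divisible_at_coeff_quotient:
  fixes Q :: "rat poly"
  assumes l: "prime l" and P: "\<And>j. j \<ge> Suc k \<Longrightarrow> divisible_at l e (coeff ([:- of_int t, 1:] * Q) j)"
    and "j \<ge> k"
  shows "divisible_at l e (coeff Q j)"
proof (cases "j \<le> degree Q")
  case True
  thus ?thesis using \<open>j \<ge> k\<close>
  proof (induction j rule: inc_induct)
    case base
    have "coeff ([:- of_int t, 1:] * Q) (Suc (degree Q)) = coeff Q (degree Q)"
      by (simp add: coeff_eq_0)
    thus ?case using P[of "Suc (degree Q)"] base by (simp add: coeff_eq_0)
  next
    case (step n)
    have "coeff Q n = coeff ([:- of_int t, 1:] * Q) (Suc n) + of_int t * coeff Q (Suc n)"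
      by simp
    also have "divisible_at l e \<dots>"
      using step by (intro divisible_at_add l divisible_at_mult_int P) auto
    finally show ?case .
  qed
qed (simp add: coeff_eq_0 divisible_at_0 l)

lemma divisible_at_split_roots:
  fixes A :: "rat poly"
  assumes l: "prime l" and T: "finite T" "\<And>t. t \<in> T \<Longrightarrow> poly A (of_int t) = 0"
    and A: "\<And>j. j \<ge> card T \<Longrightarrow> divisible_at l e (coeff A j)"
  shows "\<exists>Q. A = (\<Prod>t\<in>T. [:- of_int t, 1:]) * Q \<and> (\<forall>j. divisible_at l e (coeff Q j))"
  using T A
proof (induction T arbitrary: A rule: finite_induct)
  case empty
  thus ?case by (intro exI[of _ A]) auto
next
  case (insert t T)
  have "poly A (of_int t) = 0" using insert.prems by auto
  then obtain A' where A': "A = [:- of_int t, 1:] * A'"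
    by (auto simp: poly_eq_0_iff_dvd elim!: dvdE)
  have "\<exists>Q. A' = (\<Prod>t\<in>T. [:- of_int t, 1:]) * Q \<and> (\<forall>j. divisible_at l e (coeff Q j))" (is "\<exists>Q. _ = ?p * Q \<and> _")
  proof (rule insert.IH)
    fix s assume s: "s \<in> T"
    hence "poly A (of_int s) = 0" "s \<noteq> t" using insert by auto
    thus "poly A' (of_int s) = 0" by (simp add: A')
  next
    fix j assume "j \<ge> card T"
    thus "divisible_at l e (coeff A' j)"
    proof (rule divisible_at_coeff_quotient[OF l, of "card T" e t, rotated])
      fix j assume "Suc (card T) \<le> j"
      thus "divisible_at l e (coeff ([:- of_int t, 1:] * A') j)"
        unfolding A'[symmetric] using insert.prems(2) insert.hyps by simp
    qed
  qed
  then obtain Q where "A' = ?p * Q" "\<forall>j. divisible_at l e (coeff Q j)" by blast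
  moreover from this have "A = (\<Prod>t\<in>insert t T. [:- of_int t, 1:]) * Q"
    unfolding A' by (simp only: prod.insert[OF insert.hyps(1,2)] mult.assoc)
  ultimately show ?case by blast
qed

text \<open>
  Hansel's argument: dividing an interpolating polynomial by its known integer roots preserves
  the divisibility of its high coefficients.
\<close>

lemma newton_series_infinitely_many_zeros:
  fixes \<beta> :: "nat \<Rightarrow> int"
  assumes l: "prime l" "l \<ge> 3"
    and u: "\<And>n. u n = (\<Sum>i\<le>n. of_nat (n choose i) * int l ^ i * \<beta> i)"
    and inf: "infinite {n. u n = 0}"
  shows "u n = 0"
proof (rule ccontr)
  assume un: "u n \<noteq> 0"
  \<comment> \<open>With this many zeros, u n turns out divisible by l^(k div 2), whose exponent is
    the absolute value of u n; a nonzero integer cannot be that divisible.\<close>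
  define k where "k = 2 * nat \<bar>u n\<bar>"
  obtain T where T: "T \<subseteq> {n. u n = 0}" "finite T" "card T = k"
    using infinite_arbitrarily_large[OF inf] by blast
  define m where "m = Max (insert n T)"
  have m: "n \<le> m" "\<And>t. t \<in> T \<Longrightarrow> t \<le> m" using T(2) by (auto simp: m_def)
  define F :: "nat \<Rightarrow> rat poly" where "F = (\<lambda>i. \<Prod>s<i. [:- of_nat s, 1:])"
  \<comment> \<open>The Newton interpolation polynomial: \<open>F i\<close> divided by i! is the
    binomial coefficient of index i, so \<open>A\<close> agrees with u on 0, ..., m.\<close>
  define A where "A = (\<Sum>i\<le>m. smult (of_nat l ^ i / fact i * of_int (\<beta> i)) (F i))"
  have F_eval: "poly (F i) (of_nat t) / fact i = of_nat (t choose i)" for i t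
    by (simp add: F_def poly_prod binomial_gbinomial gbinomial_prod_rev atLeast0LessThan)
  have A_eval: "poly A (of_nat t) = of_int (u t)" if "t \<le> m" for t
  proof -
    have "poly A (of_nat t) = (\<Sum>i\<le>m. of_int (int l ^ i * \<beta> i) * (poly (F i) (of_nat t) / fact i))"
      by (simp add: A_def poly_sum field_simps)
    also have "\<dots> = (\<Sum>i\<le>m. of_int (of_nat (t choose i) * int l ^ i * \<beta> i))"
      unfolding F_eval by (simp add: mult_ac)
    also have "\<dots> = (\<Sum>i\<le>t. of_int (of_nat (t choose i) * int l ^ i * \<beta> i))"
      using that by (intro sum.mono_neutral_right) (auto simp: binomial_eq_0)
    finally show ?thesis by (simp only: u of_int_sum)
  qed
  have F_int: "\<exists>z. coeff (F i) j = of_int z" for i j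
  proof (induction i arbitrary: j)
    case 0
    show ?case by (auto simp: F_def coeff_1 intro: exI[of _ "of_bool (j = 0)"])
  next
    case (Suc i)
    obtain z z' where z: "coeff (F i) j = of_int z" "coeff (F i) (j - 1) = of_int z'"
      using Suc by metis
    have "F (Suc i) = [:- of_nat i, 1:] * F i" by (simp add: F_def mult.commute)
    hence "coeff (F (Suc i)) j = of_int ((if j = 0 then 0 else z') - int i * z)"
      using z by (cases j) auto
    thus ?case by blast
  qed
  have F_deg: "degree (F i) \<le> i" for i
    unfolding F_def by (rule order.trans[OF degree_prod_sum_le]) auto
  \<comment> \<open>Since \<open>F i\<close> has degree at most i, only terms with i >= j >= k
    contribute.\<close>
  have "divisible_at l (k div 2) (coeff A j)" if "j \<ge> k" for j
    unfolding A_def coeff_sum coeff_smult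
  proof (intro divisible_at_sum l)
    fix i assume "i \<in> {..m}"
    obtain z where z: "coeff (F i) j = of_int z" using F_int by blast
    show "divisible_at l (k div 2) (of_nat l ^ i / fact i * of_int (\<beta> i) * coeff (F i) j)"
    proof (cases "i < j")
      case True
      hence "coeff (F i) j = 0" using F_deg[of i] by (intro coeff_eq_0) auto
      thus ?thesis by (simp add: divisible_at_0 l)
    next
      case False
      have "of_nat l ^ i / fact i * of_int (\<beta> i) * coeff (F i) j = of_int (\<beta> i * z) * (of_nat l ^ i / fact i)"
        by (simp add: z)
      also have "divisible_at l (k div 2) \<dots>"
        using False that by (intro divisible_at_mult_int divisible_at_power_div_fact l div_le_mono) auto
      finally show ?thesis .
    qed
  qed
  moreover have "poly A (of_int t) = 0" if "t \<in> int ` T" for t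
    using that A_eval m(2) T(1) by auto
  moreover have "card (int ` T) = k" using T(3) by (subst card_image) auto
  ultimately obtain Q where Q: "A = (\<Prod>t\<in>int ` T. [:- of_int t, 1:]) * Q"
      "\<And>j. divisible_at l (k div 2) (coeff Q j)"
    using divisible_at_split_roots[OF l(1), of "int ` T" A "k div 2"] T(2) by auto
  have "poly Q (of_int (int n)) = (\<Sum>j\<le>degree Q. of_int (int n ^ j) * coeff Q j)"
    by (simp add: poly_altdef mult.commute)
  also have "divisible_at l (k div 2) \<dots>"
    by (intro divisible_at_sum divisible_at_mult_int Q l)
  finally have "divisible_at l (k div 2) (of_int (\<Prod>t\<in>int ` T. int n - t) * poly Q (of_int (int n)))"
    by (rule divisible_at_mult_int)
  also have "of_int (\<Prod>t\<in>int ` T. int n - t) * poly Q (of_int (int n)) = poly A (of_nat n)"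
    by (subst Q(1)) (simp add: poly_prod)
  also have "\<dots> = of_int (u n)" using m(1) by (rule A_eval)
  finally have dvd: "int l ^ (k div 2) dvd u n" by (rule divisible_at_int[OF l(1)])
  have "nat \<bar>u n\<bar> < 2 ^ nat \<bar>u n\<bar>" by (rule less_exp)
  also have "\<dots> \<le> l ^ nat \<bar>u n\<bar>" using l(2) by (intro power_mono) auto
  finally have "\<bar>u n\<bar> < int l ^ (k div 2)"
    by (simp add: k_def nat_less_iff)
  thus False using dvd un zdvd_imp_le[of "int l ^ (k div 2)" "\<bar>u n\<bar>"] by simp
qed

section \<open>Virtual periodicity and linear recurrences\<close>

definition virtually_periodic :: "(nat \<Rightarrow> 'a) \<Rightarrow> bool" where
  "virtually_periodic s \<longleftrightarrow> (\<exists>N r. r > 0 \<and> (\<forall>k\<ge>N. s (k + r) = s k))"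

lemma virtually_periodicI: "r > 0 \<Longrightarrow> (\<And>k. k \<ge> N \<Longrightarrow> s (k + r) = s k) \<Longrightarrow> virtually_periodic s"
  unfolding virtually_periodic_def by blast

lemma virtually_periodic_shift: "virtually_periodic (\<lambda>k. s (m + k)) \<Longrightarrow> virtually_periodic s"
proof -
  assume "virtually_periodic (\<lambda>k. s (m + k))"
  then obtain N r where r: "r > 0" "\<And>k. k \<ge> N \<Longrightarrow> s (m + (k + r)) = s (m + k)"
    by (auto simp: virtually_periodic_def)
  show ?thesis
  proof (rule virtually_periodicI[of r "m + N"])
    fix k assume "k \<ge> m + N"
    thus "s (k + r) = s k" using r(2)[of "k - m"] by simp
  qed (rule r)
qed

lemma virtually_periodic_family:
  assumes "finite I" "\<And>i. i \<in> I \<Longrightarrow> virtually_periodic (s i)"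
  shows "virtually_periodic (\<lambda>k. \<lambda>i\<in>I. s i k)"
proof -
  have "\<forall>i. \<exists>N r. i \<in> I \<longrightarrow> r > 0 \<and> (\<forall>k\<ge>N. s i (k + r) = s i k)"
    using assms(2) by (auto simp: virtually_periodic_def)
  then obtain N r where Nr: "\<And>i. i \<in> I \<Longrightarrow> r i > 0"
      "\<And>i k. i \<in> I \<Longrightarrow> k \<ge> N i \<Longrightarrow> s i (k + r i) = s i k"
    by metis
  have mult: "s i (k + m * r i) = s i k" if "i \<in> I" "k \<ge> N i" for i k m
    using Nr(2)[OF that(1), of "k + _ * r i"] that
    by (induction m) (auto simp: algebra_simps trans_le_add1)
  have le: "k \<ge> N i" if "k \<ge> (\<Sum>i\<in>I. N i)" "i \<in> I" for k i
    using that member_le_sum[of i I N] assms(1) by auto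
  show ?thesis
  proof (rule virtually_periodicI[of "\<Prod>i\<in>I. r i" "\<Sum>i\<in>I. N i"])
    show "(\<Prod>i\<in>I. r i) > 0" using Nr(1) by (intro prod_pos) auto
    fix k assume k: "k \<ge> (\<Sum>i\<in>I. N i)"
    show "(\<lambda>i\<in>I. s i (k + (\<Prod>i\<in>I. r i))) = (\<lambda>i\<in>I. s i k)"
    proof (rule restrict_ext)
      fix i assume i: "i \<in> I"
      have "(\<Prod>i\<in>I. r i) = (\<Prod>i\<in>I - {i}. r i) * r i"
        using prod.remove[OF assms(1) i, of r] by (simp add: mult.commute)
      thus "s i (k + (\<Prod>i\<in>I. r i)) = s i k" using mult[OF i le[OF k i]] by simp
    qed
  qed
qed

text \<open>The factor \<open>e\<close> on the left keeps the coefficients integral after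
  denominators are cleared, at the price of a recurrence that is not monic.\<close>

definition satisfies_recurrence :: "nat \<Rightarrow> (nat \<Rightarrow> 'a::comm_ring_1) \<Rightarrow> 'a \<Rightarrow> (nat \<Rightarrow> 'a) \<Rightarrow> bool" where
  "satisfies_recurrence d c e a \<longleftrightarrow> (\<forall>k. e * a (k + d) = (\<Sum>j<d. c j * a (k + j)))"

text \<open>The windows of d consecutive values modulo l take at most l^d states, and as
  \<open>e\<close> and \<open>c 0\<close> are units modulo l the recurrence runs in both directions;
  hence pure periodicity with some period at most l^d. The factorial is a common multiple of all
  candidates, so one period serves every sequence satisfying the recurrence.\<close>

lemma recurrence_period_mod_prime:
  fixes x :: "nat \<Rightarrow> int"
  assumes l: "prime l" and d: "d > 0" and e: "\<not> int l dvd e" "\<not> int l dvd c 0"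
    and rec: "satisfies_recurrence d c e x"
  shows "int l dvd x (k + fact (l ^ d)) - x k"
proof -
  define S where "S = (\<lambda>k. \<lambda>j\<in>{..<d}. x (k + j) mod int l)"
  have S_eq: "S k = S m \<longleftrightarrow> (\<forall>j<d. [x (k + j) = x (m + j)] (mod int l))" for k m
    by (auto simp: S_def cong_def fun_eq_iff restrict_def)
  have cancel: "[a = b] (mod int l)" if "[z * a = z * b] (mod int l)" "\<not> int l dvd z" for a b z
  proof -
    have "coprime (int l) z" using that(2) l by (simp add: prime_imp_coprime)
    thus ?thesis using that(1) by (simp add: cong_mult_lcancel coprime_commute)
  qed
  have R: "e * x (k + d) = (\<Sum>j<d. c j * x (k + j))" for k
    using rec by (simp add: satisfies_recurrence_def)
  have step: "S (Suc k) = S (Suc m)" if "S k = S m" for k m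
    unfolding S_eq
  proof (intro allI impI)
    fix j assume "j < d"
    show "[x (Suc k + j) = x (Suc m + j)] (mod int l)"
    proof (cases "Suc j < d")
      case True
      thus ?thesis using that[unfolded S_eq, rule_format, of "Suc j"] by simp
    next
      case False
      hence "Suc j = d" using \<open>j < d\<close> by simp
      moreover have "[e * x (k + d) = e * x (m + d)] (mod int l)"
        unfolding R using that[unfolded S_eq] by (intro cong_sum cong_mult) auto
      hence "[x (k + d) = x (m + d)] (mod int l)" using e(1) by (rule cancel)
      ultimately show ?thesis by auto
    qed
  qed
  have backward: "S k = S m" if S: "S (Suc k) = S (Suc m)" for k m
  proof -
    have j: "[x (k + j) = x (m + j)] (mod int l)" if "0 < j" "j \<le> d" for j
      using S[unfolded S_eq, rule_format, of "j - 1"] that by (cases j) auto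
    have "c 0 * x k = e * x (k + d) - (\<Sum>j\<in>{..<d} - {0}. c j * x (k + j))" for k
      unfolding R using d by (simp add: sum.remove[of _ 0])
    note c0 = this
    have "[c 0 * x k = c 0 * x m] (mod int l)"
      unfolding c0[of k] c0[of m] using d by (intro cong_diff cong_mult cong_sum cong_refl j) auto
    hence "[x k = x m] (mod int l)" using e(2) by (rule cancel)
    thus ?thesis unfolding S_eq using j by (metis add.right_neutral less_imp_le_nat neq0_conv)
  qed
  have back_iter: "S k = S m" if "S (k + i) = S (m + i)" for i k m
    using that by (induction i) (auto dest: backward)
  have range: "S k \<in> {..<d} \<rightarrow>\<^sub>E {0..<int l}" for k
    using prime_gt_0_nat[OF l] by (auto simp: S_def)
  have card: "card ({..<d} \<rightarrow>\<^sub>E {0..<int l}) = l ^ d"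
    by (subst card_PiE) auto
  have "\<not> inj_on S {..l ^ d}"
  proof
    assume "inj_on S {..l ^ d}"
    hence "card {..l ^ d} \<le> card ({..<d} \<rightarrow>\<^sub>E {0..<int l})"
      using range by (intro card_inj_on_le[of S] finite_PiE) auto
    thus False unfolding card by simp
  qed
  then obtain i0 m0 where im0: "i0 \<le> l ^ d" "m0 \<le> l ^ d" "S i0 = S m0" "i0 \<noteq> m0"
    unfolding inj_on_def by blast
  define i m where "i = min i0 m0" and "m = max i0 m0"
  have im: "i < m" "m \<le> l ^ d" "S i = S m"
  proof -
    show "i < m" "m \<le> l ^ d" using im0 unfolding i_def m_def by linarith+
    show "S i = S m" unfolding i_def m_def min_def max_def using im0(3) by metis
  qed
  define t where "t = m - i"
  have t: "0 < t" "t \<le> l ^ d" using im by (auto simp: t_def)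
  have "S (0 + i) = S (t + i)" using im by (simp add: t_def)
  hence "S 0 = S t" by (rule back_iter)
  have per: "S k = S (k + t)" for k
  proof (induction k)
    case 0
    show ?case using \<open>S 0 = S t\<close> by (simp only: add_0)
  next
    case (Suc k)
    show ?case using step[OF Suc] by (simp only: add_Suc)
  qed
  have per': "S k = S (k + n * t)" for n
  proof (induction n)
    case (Suc n)
    thus ?case using per[of "k + n * t"] by (simp add: add.commute add.left_commute)
  qed simp
  have "t dvd fact (l ^ d)" using t by (intro dvd_fact) auto
  then obtain n where "fact (l ^ d) = n * t" by (metis dvd_def mult.commute)
  hence "S k = S (k + fact (l ^ d))" using per'[of n] by simp
  hence "[x k = x (k + fact (l ^ d))] (mod int l)" using d unfolding S_eq by force
  thus ?thesis by (simp add: cong_iff_dvd_diff dvd_diff_commute)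
qed

text \<open>A recurrence with constant coefficients is linear and shift-invariant. The division by l
  can therefore be iterated with the same \<open>c\<close> and \<open>e\<close>.\<close>

lemma recurrence_difference_quotient:
  fixes x :: "nat \<Rightarrow> int"
  assumes l: "prime l" and rec: "satisfies_recurrence d c e x"
    and div: "\<And>k. int l dvd x (k + r) - x k"
  shows "satisfies_recurrence d c e (\<lambda>k. (x (k + r) - x k) div int l)"
  unfolding satisfies_recurrence_def
proof
  fix k
  let ?y = "\<lambda>k. (x (k + r) - x k) div int l"
  have y: "int l * ?y k = x (k + r) - x k" for k using div[of k] by simp
  have R: "e * x (k + d) = (\<Sum>j<d. c j * x (k + j))" for k
    using rec by (simp add: satisfies_recurrence_def)
  have "int l * (e * ?y (k + d)) = e * x (k + r + d) - e * x (k + d)"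
    unfolding mult.left_commute[of "int l"] y by (simp add: algebra_simps)
  also have "\<dots> = (\<Sum>j<d. c j * (x (k + j + r) - x (k + j)))"
    unfolding R sum_subtractf[symmetric] by (intro sum.cong) (auto simp: algebra_simps)
  also have "\<dots> = int l * (\<Sum>j<d. c j * ?y (k + j))"
    unfolding sum_distrib_left mult.left_commute[of "int l"] y ..
  finally show "e * ?y (k + d) = (\<Sum>j<d. c j * ?y (k + j))"
    using prime_gt_0_nat[OF l] by simp
qed

text \<open>Along a progression with difference r the sequence is a Newton series in powers of l, so
  it vanishes identically or only finitely often there. The residues modulo r with identical
  vanishing give the period.\<close>

lemma skolem_mahler_lech_invertible:
  fixes a :: "nat \<Rightarrow> int"
  assumes rec: "satisfies_recurrence d c e a" and d: "d > 0" and nz: "e \<noteq> 0" "c 0 \<noteq> 0"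
  shows "virtually_periodic (\<lambda>k. a k = 0)"
proof -
  \<comment> \<open>Large enough to be prime to \<open>e\<close> and \<open>c 0\<close>, and at
    least 3 as the Newton series requires.\<close>
  obtain l where l: "prime l" "l > nat \<bar>e\<bar> + nat \<bar>c 0\<bar> + 3"
    using bigger_prime by blast
  have ndvd: "\<not> int l dvd e" "\<not> int l dvd c 0"
    using nz l(2) zdvd_imp_le[of "int l" "\<bar>e\<bar>"] zdvd_imp_le[of "int l" "\<bar>c 0\<bar>"] by auto
  define r :: nat where "r = fact (l ^ d)"
  have r: "r > 0" by (simp add: r_def)
  define \<Delta> where "\<Delta> = (\<lambda>x k. (x (k + r) - x k) div int l)"
  have \<Delta>_eq: "\<Delta> x = (\<lambda>k. (x (k + r) - x k) div int l)" for x
    by (simp add: \<Delta>_def)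
  have rec_iter: "satisfies_recurrence d c e ((\<Delta> ^^ i) a)" for i
  proof (induction i)
    case (Suc i)
    have "int l dvd (\<Delta> ^^ i) a (k + r) - (\<Delta> ^^ i) a k" for k
      unfolding r_def by (rule recurrence_period_mod_prime[OF l(1) d ndvd Suc])
    from recurrence_difference_quotient[OF l(1) Suc this]
    have "satisfies_recurrence d c e (\<Delta> ((\<Delta> ^^ i) a))" unfolding \<Delta>_eq .
    thus ?case by simp
  qed (use rec in simp)
  have shift: "(\<Delta> ^^ i) a (k + r) = (\<Delta> ^^ i) a k + int l * (\<Delta> ^^ Suc i) a k" for i k
    using recurrence_period_mod_prime[OF l(1) d ndvd rec_iter, of i k]
    by (simp add: \<Delta>_def r_def)
  \<comment> \<open>By \<open>shift\<close>, translation by r is the operator 1 + l \<Delta>; this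
    is the binomial theorem for its n-th power.\<close>
  have expand: "(\<Delta> ^^ m) a (j + n * r) =
      (\<Sum>i\<le>n. of_nat (n choose i) * int l ^ i * (\<Delta> ^^ (m + i)) a j)" for m j n
  proof (induction n arbitrary: m)
    case (Suc n)
    let ?b = "\<lambda>m. (\<Delta> ^^ m) a j"
    have "(\<Delta> ^^ m) a (j + Suc n * r) = (\<Delta> ^^ m) a (j + n * r) + int l * (\<Delta> ^^ Suc m) a (j + n * r)"
      using shift[of m "j + n * r"] by (simp add: algebra_simps)
    also have "\<dots> = (\<Sum>i\<le>n. of_nat (n choose i) * int l ^ i * ?b (m + i)) +
        (\<Sum>i\<le>n. of_nat (n choose i) * int l ^ Suc i * ?b (m + Suc i))"
      unfolding Suc.IH sum_distrib_left by (simp add: mult_ac)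
    also have "(\<Sum>i\<le>n. of_nat (n choose i) * int l ^ i * ?b (m + i)) =
        (\<Sum>i\<le>Suc n. of_nat (n choose i) * int l ^ i * ?b (m + i))"
      by (simp add: binomial_eq_0)
    also have "\<dots> = ?b m + (\<Sum>i\<le>n. of_nat (n choose Suc i) * int l ^ Suc i * ?b (m + Suc i))"
      by (subst sum.atMost_Suc_shift) simp
    also have "\<dots> + (\<Sum>i\<le>n. of_nat (n choose i) * int l ^ Suc i * ?b (m + Suc i)) =
        ?b m + (\<Sum>i\<le>n. of_nat (Suc n choose Suc i) * int l ^ Suc i * ?b (m + Suc i))"
      by (simp only: binomial_Suc_Suc of_nat_add distrib_right sum.distrib add_ac)
    also have "\<dots> = (\<Sum>i\<le>Suc n. of_nat (Suc n choose i) * int l ^ i * ?b (m + i))"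
      by (subst sum.atMost_Suc_shift) (simp del: binomial_Suc_Suc)
    finally show ?case .
  qed simp
  have dichotomy: "finite {n. a (j + n * r) = 0} \<or> (\<forall>n. a (j + n * r) = 0)" for j
  proof (rule disjCI)
    assume "\<not> (\<forall>n. a (j + n * r) = 0)"
    then obtain n where n: "a (j + n * r) \<noteq> 0" by auto
    show "finite {n. a (j + n * r) = 0}"
    proof (rule ccontr)
      assume "infinite {n. a (j + n * r) = 0}"
      hence "a (j + n * r) = 0"
        using expand[of 0 j] l
        by (intro newton_series_infinitely_many_zeros[of l "\<lambda>n. a (j + n * r)" "\<lambda>i. (\<Delta> ^^ i) a j"]) auto
      thus False using n by simp
    qed
  qed
  \<comment> \<open>The sporadic zeros, those in progressions on which the sequence does not vanish
    identically.\<close>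
  define Z where "Z = (\<Union>j\<in>{j. j < r \<and> \<not> (\<forall>n. a (j + n * r) = 0)}. (\<lambda>n. j + n * r) ` {n. a (j + n * r) = 0})"
  have "finite Z" unfolding Z_def using dichotomy by auto
  then obtain N where N: "\<And>k. k \<in> Z \<Longrightarrow> k < N" using finite_nat_set_iff_bounded by auto
  have nonzero: "a k \<noteq> 0" if "k \<ge> N" "\<not> (\<forall>n. a (k mod r + n * r) = 0)" for k
  proof
    assume "a k = 0"
    have k: "k mod r + (k div r) * r = k" by simp
    have "k \<in> Z" unfolding Z_def using that(2) \<open>a k = 0\<close> r
      by (intro UN_I[of "k mod r"] image_eqI[of _ _ "k div r"]) (simp_all only: mem_Collect_eq k mod_less_divisor simp_thms)
    from N[OF this] show False using that(1) by simp
  qed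
  have zero: "a k = 0" if "\<forall>n. a (k mod r + n * r) = 0" for k
  proof -
    have "a (k mod r + (k div r) * r) = 0" using that by blast
    thus ?thesis by simp
  qed
  show ?thesis
  proof (rule virtually_periodicI[OF r, of N])
    fix k assume k: "k \<ge> N"
    have eq: "(k + r) mod r = k mod r" by simp
    show "(a (k + r) = 0) = (a k = 0)"
    proof (cases "\<forall>n. a (k mod r + n * r) = 0")
      case True
      thus ?thesis using zero[of k] zero[of "k + r"] unfolding eq by simp
    next
      case False
      thus ?thesis using nonzero[of k] nonzero[of "k + r"] k unfolding eq by simp
    qed
  qed
qed

text \<open>Among the recurrences satisfied by tails of the sequence, one of least order has
  \<open>c 0\<close> nonzero: otherwise dropping the first term and shifting by one would shorten
  it. Clearing denominators then leads to the invertible case.\<close>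

theorem skolem_mahler_lech:
  fixes a :: "nat \<Rightarrow> int" and c :: "nat \<Rightarrow> rat"
  assumes rec: "satisfies_recurrence d c 1 (\<lambda>k. of_int (a k))"
  shows "virtually_periodic (\<lambda>k. a k = 0)"
proof -
  define A where "A = (\<lambda>d. \<exists>s (c :: nat \<Rightarrow> rat). satisfies_recurrence d c 1 (\<lambda>k. of_int (a (s + k))))"
  have "A d" unfolding A_def using rec by (intro exI[of _ 0] exI[of _ c]) simp
  define D where "D = (LEAST d. A d)"
  have "A D" unfolding D_def using \<open>A d\<close> by (rule LeastI)
  have least: "D \<le> m" if "A m" for m unfolding D_def using that by (rule Least_le)
  obtain s and c :: "nat \<Rightarrow> rat" where c: "satisfies_recurrence D c 1 (\<lambda>k. of_int (a (s + k)))"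
    using \<open>A D\<close> by (auto simp: A_def)
  hence R: "of_int (a (s + (k + D))) = (\<Sum>j<D. c j * of_int (a (s + (k + j))))" for k
    by (simp add: satisfies_recurrence_def)
  show ?thesis
  proof (cases D)
    case 0
    hence "a (s + k) = 0" for k using R[of k] by simp
    hence "virtually_periodic (\<lambda>k. a (s + k) = 0)"
      by (auto intro!: virtually_periodicI[of 1 0])
    thus ?thesis by (rule virtually_periodic_shift)
  next
    case (Suc D')
    have c0: "c 0 \<noteq> 0"
    proof
      assume "c 0 = 0"
      hence "satisfies_recurrence D' (\<lambda>j. c (Suc j)) 1 (\<lambda>k. of_int (a (Suc s + k)))"
        using R unfolding satisfies_recurrence_def Suc
        by (simp add: sum.lessThan_Suc_shift del: sum.lessThan_Suc)
      hence "A D'" unfolding A_def by blast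
      thus False using least[of D'] Suc by simp
    qed
    define m n where "m = (\<lambda>j. fst (quotient_of (c j)))" and "n = (\<lambda>j. snd (quotient_of (c j)))"
    have mn: "c j = of_int (m j) / of_int (n j)" "n j > 0" for j
      using quotient_of_div[of "c j" "m j" "n j"] quotient_of_denom_pos[of "c j" "m j" "n j"]
      by (simp_all add: m_def n_def)
    define e where "e = (\<Prod>j<D. n j)"
    have e: "e \<noteq> 0" using mn(2) by (simp add: e_def less_imp_neq[symmetric])
    define c' where "c' = (\<lambda>j. m j * (\<Prod>i\<in>{..<D} - {j}. n i))"
    have c': "of_int (c' j) = of_int e * c j" if "j < D" for j
    proof -
      have "e = n j * (\<Prod>i\<in>{..<D} - {j}. n i)"
        unfolding e_def using that by (intro prod.remove) auto
      thus ?thesis using mn(2)[of j] by (simp add: c'_def mn(1))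
    qed
    have "satisfies_recurrence D c' e (\<lambda>k. a (s + k))"
      unfolding satisfies_recurrence_def
    proof
      fix k
      have "of_int (e * a (s + (k + D))) = (of_int (\<Sum>j<D. c' j * a (s + (k + j))) :: rat)"
        using c' by (simp add: R sum_distrib_left mult.assoc)
      thus "e * a (s + (k + D)) = (\<Sum>j<D. c' j * a (s + (k + j)))" unfolding of_int_eq_iff .
    qed
    moreover have "c' 0 \<noteq> 0"
    proof
      assume "c' 0 = 0"
      hence "of_int e * c 0 = 0" using c'[of 0] Suc by simp
      thus False using e c0 by simp
    qed
    ultimately have "virtually_periodic (\<lambda>k. a (s + k) = 0)"
      using e Suc by (intro skolem_mahler_lech_invertible[of D c' e]) auto
    thus ?thesis by (rule virtually_periodic_shift)
  qed
qed

section \<open>Kronecker's criterion\<close>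

definition hankel :: "(nat \<Rightarrow> 'a) \<Rightarrow> nat \<Rightarrow> 'a mat" where
  "hankel a n = mat n n (\<lambda>(i, j). a (i + j))"

text \<open>The functional \<open>x\<^sup>i \<mapsto> a i\<close> on polynomials.\<close>

definition umbral :: "(nat \<Rightarrow> 'a::comm_ring_1) \<Rightarrow> 'a poly \<Rightarrow> 'a" where
  "umbral a v = (\<Sum>i\<le>degree v. coeff v i * a i)"

lemma umbral_altdef: "degree v \<le> n \<Longrightarrow> umbral a v = (\<Sum>i\<le>n. coeff v i * a i)"
  unfolding umbral_def by (intro sum.mono_neutral_left) (auto simp: coeff_eq_0)

lemma umbral_add: "umbral a (u + v) = umbral a u + umbral a v"
proof -
  define n where "n = max (degree u) (degree v)"
  have "degree (u + v) \<le> n" "degree u \<le> n" "degree v \<le> n"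
    unfolding n_def by (auto intro: degree_add_le_max)
  thus ?thesis by (simp add: umbral_altdef[of _ n] sum.distrib algebra_simps)
qed

lemma umbral_smult: "umbral a (smult c v) = c * umbral a v"
  using degree_smult_le[of c v]
  by (simp add: umbral_altdef[of _ "degree v"] sum_distrib_left mult.assoc)

lemma umbral_0 [simp]: "umbral a 0 = 0"
  by (simp add: umbral_def)

lemma umbral_pCons: "umbral a (pCons c v) = c * a 0 + umbral (\<lambda>i. a (Suc i)) v"
  using degree_pCons_le[of c v]
  by (simp add: umbral_altdef[of _ "Suc (degree v)"] umbral_def sum.atMost_Suc_shift del: sum.atMost_Suc)

lemma umbral_mult: "umbral a (q * g) = umbral (\<lambda>r. umbral (\<lambda>i. a (r + i)) q) g"
  by (induction g arbitrary: a) (simp_all add: umbral_add umbral_smult umbral_pCons)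

text \<open>A kernel vector is read as the coefficients of a polynomial v; row r of the matrix
  applies the functional to X^r v.\<close>

lemma det_hankel_eq_0_iff:
  fixes a :: "nat \<Rightarrow> 'a::field"
  shows "det (hankel a n) = 0 \<longleftrightarrow>
           (\<exists>v. v \<noteq> 0 \<and> degree v < n \<and> (\<forall>r<n. umbral (\<lambda>i. a (r + i)) v = 0))"
proof -
  have H: "hankel a n \<in> carrier_mat n n" by (simp add: hankel_def)
  have eval: "(hankel a n *\<^sub>v w) $ r = (\<Sum>i<n. a (r + i) * w $ i)" if "r < n" "w \<in> carrier_vec n" for w r
    using that by (auto simp: hankel_def scalar_prod_def atLeast0LessThan intro!: sum.cong)
  have umbral: "umbral b v = (\<Sum>i<n. coeff v i * b i)" if "degree v < n" for b v
    using that by (cases n) (auto simp: umbral_altdef lessThan_Suc_atMost)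
  show ?thesis
    unfolding det_0_iff_vec_prod_zero_field[OF H]
  proof (intro iffI; elim exE conjE)
    fix w assume w: "w \<in> carrier_vec n" "w \<noteq> 0\<^sub>v n" "hankel a n *\<^sub>v w = 0\<^sub>v n"
    define v where "v = (\<Sum>i<n. monom (w $ i) i)"
    have cf: "coeff v i = (if i < n then w $ i else 0)" for i
      by (simp add: v_def coeff_sum)
    have "\<exists>i<n. w $ i \<noteq> 0" using w(1,2) by (metis carrier_vecD eq_vecI index_zero_vec)
    then obtain i where "i < n" "coeff v i \<noteq> 0" using cf by auto
    hence "v \<noteq> 0" "n > 0" by auto
    have "degree v \<le> n - 1" by (intro degree_le) (auto simp: cf)
    hence deg: "degree v < n" using \<open>n > 0\<close> by simp
    moreover have "umbral (\<lambda>i. a (r + i)) v = 0" if r: "r < n" for r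
    proof -
      have "umbral (\<lambda>i. a (r + i)) v = (hankel a n *\<^sub>v w) $ r"
        unfolding umbral[OF deg] eval[OF r w(1)] by (intro sum.cong) (auto simp: cf)
      thus ?thesis using w(3) r by simp
    qed
    ultimately show "\<exists>v. v \<noteq> 0 \<and> degree v < n \<and> (\<forall>r<n. umbral (\<lambda>i. a (r + i)) v = 0)"
      using \<open>v \<noteq> 0\<close> by blast
  next
    fix v assume v: "v \<noteq> 0" "degree v < n" "\<forall>r<n. umbral (\<lambda>i. a (r + i)) v = 0"
    define w where "w = vec n (coeff v)"
    have w: "w \<in> carrier_vec n" by (simp add: w_def)
    have "w $ degree v \<noteq> 0" using v(1,2) by (simp add: w_def)
    hence "w \<noteq> 0\<^sub>v n" using v(2) by auto
    moreover have "hankel a n *\<^sub>v w = 0\<^sub>v n"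
    proof (rule eq_vecI)
      fix r assume "r < dim_vec (0\<^sub>v n)"
      hence r: "r < n" by simp
      have "(hankel a n *\<^sub>v w) $ r = umbral (\<lambda>i. a (r + i)) v"
        unfolding eval[OF r w] umbral[OF v(2)] by (intro sum.cong) (auto simp: w_def)
      thus "(hankel a n *\<^sub>v w) $ r = 0\<^sub>v n $ r" using v(3) r by simp
    qed (use H in auto)
    ultimately show "\<exists>w. w \<in> carrier_vec n \<and> w \<noteq> 0\<^sub>v n \<and> hankel a n *\<^sub>v w = 0\<^sub>v n"
      using w by blast
  qed
qed

text \<open>Let m be the largest size with nonzero determinant. A kernel polynomial q of the next
  size has degree exactly m, and it annihilates every shift of the sequence, which is a recurrence.
  For the shift by t, a kernel polynomial of size t + 1 is divided by q: the remainder vanishes by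
  nonsingularity in size m, and the quotient isolates \<open>b t\<close>.\<close>

theorem kronecker_hankel:
  fixes a :: "nat \<Rightarrow> 'a::field_gcd"
  assumes "\<And>n. n \<ge> n0 \<Longrightarrow> det (hankel a n) = 0"
  shows "\<exists>d c. satisfies_recurrence d c 1 a"
proof -
  define ann where "ann = (\<lambda>n v. \<forall>r<n. umbral (\<lambda>i. a (r + i)) v = 0)"
  have det: "det (hankel a n) = 0 \<longleftrightarrow> (\<exists>v. v \<noteq> 0 \<and> degree v < n \<and> ann n v)" for n
    unfolding ann_def by (rule det_hankel_eq_0_iff)
  define m where "m = (GREATEST n. det (hankel a n) \<noteq> 0)"
  have "det (hankel a 0) \<noteq> 0" by (simp add: hankel_def)
  moreover have bound: "n \<le> n0" if "det (hankel a n) \<noteq> 0" for n using assms[of n] that by fastforce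
  ultimately have m: "det (hankel a m) \<noteq> 0"
    unfolding m_def using GreatestI_nat[of "\<lambda>n. det (hankel a n) \<noteq> 0" 0 n0] by blast
  have above: "det (hankel a n) = 0" if "n > m" for n
    using Greatest_le_nat[of "\<lambda>n. det (hankel a n) \<noteq> 0" n n0] bound that unfolding m_def by fastforce
  obtain q where q: "q \<noteq> 0" "degree q \<le> m" "ann (Suc m) q"
    using above[of "Suc m"] unfolding det by auto
  have deg_q: "degree q = m"
  proof (rule ccontr)
    assume "degree q \<noteq> m"
    hence "degree q < m" using q(2) by simp
    moreover have "ann m q" using q(3) by (simp add: ann_def)
    ultimately show False using m q(1) unfolding det by blast
  qed
  define b where "b = (\<lambda>r. umbral (\<lambda>i. a (r + i)) q)"
  have umbral_q: "umbral (\<lambda>i. a (r + i)) (q * g) = umbral (\<lambda>i. b (r + i)) g" for r g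
    unfolding umbral_mult b_def by (simp add: add.assoc)
  have b0: "b t = 0" for t
  proof (induction t rule: less_induct)
    case (less t)
    show ?case
    proof (cases "t \<le> m")
      case True
      thus ?thesis using q(3) by (simp add: ann_def b_def)
    next
      case False
      then obtain v where v: "v \<noteq> 0" "degree v \<le> t" "ann (Suc t) v"
        using above[of "Suc t"] unfolding det by auto
      define g w where "g = v div q" and "w = v mod q"
      have vgw: "v = q * g + w" by (simp add: g_def w_def)
      have w: "w = 0 \<or> degree w < m"
        using degree_mod_less[OF q(1), of v] by (simp add: w_def deg_q)
      have deg_g: "degree g + m \<le> t"
      proof (cases "g = 0")
        case False
        have "degree (q * g) = m + degree g" using q(1) False by (simp add: degree_mult_eq deg_q)
        moreover have "degree (q * g) \<le> t"
        proof -
          have "q * g = v - w" using vgw by simp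
          moreover have "degree w \<le> t" using w \<open>\<not> t \<le> m\<close> by auto
          ultimately show ?thesis using v(2) by (simp only:) (rule degree_diff_le)
        qed
        ultimately show ?thesis by simp
      qed (use False in simp)
      have L: "umbral (\<lambda>i. b (r + i)) g + umbral (\<lambda>i. a (r + i)) w = 0" if "r \<le> t" for r
        using v(3) that unfolding ann_def vgw by (simp add: umbral_add umbral_q)
      have "w = 0"
      proof (rule ccontr)
        assume "w \<noteq> 0"
        have "ann m w"
          unfolding ann_def
        proof (intro allI impI)
          fix r assume r: "r < m"
          have "umbral (\<lambda>i. b (r + i)) g = 0"
            unfolding umbral_def using less deg_g r by (intro sum.neutral) auto
          thus "umbral (\<lambda>i. a (r + i)) w = 0" using L[of r] r False by simp
        qed
        thus False using m w \<open>w \<noteq> 0\<close> unfolding det by blast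
      qed
      hence "g \<noteq> 0" using v(1) vgw by auto
      \<comment> \<open>In the row t - degree g only the leading term of g meets a value of b not
        yet known to vanish.\<close>
      have "umbral (\<lambda>i. b (t - degree g + i)) g = (\<Sum>i\<in>{degree g}. coeff g i * b (t - degree g + i))"
        unfolding umbral_def using less deg_g by (intro sum.mono_neutral_right) auto
      hence "lead_coeff g * b t = 0" using L[of "t - degree g"] \<open>w = 0\<close> deg_g by simp
      thus ?thesis using \<open>g \<noteq> 0\<close> by simp
    qed
  qed
  have "satisfies_recurrence m (\<lambda>j. - coeff q j / lead_coeff q) 1 a"
    unfolding satisfies_recurrence_def
  proof
    fix k
    have lq: "lead_coeff q \<noteq> 0" using q(1) by simp
    have "(\<Sum>i\<le>m. coeff q i * a (k + i)) = 0" using b0[of k] by (simp add: b_def umbral_def deg_q)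
    hence "(\<Sum>i<m. coeff q i * a (k + i)) + lead_coeff q * a (k + m) = 0"
      by (simp add: deg_q flip: lessThan_Suc_atMost)
    hence "lead_coeff q * a (k + m) = (\<Sum>j<m. - (coeff q j * a (k + j)))"
      by (simp add: sum_negf eq_neg_iff_add_eq_0 add.commute)
    hence "a (k + m) = (\<Sum>j<m. - (coeff q j * a (k + j))) / lead_coeff q"
      using lq by (simp add: field_simps)
    thus "1 * a (k + m) = (\<Sum>j<m. - coeff q j / lead_coeff q * a (k + j))"
      by (simp add: sum_divide_distrib)
  qed
  thus ?thesis by blast
qed

section \<open>The Artin--Hasse exponential\<close>

no_notation vec_index (infixl "$" 100)

lemma fps_nth_compose_X_power:
  fixes f :: "'a::idom fps"
  assumes "d > 0"
  shows "(f oo fps_X ^ d) $ n = (if d dvd n then f $ (n div d) else 0)"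
proof -
  have "(f oo fps_X ^ d) $ n = (\<Sum>i=0..n. if n = d * i then f $ i else 0)"
    unfolding fps_compose_nth power_mult[symmetric] fps_X_power_nth by (intro sum.cong) auto
  also have "\<dots> = (\<Sum>i\<in>(if d dvd n then {n div d} else {}). f $ i)"
    using assms by (intro sum.mono_neutral_cong_right) (auto split: if_splits)
  finally show ?thesis by simp
qed

text \<open>In characteristic zero the equation determines the coefficients recursively. The
  functional equation of \<open>fexp\<close> follows without double sums, as both sides solve the
  same equation.\<close>

lemma fps_linear_ode_unique:
  fixes h :: "'a::field_char_0 fps"
  assumes "fps_deriv y = h * y" "fps_deriv z = h * z" "y $ 0 = z $ 0"
  shows "y = z"
proof (rule fps_ext)
  fix n
  show "y $ n = z $ n"
  proof (induction n rule: less_induct)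
    case (less n)
    show ?case
    proof (cases n)
      case (Suc m)
      have "of_nat (Suc m) * y $ Suc m = (h * y) $ m" "of_nat (Suc m) * z $ Suc m = (h * z) $ m"
        using fps_deriv_nth[of y m] fps_deriv_nth[of z m] assms by simp_all
      moreover have "(h * y) $ m = (h * z) $ m"
        unfolding fps_mult_nth using less by (intro sum.cong) (auto simp: Suc)
      ultimately show ?thesis unfolding Suc by (metis mult_cancel_left of_nat_neq_0)
    qed (use assms in simp)
  qed
qed

definition fexp :: "'a::field_char_0 fps \<Rightarrow> 'a fps" where
  "fexp f = fps_exp 1 oo f"

lemma fexp_nth: "fexp f $ n = (\<Sum>i=0..n. inverse (fact i) * (f ^ i) $ n)"
  by (simp add: fexp_def fps_compose_nth field_simps)

lemma fexp_nth_0 [simp]: "fexp f $ 0 = 1"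
  by (simp add: fexp_def)

lemma fexp_deriv: "f $ 0 = 0 \<Longrightarrow> fps_deriv (fexp f) = fps_deriv f * fexp f"
  by (simp add: fexp_def fps_compose_deriv mult.commute)

lemma fexp_add: "f $ 0 = 0 \<Longrightarrow> g $ 0 = 0 \<Longrightarrow> fexp (f + g) = fexp f * fexp g"
  by (rule fps_linear_ode_unique[where h = "fps_deriv f + fps_deriv g"])
     (simp_all add: fexp_deriv algebra_simps)

lemma fexp_0 [simp]: "fexp 0 = 1"
  by (simp add: fexp_def)

lemma fexp_power: "f $ 0 = 0 \<Longrightarrow> fexp f ^ n = fexp (of_nat n * f)"
  by (induction n) (simp_all add: fexp_add distrib_right)

lemma fexp_compose: "f $ 0 = 0 \<Longrightarrow> g $ 0 = 0 \<Longrightarrow> fexp f oo g = fexp (f oo g)"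
  unfolding fexp_def by (subst fps_compose_assoc) auto

lemma fexp_linear: "fexp (fps_const c * fps_X) = fps_exp c"
  using fps_exp_compose_linear[of 1 c] by (simp add: fexp_def)

text \<open>Applied with b of order n in X, this isolates how the coefficient of index n enters the
  p-th power.\<close>

lemma power_add_expand:
  fixes a b :: "'a::comm_ring_1"
  shows "\<exists>c. (a + b) ^ m = a ^ m + of_nat m * a ^ (m - 1) * b + b ^ 2 * c"
proof (induction m)
  case 0
  show ?case by (intro exI[of _ 0]) simp
next
  case (Suc m)
  then obtain c where c: "(a + b) ^ m = a ^ m + of_nat m * a ^ (m - 1) * b + b ^ 2 * c" by auto
  have "(a + b) ^ Suc m = a * a ^ m + (of_nat m * (a * a ^ (m - 1)) + a ^ m) * b
          + b ^ 2 * (of_nat m * a ^ (m - 1) + (a + b) * c)"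
    by (simp add: c algebra_simps power2_eq_square)
  moreover have "of_nat m * (a * a ^ (m - 1)) = of_nat m * a ^ m"
    by (cases m) auto
  ultimately have "(a + b) ^ Suc m = a * a ^ m + (of_nat m * a ^ m + a ^ m) * b
          + b ^ 2 * (of_nat m * a ^ (m - 1) + (a + b) * c)" by simp
  thus ?case
    by (intro exI[of _ "of_nat m * a ^ (m - 1) + (a + b) * c"]) (simp add: algebra_simps)
qed

definition artin_hasse_log :: "nat \<Rightarrow> complex fps" where
  "artin_hasse_log p = Abs_fps (\<lambda>n. if \<exists>j. n = p ^ j then inverse (of_nat n) else 0)"

definition artin_hasse :: "nat \<Rightarrow> complex fps" where
  "artin_hasse p = fexp (artin_hasse_log p)"

context p_place
begin

lemma artin_hasse_log_0 [simp]: "artin_hasse_log p $ 0 = 0"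
  by (auto simp: artin_hasse_log_def)

lemma artin_hasse_log_scaled:
  "of_nat p * artin_hasse_log p = fps_const (of_nat p) * fps_X + (artin_hasse_log p oo fps_X ^ p)"
proof (rule fps_ext)
  fix n
  have p0: "p > 0" using p_gt_1 by simp
  have 1: "(\<exists>j. n = p ^ j) \<longleftrightarrow> n = 1 \<or> (p dvd n \<and> (\<exists>j. n div p = p ^ j))"
  proof
    assume "\<exists>j. n = p ^ j"
    then obtain j where j: "n = p ^ j" ..
    show "n = 1 \<or> (p dvd n \<and> (\<exists>j. n div p = p ^ j))"
      using p0 by (cases j) (auto simp: j)
  next
    assume "n = 1 \<or> (p dvd n \<and> (\<exists>j. n div p = p ^ j))"
    thus "\<exists>j. n = p ^ j"
    proof
      assume "p dvd n \<and> (\<exists>j. n div p = p ^ j)"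
      then obtain j where "p dvd n" "n div p = p ^ j" by blast
      hence "n = p ^ Suc j" using dvd_mult_div_cancel[of p n] by simp
      thus ?thesis ..
    qed (auto intro: exI[of _ 0])
  qed
  have "of_nat p * inverse (of_nat n) = (inverse (of_nat (n div p)) :: complex)" if "p dvd n"
    using that p0 by (auto elim!: dvdE)
  note inv = this
  have "(of_nat p :: complex fps) = fps_const (of_nat p)" by (simp add: fps_of_nat)
  hence lhs: "(of_nat p * artin_hasse_log p) $ n = of_nat p * artin_hasse_log p $ n" by simp
  show "(of_nat p * artin_hasse_log p) $ n =
      (fps_const (of_nat p) * fps_X + (artin_hasse_log p oo fps_X ^ p)) $ n"
  proof (cases "n = 1")
    case True
    moreover have "\<not> p dvd 1" using p_gt_1 by auto
    moreover have "\<exists>j. 1 = p ^ j" by (intro exI[of _ 0]) auto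
    ultimately show ?thesis
      unfolding lhs by (simp add: artin_hasse_log_def fps_nth_compose_X_power p0)
  next
    case False
    thus ?thesis
      unfolding lhs using inv 1
      by (cases "p dvd n") (simp_all add: artin_hasse_log_def fps_nth_compose_X_power p0)
  qed
qed

text \<open>The exponential of p L(X) = p X + L(X^p), where L is the logarithm of the series. It is
  the relation between the series at X and at X^p that Dwork's integrality criterion asks
  for.\<close>

lemma artin_hasse_power:
  "artin_hasse p ^ p = fps_exp (of_nat p) * (artin_hasse p oo fps_X ^ p)"
proof -
  have "(fps_X ^ p :: complex fps) $ 0 = 0" using p_gt_1 by simp
  thus ?thesis
    by (simp add: artin_hasse_def fexp_power artin_hasse_log_scaled fexp_add fexp_linear fexp_compose)
qed

text \<open>Fermat's little theorem for p-integral rationals. It fails for general elements of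
  \<open>R\<close>, whose reductions need not lie in the prime field; this is why rationality is
  carried along with integrality of the Artin--Hasse coefficients.\<close>

lemma rational_frobenius:
  assumes "x \<in> \<rat>" "x \<in> R"
  shows "V 1 (x ^ p - x)"
proof -
  obtain a b where ab: "x = of_int a / of_int b" "b > 0" "coprime a b"
    using assms(1) by (elim Rats_cases') auto
  have b: "\<not> int p dvd b"
  proof
    assume pb: "int p dvd b"
    have "of_int b * x = of_int a" using ab by simp
    hence "\<phi> (of_int b * x) = of_int a" by simp
    moreover have "(of_int b :: 'a) = 0" using pb by (auto simp: of_nat_p)
    ultimately have "(of_int a :: 'a) = 0" using assms(2) by (simp add: hom_mult)
    moreover have "\<not> int p dvd a"
    proof
      assume "int p dvd a"
      hence "is_unit (int p)" using pb ab(3) by (metis coprime_common_divisor)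
      thus False using p_gt_1 by simp
    qed
    hence "\<not> p dvd nat \<bar>a\<bar>" by (simp add: int_dvd_int_iff[symmetric])
    hence "(of_nat (nat \<bar>a\<bar>) :: 'a) \<noteq> 0" by (rule hom_coprime)
    hence "(of_int a :: 'a) \<noteq> 0" by (cases "a \<ge> 0") auto
    ultimately show False by simp
  qed
  have nat_fermat: "[r ^ p = r] (mod p)" for r
  proof (cases "p dvd r")
    case True
    moreover have "p dvd r ^ p" using p_gt_1 by (intro dvd_trans[OF True dvd_power]) auto
    ultimately show ?thesis by (auto simp: cong_def)
  next
    case False
    hence "[r * r ^ (p - 1) = r * 1] (mod p)" by (intro cong_mult fermat_theorem prime_p) auto
    thus ?thesis using p_gt_1 by (cases p) auto
  qed
  have fermat: "int p dvd z ^ p - z" for z :: int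
  proof -
    define r where "r = nat (z mod int p)"
    have r: "[z = int r] (mod int p)" using p_gt_1 by (simp add: r_def)
    have "[z ^ p = int r ^ p] (mod int p)" by (rule cong_pow[OF r])
    also have "[int r ^ p = int r] (mod int p)"
      using nat_fermat[of r] by (metis cong_int_iff of_nat_power)
    also have "[int r = z] (mod int p)" using r by (rule cong_sym)
    finally show ?thesis by (simp add: cong_iff_dvd_diff)
  qed
  have "int p dvd (a ^ p - a) * b - a * (b ^ p - b)"
    by (intro dvd_diff dvd_mult dvd_mult2 fermat)
  also have "(a ^ p - a) * b - a * (b ^ p - b) = a ^ p * b - a * b ^ p"
    by (simp add: algebra_simps)
  finally obtain m where m: "a ^ p * b - a * b ^ p = int p * m" by (rule dvdE)
  have bi: "inverse (of_int b) \<in> R"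
  proof (rule inverse_in)
    have "\<not> int p dvd int (nat b)" using b ab(2) by simp
    hence "\<not> p dvd nat b" unfolding int_dvd_int_iff .
    hence "(of_nat (nat b) :: 'a) \<noteq> 0" by (rule hom_coprime)
    thus "\<phi> (of_int b) \<noteq> 0" using ab(2) by simp
  qed simp
  have "x ^ p - x = of_int (a ^ p * b - a * b ^ p) * inverse (of_int b) ^ (p + 1)"
    using ab(2) by (simp add: ab(1) field_simps)
  also have "\<dots> = of_nat p * (of_int m * inverse (of_int b) ^ (p + 1))"
    unfolding m by simp
  finally have eq: "x ^ p - x = of_nat p * (of_int m * inverse (of_int b) ^ (p + 1))" .
  show ?thesis
    unfolding eq by (intro V_mult_R(1) V_p mult_in of_int_in power_in bi)
qed

lemma V_choose: "0 < k \<Longrightarrow> k < p \<Longrightarrow> V 1 (of_nat (p choose k))"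
  using dvd_choose_prime[OF _ _ _ prime_p, of k]
  by (auto elim!: dvdE intro!: V_mult_R(1) V_p)

lemma fps_frobenius_add:
  assumes "\<And>i. f $ i \<in> R" "\<And>i. g $ i \<in> R"
  shows "V 1 (((f + g) ^ p - f ^ p - g ^ p) $ i)"
proof -
  have R: "(h ^ k) $ i \<in> R" if "\<And>i. h $ i \<in> R" for h :: "complex fps" and k i
    by (induction k arbitrary: i) (auto simp: fps_mult_nth that intro!: sum_in mult_in)
  have "(f + g) ^ p = (\<Sum>k\<le>p. of_nat (p choose k) * f ^ k * g ^ (p - k))"
    by (rule binomial_ring)
  also have "{..p} = insert 0 (insert p {0<..<p})" using p_gt_1 by auto
  also have "(\<Sum>k\<in>\<dots>. of_nat (p choose k) * f ^ k * g ^ (p - k)) =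
      g ^ p + (f ^ p + (\<Sum>k\<in>{0<..<p}. of_nat (p choose k) * f ^ k * g ^ (p - k)))"
    using p_gt_1 by simp
  finally have "((f + g) ^ p - f ^ p - g ^ p) $ i =
      (\<Sum>k\<in>{0<..<p}. of_nat (p choose k) * (f ^ k * g ^ (p - k)) $ i)"
    by (simp add: fps_sum_nth mult.assoc)
  also have "V 1 \<dots>"
    by (intro V_sum V_mult_R(1) V_choose)
       (auto simp: fps_mult_nth intro!: sum_in mult_in R assms)
  finally show ?thesis .
qed

text \<open>The congruence g(X)^p = g(X^p) modulo p, built up one term at a time.\<close>

lemma fps_frobenius_poly:
  assumes "\<And>i. i < n \<Longrightarrow> e i \<in> \<rat>" "\<And>i. i < n \<Longrightarrow> e i \<in> R"
  shows "V 1 (((\<Sum>i<n. fps_const (e i) * fps_X ^ i) ^ p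
            - (\<Sum>i<n. fps_const (e i) * fps_X ^ (p * i))) $ j)"
  using assms
proof (induction n)
  case 0
  thus ?case using p_gt_1 by (simp add: power_0_left)
next
  case (Suc n)
  let ?f = "\<Sum>i<n. fps_const (e i) * fps_X ^ i" and ?g = "fps_const (e n) * fps_X ^ n"
  have "V 1 (((?f + ?g) ^ p - ?f ^ p - ?g ^ p) $ j)"
    using Suc.prems(2) by (intro fps_frobenius_add) (auto simp: fps_sum_nth intro!: sum_in)
  moreover have "V 1 ((?f ^ p - (\<Sum>i<n. fps_const (e i) * fps_X ^ (p * i))) $ j)"
    using Suc by auto
  moreover have "V 1 ((?g ^ p - fps_const (e n) * fps_X ^ (p * n)) $ j)"
  proof -
    have eq: "?g ^ p - fps_const (e n) * fps_X ^ (p * n) = fps_const (e n ^ p - e n) * fps_X ^ (p * n)"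
      by (simp only: power_mult_distrib fps_const_power power_mult[symmetric] mult.commute[of n p]
          left_diff_distrib[symmetric] fps_const_sub)
    show ?thesis unfolding eq using rational_frobenius[of "e n"] Suc.prems by simp
  qed
  ultimately have "V 1 ((((?f + ?g) ^ p - ?f ^ p - ?g ^ p)
      + (?f ^ p - (\<Sum>i<n. fps_const (e i) * fps_X ^ (p * i)))
      + (?g ^ p - fps_const (e n) * fps_X ^ (p * n))) $ j)"
    unfolding fps_add_nth by (intro V_add)
  thus ?case by (simp add: algebra_simps)
qed

end

lemma complex_nth_root_exists:
  assumes "n > 0"
  shows "\<exists>z :: complex. z ^ n = c"
proof -
  have "degree (monom 1 n - [:c:]) = n"
    using assms by (intro antisym degree_diff_le le_degree) (auto simp: degree_monom_eq coeff_pCons split: nat.splits)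
  hence "degree (monom 1 n - [:c:]) > 0" using assms by simp
  from alg_closed_imp_poly_has_root[OF this] show ?thesis
    by (auto simp: poly_monom)
qed

lemma fps_mult_nth_Rats:
  "(\<And>i. i \<le> n \<Longrightarrow> f $ i \<in> \<rat>) \<Longrightarrow> (\<And>i. i \<le> n \<Longrightarrow> g $ i \<in> \<rat>) \<Longrightarrow> (f * g) $ n \<in> \<rat>"
  for f g :: "'a::field_char_0 fps"
  by (auto simp: fps_mult_nth intro!: Rats_sum Rats_mult)

lemma fps_power_nth_Rats:
  "(\<And>i. f $ i \<in> \<rat>) \<Longrightarrow> (f ^ k) $ n \<in> \<rat>" for f :: "'a::field_char_0 fps"
  by (induction k arbitrary: n) (auto intro!: fps_mult_nth_Rats)

context p_place
begin

text \<open>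
  \<open>\<kappa>\<close> is the valuation of Dwork's \<open>\<pi>\<close>; \<open>\<epsilon>\<close> is a (not optimal) rate of growth for the valuations of
  the coefficients of the splitting function.
\<close>

definition \<kappa> :: rat where "\<kappa> = 1 / of_nat (p - 1)"

definition \<epsilon> :: rat where "\<epsilon> = 1 / of_nat (p ^ 2)"

lemma kappa_mult: "of_nat (p - 1) * \<kappa> = 1" and kappa_pos: "\<kappa> > 0" and kappa_le_1: "\<kappa> \<le> 1"
  using p_gt_1 by (simp_all add: \<kappa>_def)

lemma eps_pos: "\<epsilon> > 0" and eps_le_kappa: "\<epsilon> \<le> \<kappa>" and eps_mult_p: "of_nat p * \<epsilon> \<le> 1"
proof -
  have p: "(of_nat p :: rat) > 1" using p_gt_1 by simp
  show "\<epsilon> > 0" using p by (simp add: \<epsilon>_def)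
  have le: "p \<le> p * p" by simp
  have "p - 1 \<le> p ^ 2" unfolding power2_eq_square using le by linarith
  hence "(of_nat (p - 1) :: rat) \<le> of_nat (p ^ 2)" unfolding of_nat_le_iff .
  moreover have "(of_nat (p - 1) :: rat) > 0" using p_gt_1 by simp
  ultimately show "\<epsilon> \<le> \<kappa>" unfolding \<epsilon>_def \<kappa>_def by (intro divide_left_mono mult_pos_pos) auto
  show "of_nat p * \<epsilon> \<le> 1" using p by (simp add: \<epsilon>_def power2_eq_square)
qed

lemma V_inverse_fact': "n \<ge> 1 \<Longrightarrow> V (- (of_nat (n - 1) * \<kappa>)) (inverse (fact n))"
  using V_inverse_fact[of n] by (simp add: \<kappa>_def)

lemma V_p_power_div_fact:
  assumes "i \<ge> 1"
  shows "V 1 (of_nat p ^ i / fact i)"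
proof -
  have "V (of_nat i * 1 + - (of_nat (i - 1) * \<kappa>)) (of_nat p ^ i * inverse (fact i))"
    using assms by (intro V_mult V_power V_p V_inverse_fact')
  hence "V 1 (of_nat p ^ i * inverse (fact i))"
  proof (rule V_mono)
    have "of_nat (i - 1) * \<kappa> \<le> of_nat (i - 1) * 1"
      using kappa_le_1 by (intro mult_left_mono) auto
    thus "1 \<le> of_nat i * 1 + - (of_nat (i - 1) * \<kappa>)" using assms by (simp add: of_nat_diff)
  qed
  thus ?thesis by (simp add: divide_inverse)
qed

lemma V_1_of_nat_p_mult: "V 1 (of_nat p * x) \<longleftrightarrow> x \<in> R"
proof -
  have eq: "of_nat p * x * P (- 1) = x" using p_gt_1 by (simp add: P_minus P_1 field_simps)
  show ?thesis by (simp only: V_def eq)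
qed

text \<open>Dwork's argument. Write E = g + X^n h with g of degree below n. The coefficient of index
  n in E^p is that of g^p plus p E_n. On the other side of \<open>artin_hasse_power\<close>, exp(p
  X) is 1 modulo p, which leaves the coefficient of g(X^p). As g^p and g(X^p) agree modulo p, p
  divides p E_n in \<open>R\<close>, that is, E_n lies in \<open>R\<close>.\<close>

lemma artin_hasse_in: "artin_hasse p $ n \<in> \<rat> \<and> artin_hasse p $ n \<in> R"
proof (induction n rule: less_induct)
  case (less n)
  define E where "E = artin_hasse p"
  have E0: "E $ 0 = 1" by (simp add: E_def artin_hasse_def)
  show ?case
  proof (cases "n = 0")
    case False
    define g where "g = (\<Sum>i<n. fps_const (E $ i) * fps_X ^ i)"
    define h where "h = fps_shift n E"
    define F where "F = (\<Sum>i<n. fps_const (E $ i) * fps_X ^ (p * i))"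
    have g_nth: "g $ j = (if j < n then E $ j else 0)" for j
    proof -
      have "g $ j = (\<Sum>i<n. if j = i then E $ i else 0)"
        unfolding g_def fps_sum_nth by (intro sum.cong) auto
      thus ?thesis by simp
    qed
    have E_eq: "E = g + fps_X ^ n * h"
      by (rule fps_ext) (auto simp: g_nth h_def fps_X_power_mult_nth)
    obtain c where c: "E ^ p = g ^ p + of_nat p * g ^ (p - 1) * (fps_X ^ n * h) + (fps_X ^ n * h) ^ 2 * c"
      using power_add_expand[of g "fps_X ^ n * h" p] E_eq by auto
    have eq: "((fps_X ^ n * h) ^ 2 * c) = fps_X ^ (n + n) * (h ^ 2 * c)"
      by (simp only: power2_eq_square power_add mult_ac)
    have 1: "((fps_X ^ n * h) ^ 2 * c) $ n = 0"
      unfolding eq using False by (simp add: fps_X_power_mult_nth)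
    have eq: "of_nat p * g ^ (p - 1) * (fps_X ^ n * h) = fps_X ^ n * (fps_const (of_nat p) * (g ^ (p - 1) * h))"
      unfolding fps_of_nat by (simp only: mult_ac)
    have 2: "(of_nat p * g ^ (p - 1) * (fps_X ^ n * h)) $ n = of_nat p * E $ n"
      unfolding eq fps_X_power_mult_nth using False E0 by (simp add: g_nth h_def fps_nth_power_0)
    have lhs: "(E ^ p) $ n = (g ^ p) $ n + of_nat p * E $ n"
      unfolding c fps_add_nth 1 2 by simp
    define a where "a = (\<lambda>i. if p dvd (n - i) then E $ ((n - i) div p) else 0)"
    have n_div: "(n - i) div p < n" if "i \<le> n" for i
      using False p_gt_1 by (intro le_less_trans[OF div_le_mono[of "n - i" n p] div_less_dividend]) auto
    have "(E ^ p) $ n = (fps_exp (of_nat p) * (E oo fps_X ^ p)) $ n"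
      unfolding E_def artin_hasse_power ..
    also have "\<dots> = (\<Sum>i=0..n. of_nat p ^ i / fact i * a i)"
      using p_gt_1 unfolding fps_mult_nth a_def by (intro sum.cong) (auto simp: fps_nth_compose_X_power)
    finally have "(g ^ p) $ n + of_nat p * E $ n = (\<Sum>i=0..n. of_nat p ^ i / fact i * a i)"
      using lhs by simp
    hence pE: "of_nat p * E $ n = (\<Sum>i=0..n. of_nat p ^ i / fact i * a i) - (g ^ p) $ n"
      by (simp add: algebra_simps)
    have a_in: "a i \<in> \<rat>" "a i \<in> R" if "i \<le> n" for i
      using less.IH[OF n_div[OF that]] by (auto simp: a_def E_def)
    have "(\<Sum>i=0..n. of_nat p ^ i / fact i * a i) = a 0 + (\<Sum>i=1..n. of_nat p ^ i / fact i * a i)"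
      by (simp add: sum.atLeast_Suc_atMost)
    \<comment> \<open>As n div p < n, the coefficients of E(X^p) up to index n involve only
      g.\<close>
    also have "a 0 = F $ n"
    proof -
      have "F $ n = (\<Sum>i<n. if n = p * i then E $ i else 0)"
        unfolding F_def fps_sum_nth by (intro sum.cong) auto
      also have "\<dots> = (\<Sum>i\<in>(if p dvd n then {n div p} else {}). E $ i)"
        using p_gt_1 n_div[of 0] by (intro sum.mono_neutral_cong_right) (auto split: if_splits)
      finally show ?thesis by (simp add: a_def)
    qed
    finally have eq: "of_nat p * E $ n = (\<Sum>i=1..n. of_nat p ^ i / fact i * a i) - (g ^ p - F) $ n"
      using pE by simp
    have "V 1 (of_nat p * E $ n)"
      unfolding eq
    proof (intro V_diff V_sum V_mult_R(1) V_p_power_div_fact)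
      show "V 1 ((g ^ p - F) $ n)"
        unfolding g_def F_def using less.IH by (intro fps_frobenius_poly) (auto simp: E_def)
    qed (use a_in in auto)
    hence "E $ n \<in> R" unfolding V_1_of_nat_p_mult .
    moreover have "of_nat p * E $ n \<in> \<rat>"
    proof -
      have "g $ j \<in> \<rat>" for j using less.IH by (auto simp: g_nth E_def)
      moreover have "(fact i :: complex) \<in> \<rat>" for i
        using Rats_of_nat[of "fact i"] by simp
      ultimately show ?thesis unfolding pE using a_in
        by (intro Rats_diff Rats_sum Rats_mult Rats_divide Rats_power Rats_of_nat fps_power_nth_Rats) auto
    qed
    hence "of_nat p * E $ n / of_nat p \<in> \<rat>" by (rule Rats_divide) (rule Rats_of_nat)
    hence "E $ n \<in> \<rat>" using p_gt_1 by simp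
    ultimately show ?thesis by (simp add: E_def)
  qed (use E0 in \<open>simp add: E_def\<close>)
qed

end

section \<open>The splitting function \<open>exp (\<pi> X - \<pi> X\<^sup>p)\<close>\<close>

definition trunc_eval :: "nat \<Rightarrow> complex fps \<Rightarrow> complex \<Rightarrow> complex" where
  "trunc_eval J f x = (\<Sum>j\<le>J. f $ j * x ^ j)"

locale dwork = p_place R \<phi> p for R :: "complex set" and \<phi> :: "complex \<Rightarrow> 'a::field" and p +
  fixes \<pi> :: complex
  assumes varpi: "\<pi> ^ (p - 1) = - of_nat p"
begin

lemma varpi_nonzero [simp]: "\<pi> \<noteq> 0"
  using varpi p_gt_1 by (cases "\<pi> = 0") (auto simp: power_0_left split: if_splits)

lemma varpi_power_p: "\<pi> ^ p = - of_nat p * \<pi>"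
  using varpi p_gt_1 by (cases p) (auto simp: mult.commute)

lemma V_varpi: "V \<kappa> \<pi>" and V_inverse_varpi: "V (- \<kappa>) (inverse \<pi>)"
proof -
  have pos: "p - 1 > 0" using p_gt_1 by simp
  show "V \<kappa> \<pi>"
    by (rule V_root[OF _ pos], unfold varpi kappa_mult V_minus_iff, rule V_p)
  have "V (- 1) (inverse (of_nat p))"
    using V_P[of "-1"] by (simp add: P_minus P_1)
  thus "V (- \<kappa>) (inverse \<pi>)"
    by - (rule V_root[OF _ pos], simp only: power_inverse varpi mult_minus_right kappa_mult
        inverse_minus_eq V_minus_iff)
qed

lemma varpi_in: "\<pi> \<in> R"
  using V_varpi kappa_pos V_in by fastforce

text \<open>The i-th power of h gains i \<kappa>, and the factorial loses only (i - 1) \<kappa>. The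
  surplus \<kappa> demanded of h is what the exponential consumes.\<close>

lemma fexp_V:
  assumes h0: "h $ 0 = 0" and h: "\<And>n. V (\<epsilon> * of_nat n + \<kappa>) (h $ n)"
  shows "V (\<epsilon> * of_nat n) (fexp h $ n)"
    and "n \<ge> 1 \<Longrightarrow> V (\<epsilon> * of_nat n + \<kappa>) (fexp h $ n)"
proof -
  have pow: "V (\<epsilon> * of_nat n + of_nat i * \<kappa>) ((h ^ i) $ n)" for i n
  proof (induction i arbitrary: n)
    case (Suc i)
    have "V (\<epsilon> * of_nat n + of_nat (Suc i) * \<kappa>) (h $ j * (h ^ i) $ (n - j))" if "j \<le> n" for j
    proof -
      have "V ((\<epsilon> * of_nat j + \<kappa>) + (\<epsilon> * of_nat (n - j) + of_nat i * \<kappa>)) (h $ j * (h ^ i) $ (n - j))"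
        by (intro V_mult h Suc)
      also have "(\<epsilon> * of_nat j + \<kappa>) + (\<epsilon> * of_nat (n - j) + of_nat i * \<kappa>) = \<epsilon> * of_nat n + of_nat (Suc i) * \<kappa>"
        using that by (simp add: of_nat_diff algebra_simps)
      finally show ?thesis .
    qed
    thus ?case by (auto simp: fps_mult_nth intro!: V_sum)
  qed (auto simp: V_0)
  have main: "V (\<epsilon> * of_nat n + \<kappa>) (fexp h $ n)" if "n \<ge> 1" for n
    unfolding fexp_nth
  proof (intro V_sum)
    fix i assume "i \<in> {0..n}"
    show "V (\<epsilon> * of_nat n + \<kappa>) (inverse (fact i) * (h ^ i) $ n)"
    proof (cases "i = 0")
      case False
      hence "V (- (of_nat (i - 1) * \<kappa>) + (\<epsilon> * of_nat n + of_nat i * \<kappa>)) (inverse (fact i) * (h ^ i) $ n)"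
        by (intro V_mult V_inverse_fact' pow) auto
      also have "- (of_nat (i - 1) * \<kappa>) + (\<epsilon> * of_nat n + of_nat i * \<kappa>) = \<epsilon> * of_nat n + \<kappa>"
        using False by (simp add: of_nat_diff algebra_simps)
      finally show ?thesis .
    qed (use that in auto)
  qed
  show "n \<ge> 1 \<Longrightarrow> V (\<epsilon> * of_nat n + \<kappa>) (fexp h $ n)" by (rule main)
  show "V (\<epsilon> * of_nat n) (fexp h $ n)"
    using main[of n] kappa_pos by (cases "n = 0") (auto simp: V_0 intro: V_mono)
qed

definition \<Theta> :: "complex fps" where
  "\<Theta> = fexp (fps_const \<pi> * fps_X - fps_const \<pi> * fps_X ^ p)"

text \<open>
  As \<open>\<pi>\<^sup>p / p = - \<pi>\<close>, the first two terms of the logarithm of the Artin--Hasse series at \<open>\<pi> X\<close> give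
  \<open>\<Theta>\<close>; the remaining ones have small coefficients.
\<close>

definition ah_tail :: "complex fps" where
  "ah_tail = Abs_fps (\<lambda>n. if \<exists>j\<ge>2. n = p ^ j then \<pi> ^ n * inverse (of_nat n) else 0)"

text \<open>Divided by p - 1, this says that p^j \<kappa> - j, the valuation of the tail term of
  degree p^j, is at least p^(j - 2) + \<kappa> = \<epsilon> p^j + \<kappa>. The choice of \<epsilon>
  as 1/p^2 comes from here.\<close>

lemma ah_tail_exponent:
  assumes "j \<ge> 2"
  shows "p ^ j - 1 \<ge> (p - 1) * (j + p ^ (j - 2))"
  using assms
proof (induction j rule: dec_induct)
  case base
  have "(p - 1) * 3 \<le> (p - 1) * (p + 1)" using p_gt_1 by (intro mult_left_mono) auto
  also have "\<dots> = p ^ 2 - 1" using p_gt_1 by (cases p) (auto simp: power2_eq_square)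
  finally show ?case by simp
next
  case (step j)
  define i where "i = j - 2"
  have j: "j = i + 2" using step.hyps by (simp add: i_def)
  have "p ^ Suc j = p ^ j + (p - 1) * p ^ j" using p_gt_1 by (cases p) auto
  moreover have "p ^ j \<ge> 1" using p_gt_1 by simp
  ultimately have "p ^ Suc j - 1 = (p ^ j - 1) + (p - 1) * p ^ j" by linarith
  moreover have "p ^ j \<ge> 1 + p ^ Suc i"
  proof -
    have "p ^ Suc i \<ge> 1" using p_gt_1 by simp
    moreover have "p ^ j = p * p ^ Suc i" by (simp add: j)
    moreover have "2 * p ^ Suc i \<le> p * p ^ Suc i" using p_gt_1 by (intro mult_right_mono) auto
    ultimately show ?thesis by linarith
  qed
  hence "(p - 1) * (1 + p ^ Suc i) \<le> (p - 1) * p ^ j" by (intro mult_left_mono) auto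
  ultimately have "(p - 1) * (j + p ^ i) + (p - 1) * (1 + p ^ Suc i) \<le> p ^ Suc j - 1"
    using step.IH by (simp add: i_def)
  moreover have "(p - 1) * (Suc j + p ^ Suc i) \<le> (p - 1) * (j + p ^ i) + (p - 1) * (1 + p ^ Suc i)"
    unfolding distrib_left[symmetric] by (intro mult_left_mono) auto
  ultimately show ?case by (simp add: j)
qed

lemma ah_tail_V: "V (\<epsilon> * of_nat n + \<kappa>) (ah_tail $ n)"
proof (cases "\<exists>j\<ge>2. n = p ^ j")
  case True
  then obtain j where j: "j \<ge> 2" "n = p ^ j" by auto
  define i where "i = j - 2"
  have ji: "j = i + 2" using j by (simp add: i_def)
  have "V (- of_nat j) (inverse (of_nat n))"
    using V_P[of "- of_nat j"] by (simp add: P_minus P_of_nat j)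
  hence "V (of_nat n * \<kappa> + - of_nat j) (\<pi> ^ n * inverse (of_nat n))"
    by (intro V_mult V_power V_varpi)
  moreover have "\<epsilon> * of_nat n + \<kappa> \<le> of_nat n * \<kappa> + - of_nat j"
  proof -
    have eps: "\<epsilon> * of_nat n = of_nat (p ^ i)"
      using p_gt_1 by (simp add: \<epsilon>_def j ji power_add power2_eq_square)
    have "(p - 1) * (j + p ^ i) \<le> n - 1"
      using ah_tail_exponent[OF j(1)] by (simp add: j i_def)
    moreover have "n \<ge> 1" using p_gt_1 by (simp add: j)
    ultimately have "(p - 1) * (j + p ^ i) + 1 \<le> n" by linarith
    hence "of_nat ((p - 1) * (j + p ^ i) + 1) \<le> (of_nat n :: rat)" unfolding of_nat_le_iff .
    hence "of_nat ((p - 1) * (j + p ^ i) + 1) * \<kappa> \<le> of_nat n * \<kappa>"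
      using kappa_pos by (intro mult_right_mono) auto
    also have "of_nat ((p - 1) * (j + p ^ i) + 1) * \<kappa> = of_nat (p - 1) * \<kappa> * (of_nat j + of_nat (p ^ i)) + \<kappa>"
      by (simp only: of_nat_add of_nat_mult of_nat_1) (simp only: algebra_simps mult_1_right)
    finally show ?thesis by (simp only: kappa_mult eps) simp
  qed
  ultimately show ?thesis
    using True by (auto simp: ah_tail_def intro: V_mono)
next
  case False
  hence "ah_tail $ n = 0" unfolding ah_tail_def fps_nth_Abs_fps by metis
  thus ?thesis by simp
qed

lemma theta_factorization:
  "\<Theta> = (artin_hasse p oo (fps_const \<pi> * fps_X)) * fexp (- ah_tail)"
proof -
  let ?L = "artin_hasse_log p oo (fps_const \<pi> * fps_X)"
  have p2: "p \<noteq> 1" "p \<noteq> 0" using p_gt_1 by auto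
  have pj: "p ^ j = p \<longleftrightarrow> j = 1" "p ^ j = 1 \<longleftrightarrow> j = 0" for j
    using p_gt_1 power_inject_exp[of p j 1] power_inject_exp[of p j 0] by auto
  have "fps_const \<pi> * fps_X - fps_const \<pi> * fps_X ^ p = ?L + (- ah_tail)" (is "?lhs = _")
  proof (rule fps_ext)
    fix n
    have L: "?L $ n = \<pi> ^ n * (if \<exists>j. n = p ^ j then inverse (of_nat n) else 0)"
      by (simp add: artin_hasse_log_def)
    show "(fps_const \<pi> * fps_X - fps_const \<pi> * fps_X ^ p) $ n = (?L + (- ah_tail)) $ n"
    proof (cases "\<exists>j. n = p ^ j")
      case True
      then obtain j where j: "n = p ^ j" ..
      consider "j = 0" | "j = 1" | "j \<ge> 2" by linarith
      thus ?thesis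
      proof cases
        assume "j \<ge> 2"
        hence "n \<noteq> 1" "n \<noteq> p" using j pj[of j] by auto
        moreover have "ah_tail $ n = \<pi> ^ n * inverse (of_nat n)"
          using j \<open>j \<ge> 2\<close> by (auto simp: ah_tail_def)
        ultimately show ?thesis using True
          unfolding fps_add_nth fps_neg_nth fps_sub_nth L by simp
      next
        assume "j = 0"
        hence n: "n = 1" using j by simp
        have "1 \<noteq> p ^ j" if "j \<ge> 2" for j using pj(2)[of j] that by linarith
        hence "ah_tail $ 1 = 0" unfolding ah_tail_def fps_nth_Abs_fps by metis
        thus ?thesis using True p2 unfolding fps_add_nth fps_neg_nth fps_sub_nth L unfolding n by simp
      next
        assume "j = 1"
        hence n: "n = p" using j by simp
        have "p \<noteq> p ^ j" if "j \<ge> 2" for j using pj(1)[of j] that by linarith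
        hence "ah_tail $ p = 0" unfolding ah_tail_def fps_nth_Abs_fps by metis
        thus ?thesis using True p2 unfolding fps_add_nth fps_neg_nth fps_sub_nth L unfolding n
          by (simp add: varpi_power_p)
      qed
    next
      case False
      hence "n \<noteq> p ^ 0" "n \<noteq> p ^ 1" by blast+
      hence "n \<noteq> 1" "n \<noteq> p" by simp_all
      moreover have "ah_tail $ n = 0" using False by (auto simp: ah_tail_def)
      ultimately show ?thesis using False unfolding fps_add_nth fps_neg_nth fps_sub_nth L
        by simp
    qed
  qed
  note eq = this
  have "ah_tail $ 0 = 0" using p2 by (auto simp: ah_tail_def)
  hence "fexp ?lhs = fexp ?L * fexp (- ah_tail)"
    unfolding eq by (intro fexp_add) simp_all
  thus ?thesis
    unfolding \<Theta>_def artin_hasse_def by (simp add: fexp_compose)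
qed

text \<open>In the factorisation, the Artin--Hasse factor contributes \<kappa> per degree and the
  tail factor \<epsilon> per degree, plus \<kappa> as soon as it is not constant. Hence beyond the
  linear term every coefficient has valuation strictly above \<kappa>, leaving 1 + \<pi> X as the
  leading part.\<close>

lemma
  shows theta_0: "\<Theta> $ 0 = 1" and theta_1: "\<Theta> $ 1 = \<pi>"
    and theta_V: "V (\<epsilon> * of_nat n) (\<Theta> $ n)"
    and theta_V_ge_2: "n \<ge> 2 \<Longrightarrow> V (\<kappa> + \<epsilon>) (\<Theta> $ n)"
proof -
  show "\<Theta> $ 0 = 1" by (simp add: \<Theta>_def)
  show "\<Theta> $ 1 = \<pi>" using p_gt_1 by (simp add: \<Theta>_def fexp_nth)
  have t0: "(- ah_tail) $ 0 = 0" using p_gt_1 by (auto simp: ah_tail_def)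
  note tail = fexp_V[of "- ah_tail", OF t0, unfolded fps_neg_nth V_minus_iff, OF ah_tail_V]
  have E: "V (of_nat i * \<kappa>) ((artin_hasse p oo (fps_const \<pi> * fps_X)) $ i)" for i
    using V_power[OF V_varpi, of i] artin_hasse_in[of i] by (auto intro: V_mult_R(1))
  have theta: "\<Theta> $ n = (\<Sum>i=0..n. (artin_hasse p oo (fps_const \<pi> * fps_X)) $ i * fexp (- ah_tail) $ (n - i))"
    unfolding theta_factorization fps_mult_nth ..
  show "V (\<epsilon> * of_nat n) (\<Theta> $ n)"
    unfolding theta
  proof (intro V_sum)
    fix i assume i: "i \<in> {0..n}"
    have "V (of_nat i * \<kappa> + \<epsilon> * of_nat (n - i))
            ((artin_hasse p oo (fps_const \<pi> * fps_X)) $ i * fexp (- ah_tail) $ (n - i))"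
      by (intro V_mult E tail)
    moreover have "\<epsilon> * of_nat i \<le> \<kappa> * of_nat i" using eps_le_kappa by (intro mult_right_mono) auto
    ultimately show "V (\<epsilon> * of_nat n)
            ((artin_hasse p oo (fps_const \<pi> * fps_X)) $ i * fexp (- ah_tail) $ (n - i))"
      using i by (elim V_mono) (auto simp: of_nat_diff algebra_simps)
  qed
  show "V (\<kappa> + \<epsilon>) (\<Theta> $ n)" if n: "n \<ge> 2"
    unfolding theta
  proof (intro V_sum)
    fix i assume i: "i \<in> {0..n}"
    show "V (\<kappa> + \<epsilon>) ((artin_hasse p oo (fps_const \<pi> * fps_X)) $ i * fexp (- ah_tail) $ (n - i))"
    proof (cases "i = n")
      case True
      have "2 * \<kappa> \<le> of_nat n * \<kappa>" using n kappa_pos by (intro mult_right_mono) auto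
      hence "\<kappa> + \<epsilon> \<le> of_nat n * \<kappa>" using eps_le_kappa by linarith
      with E[of n] have "V (\<kappa> + \<epsilon>) ((artin_hasse p oo (fps_const \<pi> * fps_X)) $ n)" by (rule V_mono)
      thus ?thesis using True by simp
    next
      case False
      hence "n - i \<ge> 1" using i by auto
      hence "V (of_nat i * \<kappa> + (\<epsilon> * of_nat (n - i) + \<kappa>))
              ((artin_hasse p oo (fps_const \<pi> * fps_X)) $ i * fexp (- ah_tail) $ (n - i))"
        by (intro V_mult E tail)
      moreover have "\<epsilon> * 1 \<le> \<epsilon> * of_nat (n - i)"
        using \<open>n - i \<ge> 1\<close> eps_pos by (intro mult_left_mono) (auto simp del: of_nat_diff)
      moreover have "of_nat i * \<kappa> \<ge> 0" using kappa_pos by simp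
      ultimately show ?thesis by (elim V_mono) linarith
    qed
  qed
qed

text \<open>The telescoping partner of \<Theta>: formally \<Theta>(X)^p is the quotient of
  \<Gamma>(X) by \<Gamma>(X^p), and \<Gamma>, unlike exp(\<pi> X), has coefficients decaying fast
  enough to be evaluated at integral points.\<close>

definition \<Gamma> :: "complex fps" where "\<Gamma> = fps_exp (of_nat p * \<pi>)"

lemma Gamma_0: "\<Gamma> $ 0 = 1"
  by (simp add: \<Gamma>_def)

lemma Gamma_V: "V (of_nat n) (\<Gamma> $ n)"
proof (cases "n = 0")
  case False
  have "V (of_nat n * (1 + \<kappa>) + - (of_nat (n - 1) * \<kappa>)) ((of_nat p * \<pi>) ^ n * inverse (fact n))"
    using False by (intro V_mult V_power V_inverse_fact' V_p V_varpi) auto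
  moreover have "of_nat n \<le> of_nat n * (1 + \<kappa>) + - (of_nat (n - 1) * \<kappa>)"
    using kappa_pos False by (simp add: of_nat_diff algebra_simps)
  ultimately show ?thesis by (auto simp: \<Gamma>_def divide_inverse intro: V_mono)
qed (simp add: Gamma_0 V_0)

lemma theta_telescope: "\<Theta> ^ p * (\<Gamma> oo fps_X ^ p) = \<Gamma>"
proof -
  let ?c = "fps_const (of_nat p * \<pi>)"
  have X0: "(fps_X ^ p :: complex fps) $ 0 = 0" using p_gt_1 by simp
  have "\<Gamma> oo fps_X ^ p = fexp (?c * fps_X oo fps_X ^ p)"
    using X0 unfolding \<Gamma>_def fexp_linear[symmetric] by (subst fexp_compose) auto
  also have "?c * fps_X oo fps_X ^ p = ?c * fps_X ^ p"
    using X0 by (simp only: fps_compose_mult_distrib fps_const_compose fps_X_fps_compose_startby0)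
  finally have G: "\<Gamma> oo fps_X ^ p = fexp (?c * fps_X ^ p)" .
  have "\<Theta> ^ p = fexp (of_nat p * (fps_const \<pi> * fps_X - fps_const \<pi> * fps_X ^ p))"
    unfolding \<Theta>_def using X0 by (intro fexp_power) simp
  also have "of_nat p * (fps_const \<pi> * fps_X - fps_const \<pi> * fps_X ^ p) = ?c * fps_X - ?c * fps_X ^ p"
    by (simp only: fps_of_nat[symmetric] fps_const_mult[symmetric] algebra_simps)
  finally have "\<Theta> ^ p * (\<Gamma> oo fps_X ^ p) = fexp ((?c * fps_X - ?c * fps_X ^ p) + ?c * fps_X ^ p)"
    unfolding G using X0 by (subst fexp_add) auto
  thus ?thesis by (simp add: fexp_linear \<Gamma>_def)
qed

end

section \<open>Truncated evaluation and values near roots of unity\<close>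

context p_place
begin

lemma V_prod_cong:
  assumes "\<And>i. i \<in> I \<Longrightarrow> a i \<in> R" "\<And>i. i \<in> I \<Longrightarrow> b i \<in> R" "\<And>i. i \<in> I \<Longrightarrow> V r (a i - b i)"
  shows "V r (prod a I - prod b I)"
  using assms
proof (induction I rule: infinite_finite_induct)
  case (insert i I)
  have "V r ((a i - b i) * prod a I + b i * (prod a I - prod b I))"
    using insert by (intro V_add V_mult_R(1) V_mult_R(2)[of r "prod a I - prod b I"] prod_in) auto
  thus ?case using insert.hyps by (simp add: algebra_simps)
qed auto

text \<open>A factor that fails \<open>V s\<close> has an inverse of valuation at least -s, so it
  can be divided out without spoiling the bound for the rest.\<close>

lemma V_prod_mset_factor:
  assumes "V (of_nat (size A) * s) (\<Prod>x\<in>#A. f x)" "A \<noteq> {#}"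
  shows "\<exists>x\<in>#A. V s (f x)"
  using assms
proof (induction A)
  case (add x A)
  show ?case
  proof (cases "V s (f x)")
    case False
    hence "inverse (f x * P (- s)) \<in> R" using not_in unfolding V_def by blast
    hence V: "V (- s) (inverse (f x))" by (simp add: V_def P_minus)
    have "f x \<noteq> 0" using False by auto
    have "V (of_nat (size (add_mset x A)) * s + - s) ((\<Prod>x\<in>#add_mset x A. f x) * inverse (f x))"
      using add.prems(1) V by (rule V_mult)
    also have "(\<Prod>x\<in>#add_mset x A. f x) * inverse (f x) = (\<Prod>x\<in>#A. f x)"
      using \<open>f x \<noteq> 0\<close> by simp
    also have "of_nat (size (add_mset x A)) * s + - s = of_nat (size A) * s"
      by (simp add: algebra_simps)
    finally have *: "V (of_nat (size A) * s) (\<Prod>x\<in>#A. f x)" .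
    show ?thesis
    proof (cases "A = {#}")
      case True
      thus ?thesis using add.prems(1) by simp
    qed (use add.IH[OF *] in auto)
  qed auto
qed simp

text \<open>Some linear factor of x^n - 1 has at least the average valuation; the division of the
  precision by p in the splitting theorem comes from here.\<close>

lemma V_near_root_of_unity:
  assumes "V (of_nat n * s) (x ^ n - 1)" "n > 0"
  shows "\<exists>\<eta>. \<eta> ^ n = 1 \<and> V s (x - \<eta>)"
proof -
  define Q :: "complex poly" where "Q = monom 1 n - 1"
  have deg: "degree Q = n"
    unfolding Q_def using assms(2)
    by (intro antisym degree_diff_le le_degree) (auto simp: degree_monom_eq)
  obtain A where A: "size A = degree Q" "Q = smult (lead_coeff Q) (\<Prod>x\<in>#A. [:-x, 1:])"
    using alg_closed_imp_factorization[of Q] deg assms(2) by fastforce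
  have lc: "lead_coeff Q = 1" using deg assms(2) by (simp add: Q_def)
  have Q: "poly Q y = (\<Prod>x\<in>#A. y - x)" for y
    by (subst A(2)) (simp add: lc poly_prod_mset image_mset.compositionality o_def)
  have "poly Q x = x ^ n - 1" by (simp add: Q_def poly_monom)
  hence "V (of_nat (size A) * s) (\<Prod>y\<in>#A. x - y)" using assms(1) A(1) deg Q[of x] by simp
  moreover have "A \<noteq> {#}" using A(1) deg assms(2) by auto
  ultimately obtain \<eta> where "\<eta> \<in># A" "V s (x - \<eta>)" using V_prod_mset_factor by blast
  moreover have "poly Q \<eta> = 0" using \<open>\<eta> \<in># A\<close> unfolding Q by (auto simp: prod_mset_zero_iff)
  hence "\<eta> ^ n = 1" by (simp add: Q_def poly_monom)
  ultimately show ?thesis by blast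
qed

definition overconvergent :: "complex fps \<Rightarrow> bool" where
  "overconvergent f \<longleftrightarrow> (\<forall>n. V (\<epsilon> * of_nat n) (f $ n))"

lemma overconvergent_mult:
  assumes "overconvergent f" "overconvergent g"
  shows "overconvergent (f * g)"
  unfolding overconvergent_def fps_mult_nth
proof (intro allI V_sum)
  fix n i :: nat assume "i \<in> {0..n}"
  hence "\<epsilon> * of_nat n = \<epsilon> * of_nat i + \<epsilon> * of_nat (n - i)"
    by (simp add: of_nat_diff algebra_simps)
  moreover have "V (\<epsilon> * of_nat i + \<epsilon> * of_nat (n - i)) (f $ i * g $ (n - i))"
    using assms by (intro V_mult) (auto simp: overconvergent_def)
  ultimately show "V (\<epsilon> * of_nat n) (f $ i * g $ (n - i))" by simp
qed

lemma overconvergent_power: "overconvergent f \<Longrightarrow> overconvergent (f ^ n)"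
proof (induction n)
  case 0
  show ?case by (simp add: overconvergent_def V_0)
qed (simp add: overconvergent_mult)

lemma trunc_eval_in: "overconvergent f \<Longrightarrow> x \<in> R \<Longrightarrow> trunc_eval J f x \<in> R"
  unfolding trunc_eval_def overconvergent_def using eps_pos
  by (intro sum_in mult_in power_in) (auto intro: V_in)

text \<open>The products missing from the truncation have degree above J, hence valuation at least
  \<epsilon> J.\<close>

lemma trunc_eval_mult:
  assumes "overconvergent f" "overconvergent g" "x \<in> R"
  shows "V (\<epsilon> * of_nat J) (trunc_eval J f x * trunc_eval J g x - trunc_eval J (f * g) x)"
proof -
  let ?h = "\<lambda>(i, j). f $ i * g $ j * x ^ (i + j)"
  let ?S = "{..J} \<times> {..J}" and ?T = "{(i, j). i + j \<le> J}"
  have sub: "?T \<subseteq> ?S" by auto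
  have "trunc_eval J f x * trunc_eval J g x = sum ?h ?S"
    unfolding trunc_eval_def sum_product sum.cartesian_product
    by (intro sum.cong) (auto simp: power_add)
  moreover have "trunc_eval J (f * g) x = sum ?h ?T"
  proof -
    have "trunc_eval J (f * g) x = (\<Sum>k\<le>J. \<Sum>i\<le>k. f $ i * g $ (k - i) * x ^ (i + (k - i)))"
      unfolding trunc_eval_def fps_mult_nth sum_distrib_right
      by (intro sum.cong) (auto simp: atLeast0AtMost)
    also have "\<dots> = sum ?h ?T"
      by (rule sum.triangle_reindex_eq[symmetric])
    finally show ?thesis .
  qed
  moreover have "sum ?h ?S = sum ?h (?S - ?T) + sum ?h ?T"
    by (rule sum.subset_diff[OF sub]) auto
  moreover have "V (\<epsilon> * of_nat J) (sum ?h (?S - ?T))"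
  proof (intro V_sum)
    fix ij assume "ij \<in> ?S - ?T"
    then obtain i j where ij: "ij = (i, j)" "J \<le> i + j" by force
    have "V (\<epsilon> * of_nat i + \<epsilon> * of_nat j) (f $ i * g $ j * x ^ (i + j))"
      using assms by (intro V_mult_R(1) V_mult power_in) (auto simp: overconvergent_def)
    moreover have "\<epsilon> * of_nat J \<le> \<epsilon> * of_nat (i + j)"
      using ij eps_pos by (intro mult_left_mono) (auto simp del: of_nat_add)
    ultimately show "V (\<epsilon> * of_nat J) (?h ij)"
      unfolding ij by (auto simp: algebra_simps intro: V_mono)
  qed
  ultimately show ?thesis by simp
qed

lemma trunc_eval_power:
  assumes "overconvergent f" "x \<in> R"
  shows "V (\<epsilon> * of_nat J) (trunc_eval J f x ^ m - trunc_eval J (f ^ m) x)"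
proof (induction m)
  case 0
  have "trunc_eval J 1 x = (\<Sum>j\<le>J. if j = 0 then 1 else 0)"
    unfolding trunc_eval_def by (intro sum.cong) auto
  thus ?case by simp
next
  case (Suc m)
  let ?t = "trunc_eval J f x" and ?u = "trunc_eval J (f ^ m) x"
  have "V (\<epsilon> * of_nat J) (?t * (?t ^ m - ?u) + (?t * ?u - trunc_eval J (f * f ^ m) x))"
    using assms Suc by (intro V_add V_mult_R(2) trunc_eval_mult overconvergent_power trunc_eval_in)
  thus ?case by (simp add: algebra_simps)
qed

end

context dwork
begin

lemma overconvergent_theta: "overconvergent \<Theta>"
  by (simp add: overconvergent_def theta_V)

lemma overconvergent_Gamma: "overconvergent \<Gamma>"
  unfolding overconvergent_def
proof
  fix n
  have "\<epsilon> * of_nat n \<le> 1 * of_nat n"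
    using eps_le_kappa kappa_le_1 by (intro mult_right_mono) auto
  thus "V (\<epsilon> * of_nat n) (\<Gamma> $ n)" using Gamma_V[of n] by (auto intro: V_mono)
qed

lemma Gamma_compose_nth: "(\<Gamma> oo fps_X ^ p) $ n = (if p dvd n then \<Gamma> $ (n div p) else 0)"
  using p_gt_1 by (simp add: fps_nth_compose_X_power)

lemma overconvergent_Gamma_compose: "overconvergent (\<Gamma> oo fps_X ^ p)"
  unfolding overconvergent_def Gamma_compose_nth
proof
  fix n
  show "V (\<epsilon> * of_nat n) (if p dvd n then \<Gamma> $ (n div p) else 0)"
  proof (cases "p dvd n")
    case True
    then obtain m where m: "n = p * m" ..
    have "(of_nat p * \<epsilon>) * of_nat m \<le> 1 * of_nat m"
      using eps_mult_p by (intro mult_right_mono) auto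
    thus ?thesis using Gamma_V[of m] p_gt_1 by (auto simp: m mult_ac intro: V_mono)
  qed simp
qed

lemma trunc_eval_Gamma_compose:
  assumes "x \<in> R"
  shows "V (\<epsilon> * of_nat J) (trunc_eval J \<Gamma> (x ^ p) - trunc_eval J (\<Gamma> oo fps_X ^ p) x)"
proof -
  let ?h = "\<lambda>j. \<Gamma> $ j * x ^ (p * j)"
  have "trunc_eval J (\<Gamma> oo fps_X ^ p) x = (\<Sum>n\<in>(\<lambda>j. p * j) ` {..J div p}. \<Gamma> $ (n div p) * x ^ n)"
    unfolding trunc_eval_def Gamma_compose_nth
  proof (intro sum.mono_neutral_cong_right)
    show "(\<lambda>j. p * j) ` {..J div p} \<subseteq> {..J}"
      using p_gt_1 by (auto simp: mult.commute less_eq_div_iff_mult_less_eq)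
    show "\<forall>i\<in>{..J} - (\<lambda>j. p * j) ` {..J div p}. (if p dvd i then \<Gamma> $ (i div p) else 0) * x ^ i = 0"
    proof
      fix i assume i: "i \<in> {..J} - (\<lambda>j. p * j) ` {..J div p}"
      have "\<not> p dvd i"
      proof
        assume "p dvd i"
        hence "i = p * (i div p)" "i div p \<le> J div p" using i by (auto intro: div_le_mono)
        thus False using i by blast
      qed
      thus "(if p dvd i then \<Gamma> $ (i div p) else 0) * x ^ i = 0" by simp
    qed
  qed auto
  also have "\<dots> = sum ?h {..J div p}"
    using p_gt_1 by (subst sum.reindex) (auto simp: inj_on_def)
  finally have 1: "trunc_eval J (\<Gamma> oo fps_X ^ p) x = sum ?h {..J div p}" .
  have "J div p \<le> J" by simp
  hence sub: "{..J div p} \<subseteq> {..J}" by auto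
  have "trunc_eval J \<Gamma> (x ^ p) = sum ?h {..J}" by (simp add: trunc_eval_def power_mult)
  also have "\<dots> = sum ?h ({..J} - {..J div p}) + sum ?h {..J div p}"
    by (rule sum.subset_diff[OF sub]) auto
  finally have "trunc_eval J \<Gamma> (x ^ p) - trunc_eval J (\<Gamma> oo fps_X ^ p) x = sum ?h ({..J} - {..J div p})"
    using 1 by simp
  moreover have "V (\<epsilon> * of_nat J) (sum ?h ({..J} - {..J div p}))"
  proof (intro V_sum V_mult_R(1) power_in assms)
    fix j assume "j \<in> {..J} - {..J div p}"
    hence "J div p < j" by auto
    hence "J < j * p" using p_gt_1 by (simp add: div_less_iff_less_mult)
    hence "\<epsilon> * of_nat J \<le> \<epsilon> * of_nat (j * p)"
      using eps_pos by (intro mult_left_mono) (auto simp del: of_nat_mult)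
    also have "\<dots> = (of_nat p * \<epsilon>) * of_nat j" by simp
    also have "\<dots> \<le> 1 * of_nat j" using eps_mult_p by (intro mult_right_mono) auto
    finally show "V (\<epsilon> * of_nat J) (\<Gamma> $ j)" using Gamma_V[of j] by (auto intro: V_mono)
  qed
  ultimately show ?thesis by simp
qed

lemma trunc_theta_telescope:
  assumes "x \<in> R"
  shows "V (\<epsilon> * of_nat J)
           (trunc_eval J \<Theta> x ^ p * trunc_eval J \<Gamma> (x ^ p) - trunc_eval J \<Gamma> x)"
proof -
  let ?t = "trunc_eval J \<Theta> x" and ?g = "trunc_eval J \<Gamma> (x ^ p)"
  let ?t1 = "trunc_eval J (\<Theta> ^ p) x" and ?t2 = "trunc_eval J (\<Gamma> oo fps_X ^ p) x"
  have oc: "overconvergent (\<Theta> ^ p)" by (intro overconvergent_power overconvergent_theta)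
  have "V (\<epsilon> * of_nat J) ((?t ^ p - ?t1) * ?g + ?t1 * (?g - ?t2)
          + (?t1 * ?t2 - trunc_eval J (\<Theta> ^ p * (\<Gamma> oo fps_X ^ p)) x))"
    using assms by (intro V_add V_mult_R(1)[of _ "?t ^ p - ?t1"] V_mult_R(2)[of _ "?g - ?t2"]
      trunc_eval_mult oc overconvergent_Gamma_compose overconvergent_theta overconvergent_Gamma
      trunc_eval_power trunc_eval_Gamma_compose trunc_eval_in power_in)
  thus ?thesis by (simp add: theta_telescope algebra_simps)
qed

lemma trunc_Gamma_unit:
  assumes "x \<in> R"
  shows "\<phi> (trunc_eval J \<Gamma> x) = 1"
proof -
  have "V 1 (\<Sum>j\<in>{1..J}. \<Gamma> $ j * x ^ j)"
    using assms by (intro V_sum V_mult_R(1) power_in V_mono[OF Gamma_V]) auto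
  hence V: "(\<Sum>j\<in>{1..J}. \<Gamma> $ j * x ^ j) \<in> R" "\<phi> (\<Sum>j\<in>{1..J}. \<Gamma> $ j * x ^ j) = 0"
    by (auto intro: V_in V_hom_eq_0)
  have "{..J} = insert 0 {1..J}" by auto
  hence "trunc_eval J \<Gamma> x = 1 + (\<Sum>j\<in>{1..J}. \<Gamma> $ j * x ^ j)"
    by (simp add: trunc_eval_def Gamma_0)
  thus ?thesis using V by (simp add: hom_add)
qed

text \<open>Over a Frobenius orbit that closes up after k steps, the \<Gamma> factors at x^(p^(i+1))
  are a cyclic shift of those at x^(p^i). Their product g is a unit and cancels, so the p-th power
  of the \<Theta> product is close to 1.\<close>

lemma theta_product_near_root:
  assumes x: "x \<in> R" and xk: "x ^ (p ^ k) = x"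
  shows "V (\<epsilon> * of_nat J) ((\<Prod>i<k. trunc_eval J \<Theta> (x ^ p ^ i)) ^ p - 1)"
proof -
  define g where "g = (\<Prod>i<k. trunc_eval J \<Gamma> (x ^ p ^ i))"
  let ?X = "\<Prod>i<k. trunc_eval J \<Theta> (x ^ p ^ i)"
  have "V (\<epsilon> * of_nat J) ((\<Prod>i<k. trunc_eval J \<Theta> (x ^ p ^ i) ^ p * trunc_eval J \<Gamma> ((x ^ p ^ i) ^ p))
           - (\<Prod>i<k. trunc_eval J \<Gamma> (x ^ p ^ i)))"
    using x by (intro V_prod_cong trunc_theta_telescope mult_in power_in trunc_eval_in
      overconvergent_theta overconvergent_Gamma)
  also have "(\<Prod>i<k. trunc_eval J \<Theta> (x ^ p ^ i) ^ p * trunc_eval J \<Gamma> ((x ^ p ^ i) ^ p)) =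
     ?X ^ p * (\<Prod>i<k. trunc_eval J \<Gamma> (x ^ p ^ Suc i))"
    by (simp only: prod.distrib prod_power_distrib power_Suc2 power_mult)
  also have "(\<Prod>i<k. trunc_eval J \<Gamma> (x ^ p ^ Suc i)) = g"
  proof (cases k)
    case (Suc m)
    have "(\<Prod>i<Suc m. trunc_eval J \<Gamma> (x ^ p ^ Suc i)) =
        (\<Prod>i<m. trunc_eval J \<Gamma> (x ^ p ^ Suc i)) * trunc_eval J \<Gamma> (x ^ p ^ k)"
      by (simp add: Suc)
    also have "x ^ p ^ k = x ^ p ^ 0" using xk by simp
    also have "(\<Prod>i<m. trunc_eval J \<Gamma> (x ^ p ^ Suc i)) * trunc_eval J \<Gamma> (x ^ p ^ 0) = g"
      unfolding g_def Suc prod.lessThan_Suc_shift by (simp only: mult.commute o_def)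
    finally show ?thesis by (simp only: Suc)
  qed (simp add: g_def)
  finally have V: "V (\<epsilon> * of_nat J) ((?X ^ p - 1) * g)"
    by (simp add: g_def algebra_simps)
  have g_in: "g \<in> R"
    unfolding g_def using x by (intro prod_in trunc_eval_in overconvergent_Gamma power_in)
  have "\<phi> g = (\<Prod>i<k. \<phi> (trunc_eval J \<Gamma> (x ^ p ^ i)))"
    unfolding g_def using x by (intro hom_prod trunc_eval_in overconvergent_Gamma power_in)
  hence g1: "\<phi> g = 1" using x by (simp add: trunc_Gamma_unit power_in)
  hence "g \<noteq> 0" by auto
  have "V (\<epsilon> * of_nat J) ((?X ^ p - 1) * g * inverse g)"
    by (rule V_mult_R(1)[OF V inverse_in[OF g_in]]) (simp add: g1)
  also have "(?X ^ p - 1) * g * inverse g = ?X ^ p - 1" using \<open>g \<noteq> 0\<close> by simp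
  finally show ?thesis .
qed

end

section \<open>Leading coefficients of units and the splitting theorem\<close>

context dwork
begin

text \<open>For x = 1 + \<pi> y with y in \<open>R\<close>, the residue of y. On such x it turns
  products into sums, and it is the device by which a root of unity is recognised from an
  approximation.\<close>

definition lead :: "complex \<Rightarrow> 'a" where
  "lead x = \<phi> ((x - 1) * inverse \<pi>)"

lemma V_kappa_div_varpi: "V \<kappa> x \<Longrightarrow> x * inverse \<pi> \<in> R"
  using V_mult[OF _ V_inverse_varpi, of \<kappa> x] by (simp add: V_0)

lemma V_kappa_hom: "V \<kappa> (x - 1) \<Longrightarrow> x \<in> R" "V \<kappa> (x - 1) \<Longrightarrow> \<phi> x = 1"
proof -
  assume V: "V \<kappa> (x - 1)"
  have "x - 1 \<in> R" using V kappa_pos by (intro V_in[OF V]) auto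
  moreover have "\<phi> (x - 1) = 0" using V kappa_pos by (rule V_hom_eq_0)
  ultimately show "x \<in> R" "\<phi> x = 1" using add_in[of "x - 1" 1] hom_add[of "x - 1" 1] by auto
qed

lemma lead_mult:
  assumes "V \<kappa> (x - 1)" "V \<kappa> (y - 1)"
  shows "V \<kappa> (x * y - 1)" "lead (x * y) = lead x + lead y"
proof -
  note y = V_kappa_hom[OF assms(2)]
  have eq: "x * y - 1 = (x - 1) * y + (y - 1)" by (simp add: algebra_simps)
  show "V \<kappa> (x * y - 1)" unfolding eq using assms y by (intro V_add V_mult_R(1))
  have "lead (x * y) = \<phi> ((x - 1) * inverse \<pi> * y + (y - 1) * inverse \<pi>)"
    unfolding lead_def eq by (simp add: algebra_simps)
  also have "\<dots> = lead x + lead y"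
    using y V_kappa_div_varpi[OF assms(1)] V_kappa_div_varpi[OF assms(2)]
    by (simp add: hom_add hom_mult mult_in lead_def)
  finally show "lead (x * y) = lead x + lead y" .
qed

lemma lead_1 [simp]: "lead 1 = 0"
  by (simp add: lead_def)

lemma lead_prod:
  assumes "\<And>i. i \<in> I \<Longrightarrow> V \<kappa> (f i - 1)"
  shows "V \<kappa> (prod f I - 1) \<and> lead (prod f I) = (\<Sum>i\<in>I. lead (f i))"
  using assms by (induction I rule: infinite_finite_induct) (auto simp: lead_mult)

lemma lead_power:
  assumes "V \<kappa> (x - 1)"
  shows "V \<kappa> (x ^ n - 1) \<and> lead (x ^ n) = of_nat n * lead x"
  using lead_prod[of "{..<n}" "\<lambda>_. x"] assms by simp

lemma lead_cong:
  assumes "V \<kappa> (x - 1)" "V r (x - y)" "r > \<kappa>"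
  shows "V \<kappa> (y - 1)" "lead y = lead x"
proof -
  have xy: "V \<kappa> (x - y)" using assms(2,3) by (elim V_mono) simp
  have "y - 1 = (x - 1) - (x - y)" by simp
  thus V: "V \<kappa> (y - 1)" using V_diff[OF assms(1) xy] by simp
  have "V (r - \<kappa>) ((x - y) * inverse \<pi>)"
    using V_mult[OF assms(2) V_inverse_varpi] by simp
  hence "\<phi> ((x - y) * inverse \<pi>) = 0" using assms(3) by (intro V_hom_eq_0) auto
  moreover have "(x - 1) * inverse \<pi> = (y - 1) * inverse \<pi> + (x - y) * inverse \<pi>"
    by (simp add: algebra_simps)
  ultimately show "lead y = lead x"
    using hom_add[OF V_kappa_div_varpi[OF V] V_kappa_div_varpi[OF xy]] by (simp add: lead_def)
qed

text \<open>With \<eta> = 1 + \<pi> \<delta>, expanding \<eta>^p = 1 gives p \<pi> \<delta> (1 -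
  \<delta>^(p-1) + z) = 0 with z of zero residue. If \<delta> is nonzero the bracket vanishes, which
  is impossible when \<delta> reduces to 0. So distinct p-th roots of unity in this neighbourhood
  have distinct leading coefficients.\<close>

lemma root_of_unity_lead_0:
  assumes "\<eta> ^ p = 1" "V \<kappa> (\<eta> - 1)" "lead \<eta> = 0"
  shows "\<eta> = 1"
proof (rule ccontr)
  assume "\<eta> \<noteq> 1"
  define \<delta> where "\<delta> = (\<eta> - 1) * inverse \<pi>"
  have \<delta>: "\<delta> \<in> R" "\<phi> \<delta> = 0" "\<delta> \<noteq> 0"
    using V_kappa_div_varpi[OF assms(2)] assms(3) \<open>\<eta> \<noteq> 1\<close> by (auto simp: \<delta>_def lead_def)
  have \<eta>: "\<eta> = \<pi> * \<delta> + 1" using varpi_nonzero by (simp add: \<delta>_def field_simps)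
  have pd: "\<phi> (\<pi> * \<delta>) = 0" "\<pi> * \<delta> \<in> R" using \<delta> varpi_in by (auto simp: hom_mult mult_in)
  define z where "z = (\<Sum>k\<in>{1<..<p}. of_nat ((p choose k) div p) * (\<pi> * \<delta>) ^ (k - 1))"
  have "1 = (\<Sum>k\<le>p. of_nat (p choose k) * (\<pi> * \<delta>) ^ k)"
    using assms(1) unfolding \<eta> binomial_ring by simp
  also have "{..p} = insert 0 (insert 1 (insert p {1<..<p}))" using p_gt_1 by auto
  also have "(\<Sum>k\<in>\<dots>. of_nat (p choose k) * (\<pi> * \<delta>) ^ k) =
      1 + of_nat p * (\<pi> * \<delta>) + (\<pi> * \<delta>) ^ p + (\<Sum>k\<in>{1<..<p}. of_nat (p choose k) * (\<pi> * \<delta>) ^ k)"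
    using p_gt_1 by simp
  also have "(\<Sum>k\<in>{1<..<p}. of_nat (p choose k) * (\<pi> * \<delta>) ^ k) = of_nat p * (\<pi> * \<delta>) * z"
    unfolding z_def sum_distrib_left
  proof (intro sum.cong refl)
    fix k assume k: "k \<in> {1<..<p}"
    hence "p dvd (p choose k)" using dvd_choose_prime[OF _ _ _ prime_p, of k] by auto
    hence "(of_nat (p choose k) :: complex) = of_nat p * of_nat ((p choose k) div p)"
      unfolding of_nat_mult[symmetric] by simp
    moreover have "(\<pi> * \<delta>) ^ k = (\<pi> * \<delta>) * (\<pi> * \<delta>) ^ (k - 1)" using k by (cases k) auto
    ultimately show "of_nat (p choose k) * (\<pi> * \<delta>) ^ k =
        of_nat p * (\<pi> * \<delta>) * (of_nat ((p choose k) div p) * (\<pi> * \<delta>) ^ (k - 1))"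
      by (simp only: mult_ac)
  qed
  \<comment> \<open>The equation \<pi>^p = -p \<pi> puts the top term on the scale of the linear
    one.\<close>
  also have "(\<pi> * \<delta>) ^ p = of_nat p * (\<pi> * \<delta>) * (- (\<delta> ^ (p - 1)))"
  proof -
    have "\<delta> ^ p = \<delta> * \<delta> ^ (p - 1)" using p_gt_1 by (cases p) auto
    thus ?thesis by (simp add: power_mult_distrib varpi_power_p)
  qed
  finally have "of_nat p * (\<pi> * \<delta>) * (1 - \<delta> ^ (p - 1) + z) = 0"
    by (simp add: algebra_simps)
  hence "1 - \<delta> ^ (p - 1) + z = 0" using \<delta>(3) p_gt_1 by simp
  moreover have "z \<in> R" "\<phi> z = 0"
    unfolding z_def using pd
    by (auto simp: hom_sum hom_mult hom_power mult_in power_in intro!: sum_in sum.neutral)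
  moreover have "\<phi> (1 - \<delta> ^ (p - 1) + z) = 1 - \<phi> \<delta> ^ (p - 1) + \<phi> z"
    using \<delta>(1) \<open>z \<in> R\<close> by (simp add: hom_add hom_diff hom_power power_in diff_in)
  ultimately show False using \<delta>(2) p_gt_1 by (simp add: power_0_left)
qed

lemma lead_theta:
  assumes "x \<in> R" "J \<ge> 1"
  shows "V \<kappa> (trunc_eval J \<Theta> x - 1)" "lead (trunc_eval J \<Theta> x) = \<phi> x"
proof -
  let ?r = "\<Sum>j\<in>{2..J}. \<Theta> $ j * x ^ j"
  have "{..J} = insert 0 (insert 1 {2..J})" using assms(2) by auto
  hence eq: "trunc_eval J \<Theta> x = 1 + \<pi> * x + ?r"
    by (simp add: trunc_eval_def theta_0 theta_1[simplified])
  have r: "V (\<kappa> + \<epsilon>) ?r"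
    using assms by (intro V_sum V_mult_R(1) power_in theta_V_ge_2) auto
  have 1: "V \<kappa> ((1 + \<pi> * x) - 1)" "lead (1 + \<pi> * x) = \<phi> x"
    using assms V_varpi by (simp_all add: V_mult_R lead_def field_simps)
  have 2: "V (\<kappa> + \<epsilon>) ((1 + \<pi> * x) - trunc_eval J \<Theta> x)" "\<kappa> + \<epsilon> > \<kappa>"
    using r eps_pos by (simp_all add: eq)
  show "V \<kappa> (trunc_eval J \<Theta> x - 1)" "lead (trunc_eval J \<Theta> x) = \<phi> x"
    using lead_cong[OF 1(1) 2] 1(2) by auto
qed

text \<open>The condition on J makes the precision exceed \<kappa>, so the nearby root of unity
  inherits the leading coefficient of the product. That one is a sum of contributions
  \<open>\<phi> x ^ p ^ i\<close>, the trace of the residue of x.\<close>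

lemma theta_product_root:
  assumes x: "x \<in> R" and xk: "x ^ (p ^ k) = x" and J: "of_nat p * (\<kappa> + \<epsilon>) \<le> \<epsilon> * of_nat J"
  shows "\<exists>\<eta>. \<eta> ^ p = 1 \<and> V (\<epsilon> * of_nat J / of_nat p) ((\<Prod>i<k. trunc_eval J \<Theta> (x ^ p ^ i)) - \<eta>) \<and>
           V \<kappa> (\<eta> - 1) \<and> lead \<eta> = (\<Sum>i<k. \<phi> x ^ p ^ i)"
proof -
  let ?X = "\<Prod>i<k. trunc_eval J \<Theta> (x ^ p ^ i)" and ?s = "\<epsilon> * of_nat J / of_nat p"
  have p0: "(of_nat p :: rat) > 0" using p_gt_1 by simp
  have s: "of_nat p * ?s = \<epsilon> * of_nat J" "?s \<ge> \<kappa> + \<epsilon>"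
    using p0 J by (simp_all add: field_simps)
  have "J \<ge> 1"
  proof (rule ccontr)
    assume "\<not> J \<ge> 1"
    hence "J = 0" by simp
    hence "of_nat p * (\<kappa> + \<epsilon>) \<le> 0" using J by simp
    moreover have "of_nat p * (\<kappa> + \<epsilon>) > 0" using p0 kappa_pos eps_pos by (intro mult_pos_pos) auto
    ultimately show False by simp
  qed
  obtain \<eta> where \<eta>: "\<eta> ^ p = 1" "V ?s (?X - \<eta>)"
    using V_near_root_of_unity[of p ?s ?X] theta_product_near_root[OF x xk, of J] s(1) p_gt_1 by auto
  have *: "V \<kappa> (?X - 1)" "lead ?X = (\<Sum>i<k. \<phi> x ^ p ^ i)"
    using lead_prod[of "{..<k}" "\<lambda>i. trunc_eval J \<Theta> (x ^ p ^ i)"] lead_theta[OF power_in[OF x] \<open>J \<ge> 1\<close>]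
    by (simp_all add: hom_power x)
  have "?s > \<kappa>" using s(2) eps_pos by linarith
  from lead_cong[OF *(1) \<eta>(2) this] \<eta> *(2) show ?thesis by auto
qed

lemma large_J_exists: "\<exists>J. c \<le> \<epsilon> * of_nat J"
proof -
  obtain J where "c / \<epsilon> \<le> of_nat J" using real_arch_simple by blast
  thus ?thesis using eps_pos by (intro exI[of _ J]) (simp add: field_simps)
qed

text \<open>\<xi> is the root of unity obtained at x = 1, k = 1, of leading coefficient 1. For other
  data the nearby root \<eta> has leading coefficient t, the same as \<xi>^t, and leading
  coefficients separate p-th roots of unity.\<close>

theorem splitting:
  "\<exists>\<xi>. \<xi> ^ p = 1 \<and> \<xi> \<noteq> 1 \<and> (\<forall>J k x t. of_nat p * (\<kappa> + \<epsilon>) \<le> \<epsilon> * of_nat J \<longrightarrow> x \<in> R \<longrightarrow>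
     x ^ (p ^ k) = x \<longrightarrow> of_nat t = (\<Sum>i<k. \<phi> x ^ p ^ i) \<longrightarrow>
     V (\<epsilon> * of_nat J / of_nat p) ((\<Prod>i<k. trunc_eval J \<Theta> (x ^ p ^ i)) - \<xi> ^ t))"
proof -
  \<comment> \<open>Any admissible truncation will do: \<xi> is pinned down by its leading
    coefficient, so it serves for all other J.\<close>
  obtain J0 where J0: "of_nat p * (\<kappa> + \<epsilon>) \<le> \<epsilon> * of_nat J0" using large_J_exists by blast
  obtain \<xi> where \<xi>: "\<xi> ^ p = 1" "V \<kappa> (\<xi> - 1)" "lead \<xi> = 1"
    using theta_product_root[OF one_in, of 1 J0] J0 by auto
  show ?thesis
  proof (intro exI[of _ \<xi>] conjI allI impI)
    show "\<xi> \<noteq> 1" using \<xi>(3) by auto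
    fix J k x and t :: nat
    assume J: "of_nat p * (\<kappa> + \<epsilon>) \<le> \<epsilon> * of_nat J" and x: "x \<in> R" "x ^ (p ^ k) = x"
      and t: "of_nat t = (\<Sum>i<k. \<phi> x ^ p ^ i)"
    obtain \<eta> where \<eta>: "\<eta> ^ p = 1" "V (\<epsilon> * of_nat J / of_nat p) ((\<Prod>i<k. trunc_eval J \<Theta> (x ^ p ^ i)) - \<eta>)"
      "V \<kappa> (\<eta> - 1)" "lead \<eta> = of_nat t"
      using theta_product_root[OF x J] t by auto
    \<comment> \<open>The exponent (p - 1) t plays the part of -t.\<close>
    define y where "y = \<eta> * \<xi> ^ ((p - 1) * t)"
    have pw: "V \<kappa> (\<xi> ^ ((p - 1) * t) - 1)" "lead (\<xi> ^ ((p - 1) * t)) = of_nat ((p - 1) * t)"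
      using lead_power[OF \<xi>(2)] \<xi>(3) by auto
    have tp: "t + (p - 1) * t = p * t" using p_gt_1 by (cases p) auto
    have "lead y = of_nat (t + (p - 1) * t)"
      unfolding y_def lead_mult(2)[OF \<eta>(3) pw(1)] pw(2) \<eta>(4) by simp
    hence ly: "lead y = 0" unfolding tp by (simp add: of_nat_p)
    have "(\<xi> ^ ((p - 1) * t)) ^ p = (\<xi> ^ p) ^ ((p - 1) * t)"
      by (simp only: power_mult[symmetric] mult.commute)
    hence yp: "y ^ p = 1" by (simp only: y_def power_mult_distrib \<eta>(1) \<xi>(1) power_one mult_1_left)
    have "y = 1"
      by (rule root_of_unity_lead_0[OF yp lead_mult(1)[OF \<eta>(3) pw(1), folded y_def] ly])
    have "\<xi> ^ (p * t) = 1" unfolding power_mult \<xi>(1) by simp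
    hence "\<eta> = \<eta> * \<xi> ^ (p * t)" by (simp only: mult_1_right)
    also have "\<xi> ^ (p * t) = \<xi> ^ t * \<xi> ^ ((p - 1) * t)" by (simp only: tp[symmetric] power_add)
    also have "\<eta> * (\<xi> ^ t * \<xi> ^ ((p - 1) * t)) = \<xi> ^ t" using \<open>y = 1\<close> by (simp add: y_def)
    finally show "V (\<epsilon> * of_nat J / of_nat p) ((\<Prod>i<k. trunc_eval J \<Theta> (x ^ p ^ i)) - \<xi> ^ t)"
      using \<eta>(2) by simp
  qed (use \<xi> in auto)
qed

end

section \<open>Traces of powers and the characteristic polynomial\<close>

definition mat_trace :: "'a::comm_monoid_add mat \<Rightarrow> 'a" where
  "mat_trace A = (\<Sum>i<dim_row A. A $$ (i, i))"

lemma mat_trace_mult_commute: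
  fixes A B :: "'a::comm_semiring_0 mat"
  assumes "A \<in> carrier_mat n m" "B \<in> carrier_mat m n"
  shows "mat_trace (A * B) = mat_trace (B * A)"
proof -
  have "mat_trace (A * B) = (\<Sum>i<n. \<Sum>j<m. A $$ (i, j) * B $$ (j, i))"
    using assms by (auto simp: mat_trace_def scalar_prod_def atLeast0LessThan intro!: sum.cong)
  also have "\<dots> = (\<Sum>j<m. \<Sum>i<n. B $$ (j, i) * A $$ (i, j))"
    by (subst sum.swap) (simp add: mult.commute)
  also have "\<dots> = mat_trace (B * A)"
    using assms by (auto simp: mat_trace_def scalar_prod_def atLeast0LessThan intro!: sum.cong)
  finally show ?thesis .
qed

lemma upper_triangular_pow:
  fixes A :: "'a::comm_semiring_1 mat"
  assumes A: "A \<in> carrier_mat n n" and ut: "upper_triangular A"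
  shows "upper_triangular (A ^\<^sub>m k) \<and> (\<forall>i<n. (A ^\<^sub>m k) $$ (i, i) = A $$ (i, i) ^ k)"
proof (induction k)
  case 0
  thus ?case using A by (auto simp: upper_triangular_def)
next
  case (Suc k)
  have Ak: "A ^\<^sub>m k \<in> carrier_mat n n" using A by simp
  have entry: "(A ^\<^sub>m k * A) $$ (i, j) = (\<Sum>l<n. (A ^\<^sub>m k) $$ (i, l) * A $$ (l, j))"
    if "i < n" "j < n" for i j
    using that A Ak by (auto simp: scalar_prod_def atLeast0LessThan)
  have zero: "(A ^\<^sub>m k) $$ (i, l) * A $$ (l, j) = 0" if "i < n" "l < n" "l < i \<or> j < l" "j < n" for i l j
    using that Suc ut A Ak by (auto simp: upper_triangular_def)
  have "upper_triangular (A ^\<^sub>m k * A)"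
  proof
    fix i j assume ij: "j < i" "i < dim_row (A ^\<^sub>m k * A)"
    hence "i < n" using A by simp
    have "(A ^\<^sub>m k) $$ (i, l) * A $$ (l, j) = 0" if "l < n" for l
      using zero[of i l j] that ij \<open>i < n\<close> by linarith
    thus "(A ^\<^sub>m k * A) $$ (i, j) = 0"
      using ij \<open>i < n\<close> by (simp add: entry)
  qed
  moreover have "(A ^\<^sub>m k * A) $$ (i, i) = A $$ (i, i) ^ Suc k" if i: "i < n" for i
  proof -
    have "(A ^\<^sub>m k * A) $$ (i, i) = (\<Sum>l\<in>{i}. (A ^\<^sub>m k) $$ (i, l) * A $$ (l, i))"
      unfolding entry[OF i i] using i zero[of i _ i]
      by (intro sum.mono_neutral_right) (auto simp: neq_iff)
    thus ?thesis using Suc i by (simp add: mult.commute)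
  qed
  ultimately show ?case by simp
qed

lemma trace_powers_eigenvalues:
  fixes A :: "complex mat"
  assumes A: "A \<in> carrier_mat n n"
  shows "\<exists>as. length as = n \<and> char_poly A = (\<Prod>a\<leftarrow>as. [:-a, 1:]) \<and>
           (\<forall>k. mat_trace (A ^\<^sub>m k) = (\<Sum>a\<leftarrow>as. a ^ k))"
proof -
  obtain es where "char_poly A = (\<Prod>a\<leftarrow>es. [:-a, 1:])"
    using char_poly_factorized[OF A] by blast
  then obtain B where B: "B \<in> carrier_mat n n" "upper_triangular B" "similar_mat A B"
    using schur_decomposition_exists[OF A] by blast
  obtain S Q where wit: "similar_mat_wit A B S Q" using B(3) by (auto simp: similar_mat_def)
  hence SQ: "S \<in> carrier_mat n n" "Q \<in> carrier_mat n n" "Q * S = 1\<^sub>m n"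
    using A by (auto simp: similar_mat_wit_def Let_def)
  have "mat_trace (A ^\<^sub>m k) = (\<Sum>a\<leftarrow>diag_mat B. a ^ k)" for k
  proof -
    have Bk: "B ^\<^sub>m k \<in> carrier_mat n n" using B by simp
    have "mat_trace (A ^\<^sub>m k) = mat_trace (S * B ^\<^sub>m k * Q)"
      by (simp add: similar_mat_wit_pow_id[OF wit])
    also have "\<dots> = mat_trace (Q * (S * B ^\<^sub>m k))"
      using SQ Bk by (intro mat_trace_mult_commute[of _ n n]) auto
    also have "Q * (S * B ^\<^sub>m k) = B ^\<^sub>m k"
      using assoc_mult_mat[OF SQ(2,1) Bk] left_mult_one_mat[OF Bk] SQ(3) by simp
    also have "mat_trace (B ^\<^sub>m k) = (\<Sum>a\<leftarrow>diag_mat B. a ^ k)"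
    proof -
      have "(\<Sum>a\<leftarrow>diag_mat B. a ^ k) = (\<Sum>i\<leftarrow>[0..<n]. B $$ (i, i) ^ k)"
        using B(1) by (simp add: diag_mat_def o_def)
      also have "\<dots> = (\<Sum>i<n. B $$ (i, i) ^ k)"
        by (simp add: interv_sum_list_conv_sum_set_nat atLeast0LessThan)
      also have "\<dots> = mat_trace (B ^\<^sub>m k)"
        unfolding mat_trace_def pow_mat_dim_square[OF B(1)]
        using upper_triangular_pow[OF B(1,2), of k] by (intro sum.cong) auto
      finally show ?thesis ..
    qed
    finally show ?thesis .
  qed
  moreover have "char_poly A = (\<Prod>a\<leftarrow>diag_mat B. [:-a, 1:])"
    using char_poly_similar[OF B(3)] char_poly_upper_triangular[OF B(1,2)] by simp
  moreover have "length (diag_mat B) = n" using B(1) by (simp add: diag_mat_def)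
  ultimately show ?thesis by blast
qed

text \<open>The reversed characteristic polynomial det(1 - X A) of a matrix with eigenvalues
  \<open>as\<close>, Dwork's Fredholm determinant. It is kept as a power series because it
  multiplies generating functions.\<close>

definition rev_char :: "'a::field_char_0 list \<Rightarrow> 'a fps" where
  "rev_char as = (\<Prod>a\<leftarrow>as. 1 - fps_const a * fps_X)"

definition power_sums :: "'a::field_char_0 list \<Rightarrow> 'a fps" where
  "power_sums as = Abs_fps (\<lambda>k. \<Sum>a\<leftarrow>as. a ^ k)"

lemma rev_char_0 [simp]: "fps_nth (rev_char as) 0 = 1"
  by (induction as) (simp_all add: rev_char_def)

text \<open>\<open>power_sums\<close> is the sum of the geometric series 1/(1 - a X). The point of
  the identity is that the right side has coefficients as small as those of \<open>rev_char\<close>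
  itself.\<close>

lemma newton_identity:
  "rev_char as * power_sums as = of_nat (length as) * rev_char as - fps_X * fps_deriv (rev_char as)"
proof (induction as)
  case Nil
  have "power_sums [] = (0 :: 'a fps)" by (rule fps_ext) (simp add: power_sums_def)
  thus ?case by (simp add: rev_char_def)
next
  case (Cons a as)
  let ?g = "Abs_fps (\<lambda>k. a ^ k)" and ?l = "1 - fps_const a * fps_X"
  have g: "?l * ?g = 1"
  proof (rule fps_ext)
    fix k
    show "fps_nth (?l * ?g) k = fps_nth 1 k"
      by (cases k) (simp_all add: left_diff_distrib mult.assoc)
  qed
  have 1: "rev_char (a # as) = ?l * rev_char as" by (simp add: rev_char_def)
  have 2: "power_sums (a # as) = ?g + power_sums as"
    by (rule fps_ext) (simp add: power_sums_def)
  have d: "fps_deriv (rev_char (a # as)) = ?l * fps_deriv (rev_char as) - fps_const a * rev_char as"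
    unfolding 1 by (simp add: fps_const_neg[symmetric] del: fps_const_neg)
  have "rev_char (a # as) * power_sums (a # as) =
      rev_char as * (?l * ?g) + ?l * (rev_char as * power_sums as)"
    unfolding 1 2 by (simp only: algebra_simps)
  also have "\<dots> = rev_char as + ?l * (of_nat (length as) * rev_char as - fps_X * fps_deriv (rev_char as))"
    unfolding g Cons.IH by simp
  also have "\<dots> = (1 + of_nat (length as)) * (?l * rev_char as)
      - fps_X * (?l * fps_deriv (rev_char as) - fps_const a * rev_char as)"
    by (simp only: algebra_simps mult_1_left mult_1_right)
  finally show ?case unfolding d[symmetric] 1[symmetric] by simp
qed

lemma rev_char_nth:
  "fps_nth (rev_char as) i =
     (if i \<le> length as then coeff (\<Prod>a\<leftarrow>as. [:-a, 1:]) (length as - i) else 0)"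
proof (induction as arbitrary: i)
  case Nil
  show ?case by (simp add: rev_char_def)
next
  case (Cons a as)
  let ?q = "\<Prod>a\<leftarrow>as. [:-a, 1:]"
  have deg: "coeff ?q j = 0" if "j > length as" for j
  proof -
    have "degree ?q \<le> length as"
    proof (induction as)
      case (Cons b bs)
      have "degree ([:-b, 1:] * (\<Prod>a\<leftarrow>bs. [:-a, 1:])) \<le> 1 + degree (\<Prod>a\<leftarrow>bs. [:-a, 1:])"
        by (rule order.trans[OF degree_mult_le]) simp
      thus ?case using Cons by (simp only: list.map prod_list.Cons list.size)
    qed simp
    thus ?thesis using that by (intro coeff_eq_0) simp
  qed
  have "rev_char (a # as) = (1 - fps_const a * fps_X) * rev_char as" by (simp add: rev_char_def)
  hence "fps_nth (rev_char (a # as)) i =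
     fps_nth (rev_char as) i - (if i = 0 then 0 else a * fps_nth (rev_char as) (i - 1))"
    by (simp add: left_diff_distrib mult.assoc)
  moreover have "coeff ([:-a, 1:] * ?q) j = (if j = 0 then 0 else coeff ?q (j - 1)) - a * coeff ?q j" for j
    by (cases j) simp_all
  ultimately show ?case
    using deg[of "Suc (length as)"] Cons.IH[of 0]
    by (cases i) (auto simp: Cons.IH Suc_diff_le not_le less_Suc_eq_le le_Suc_eq diff_Suc split: nat.splits)
qed

context p_place
begin

lemma V_coeff_prod:
  assumes "\<And>i l. i \<in> I \<Longrightarrow> V (w i - B * of_nat l) (coeff (f i) l)"
  shows "V ((\<Sum>i\<in>I. w i) - B * of_nat l) (coeff (\<Prod>i\<in>I. f i) l)"
  using assms
proof (induction I arbitrary: l rule: infinite_finite_induct)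
  case (insert i I)
  have "V ((\<Sum>i\<in>insert i I. w i) - B * of_nat l) (coeff (f i) m * coeff (\<Prod>i\<in>I. f i) (l - m))"
    if "m \<le> l" for m
  proof -
    have "V ((w i - B * of_nat m) + ((\<Sum>i\<in>I. w i) - B * of_nat (l - m)))
            (coeff (f i) m * coeff (\<Prod>i\<in>I. f i) (l - m))"
      using insert by (intro V_mult) auto
    also have "(w i - B * of_nat m) + ((\<Sum>i\<in>I. w i) - B * of_nat (l - m)) =
        (\<Sum>i\<in>insert i I. w i) - B * of_nat l"
      using insert.hyps that by (simp add: of_nat_diff algebra_simps)
    finally show ?thesis .
  qed
  thus ?case using insert.hyps by (auto simp: coeff_mult intro!: V_sum)
qed (auto simp: V_0 coeff_1)

text \<open>In the Leibniz expansion each row i contributes an entry of weight w i, or an X from the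
  diagonal that forfeits at most B. The coefficient of X^l therefore loses at most B l.\<close>

lemma V_coeff_char_poly:
  assumes A: "A \<in> carrier_mat n n"
    and w: "\<And>i. i < n \<Longrightarrow> w i \<le> B"
    and V: "\<And>i j. i < n \<Longrightarrow> j < n \<Longrightarrow> V (w i) (A $$ (i, j))"
  shows "V ((\<Sum>i<n. w i) - B * of_nat l) (coeff (char_poly A) l)"
proof -
  let ?M = "char_poly_matrix A"
  have M: "?M \<in> carrier_mat n n" using A by simp
  have entry: "V (w i - B * of_nat l) (coeff (?M $$ (i, j)) l)" if ij: "i < n" "j < n" for i j l
  proof -
    have "V (w i - B) 1" by (rule V_mono[of 0 1]) (use w[OF ij(1)] in \<open>auto simp: V_0\<close>)
    have "?M $$ (i, j) = [:- A $$ (i, j), if i = j then 1 else 0:]"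
      using ij A by (auto simp: char_poly_matrix_def)
    hence c: "coeff (?M $$ (i, j)) l =
        (if l = 0 then - A $$ (i, j) else if l = 1 \<and> i = j then 1 else 0)"
      by (simp only: coeff_pCons) (simp split: nat.splits)
    show ?thesis unfolding c using V[OF ij] \<open>V (w i - B) 1\<close> by auto
  qed
  have "coeff (char_poly A) l = (\<Sum>\<sigma>\<in>{\<sigma>. \<sigma> permutes {0..<n}}.
      coeff (signof \<sigma> * (\<Prod>i=0..<n. ?M $$ (i, \<sigma> i))) l)"
    unfolding char_poly_def det_def'[OF M] coeff_sum ..
  also have "V ((\<Sum>i<n. w i) - B * of_nat l) \<dots>"
  proof (intro V_sum)
    fix \<sigma> assume "\<sigma> \<in> {\<sigma>. \<sigma> permutes {0..<n}}"
    hence "\<sigma> i < n" if "i < n" for i using that permutes_in_image[of \<sigma> "{0..<n}" i] by simp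
    hence "V ((\<Sum>i=0..<n. w i) - B * of_nat l) (coeff (\<Prod>i=0..<n. ?M $$ (i, \<sigma> i)) l)"
      by (intro V_coeff_prod entry) auto
    moreover have "signof \<sigma> = (1 :: complex poly) \<or> signof \<sigma> = (-1 :: complex poly)"
      by (simp add: sign_def)
    ultimately show "V ((\<Sum>i<n. w i) - B * of_nat l) (coeff (signof \<sigma> * (\<Prod>i=0..<n. ?M $$ (i, \<sigma> i))) l)"
      by (auto simp: atLeast0LessThan)
  qed
  finally show ?thesis .
qed

end

section \<open>Conjugates in the cyclotomic field\<close>

lemma sum_powers_root_of_unity:
  fixes \<eta> :: "'a::field"
  assumes "\<eta> ^ p = 1" "\<eta> \<noteq> 1"
  shows "(\<Sum>j<p. \<eta> ^ j) = 0"
proof -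
  have "(\<eta> - 1) * (\<Sum>j<p. \<eta> ^ j) = \<eta> ^ p - 1" by (rule power_diff_1_eq[symmetric])
  thus ?thesis using assms by simp
qed

context p_place
begin

text \<open>Expanding (1 + \<mu>)^p = 1 gives \<mu>^(p-1) = -p u with u reducing to 1: total
  ramification of p, without any integral closure.\<close>

lemma one_minus_root_of_unity:
  assumes "\<eta> ^ p = 1" "\<eta> \<noteq> 1"
  defines "\<mu> \<equiv> \<eta> - 1"
  shows "\<mu> \<in> R" "\<phi> \<mu> = 0" "of_nat p * inverse \<mu> ^ (p - 1) \<in> R"
proof -
  have "\<eta> \<in> R" using assms(1) p_gt_1 by (intro root_in[where x = \<eta> and n = p]) auto
  thus l_in: "\<mu> \<in> R" by (simp add: \<mu>_def diff_in)
  have l0: "\<mu> \<noteq> 0" using assms(2) by (simp add: \<mu>_def)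
  define u where "u = (\<Sum>k\<in>{1..<p}. of_nat ((p choose k) div p) * \<mu> ^ (k - 1))"
  have "1 = (\<Sum>k\<le>p. of_nat (p choose k) * \<mu> ^ k)"
    using binomial_ring[of \<mu> 1 p] assms(1) by (simp add: \<mu>_def)
  also have "{..p} = insert 0 (insert p {1..<p})" using p_gt_1 by auto
  also have "(\<Sum>k\<in>\<dots>. of_nat (p choose k) * \<mu> ^ k) =
      1 + \<mu> ^ p + (\<Sum>k\<in>{1..<p}. of_nat (p choose k) * \<mu> ^ k)"
    using p_gt_1 by simp
  also have "(\<Sum>k\<in>{1..<p}. of_nat (p choose k) * \<mu> ^ k) = of_nat p * \<mu> * u"
    unfolding u_def sum_distrib_left
  proof (intro sum.cong refl)
    fix k assume k: "k \<in> {1..<p}"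
    hence "p dvd (p choose k)" using dvd_choose_prime[OF _ _ _ prime_p, of k] by auto
    hence "(of_nat (p choose k) :: complex) = of_nat p * of_nat ((p choose k) div p)"
      unfolding of_nat_mult[symmetric] by simp
    moreover have "\<mu> ^ k = \<mu> * \<mu> ^ (k - 1)" using k by (cases k) auto
    ultimately show "of_nat (p choose k) * \<mu> ^ k =
        of_nat p * \<mu> * (of_nat ((p choose k) div p) * \<mu> ^ (k - 1))"
      by (simp only: mult_ac)
  qed
  also have "\<mu> ^ p = \<mu> * \<mu> ^ (p - 1)" using p_gt_1 by (cases p) auto
  finally have "\<mu> * (\<mu> ^ (p - 1) + of_nat p * u) = 0" by (simp add: algebra_simps)
  hence eq: "\<mu> ^ (p - 1) = - (of_nat p * u)" using l0 by (simp add: eq_neg_iff_add_eq_0)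
  have u_in: "u \<in> R" unfolding u_def using l_in by (intro sum_in mult_in power_in of_nat_in)
  have "\<phi> \<mu> ^ (p - 1) = \<phi> (- (of_nat p * u))" using l_in by (simp add: hom_power flip: eq)
  also have "\<dots> = 0" using u_in by (simp add: hom_uminus mult_in hom_mult of_nat_p)
  finally show l_hom: "\<phi> \<mu> = 0" by simp
  have "{1..<p} = insert 1 {2..<p}" using p_gt_1 by auto
  hence "u = 1 + (\<Sum>k\<in>{2..<p}. of_nat ((p choose k) div p) * \<mu> ^ (k - 1))"
    using p_gt_1 by (simp add: u_def)
  moreover have "\<phi> (\<Sum>k\<in>{2..<p}. of_nat ((p choose k) div p) * \<mu> ^ (k - 1)) = 0"
    using l_in l_hom
    by (subst hom_sum) (auto simp: hom_mult hom_power mult_in power_in power_0_left intro!: sum.neutral)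
  moreover have "(\<Sum>k\<in>{2..<p}. of_nat ((p choose k) div p) * \<mu> ^ (k - 1)) \<in> R"
    using l_in by (intro sum_in mult_in power_in of_nat_in)
  ultimately have u1: "\<phi> u = 1" by (simp add: hom_add)
  hence "u \<noteq> 0" by auto
  have "of_nat p * inverse \<mu> ^ (p - 1) = of_nat p * inverse (\<mu> ^ (p - 1))" by (simp only: power_inverse)
  also have "\<dots> = - inverse u" unfolding eq using \<open>u \<noteq> 0\<close> p_gt_1 by (simp add: field_simps)
  finally show "of_nat p * inverse \<mu> ^ (p - 1) \<in> R"
    using inverse_in[OF u_in] u1 by (simp add: uminus_in)
qed

text \<open>The Eisenstein argument for the \<open>p\<close>-th cyclotomic polynomial.\<close>

lemma int_poly_no_small_relation:
  fixes \<eta> :: complex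
  assumes \<eta>: "\<eta> ^ p = 1" "\<eta> \<noteq> 1" and deg: "degree G < p - 1"
    and root: "(\<Sum>i\<le>degree G. of_int (coeff G i) * (\<eta> - 1) ^ i) = 0"
  shows "G = (0 :: int poly)"
proof (rule ccontr)
  assume "G \<noteq> 0"
  define H where "H = primitive_part G"
  have G: "G = smult (content G) H" by (simp add: H_def)
  have c: "content G \<noteq> 0" using \<open>G \<noteq> 0\<close> by simp
  have dH: "degree H = degree G" by (simp add: H_def)
  define l where "l = \<eta> - 1"
  note l = one_minus_root_of_unity[OF \<eta>, folded l_def]
  have l0: "l \<noteq> 0" using \<eta>(2) by (simp add: l_def)
  have cG: "coeff G i = content G * coeff H i" for i
    using arg_cong[OF G, of "\<lambda>q. coeff q i"] by simp
  have "of_int (content G) * (\<Sum>i\<le>degree H. of_int (coeff H i) * l ^ i) = 0"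
    using root unfolding sum_distrib_left l_def[symmetric] dH cG by (simp add: mult.assoc)
  hence rH: "(\<Sum>i\<le>degree H. of_int (coeff H i) * l ^ i) = 0" using c by simp
  have "\<not> (\<forall>i. int p dvd coeff H i)"
  proof
    assume "\<forall>i. int p dvd coeff H i"
    hence "[:int p:] dvd H" by (simp add: const_poly_dvd_iff)
    hence "int p dvd content H" by (simp add: const_poly_dvd_iff_dvd_content)
    moreover have "content H = 1" using \<open>G \<noteq> 0\<close> by (simp add: H_def)
    ultimately show False using p_gt_1 by simp
  qed
  then obtain i0 where i0: "\<not> int p dvd coeff H i0" "\<And>i. i < i0 \<Longrightarrow> int p dvd coeff H i"
    using exists_least_iff[of "\<lambda>i. \<not> int p dvd coeff H i"] by auto
  have "i0 \<le> degree H" using i0(1) by (intro le_degree) auto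
  hence i0p: "i0 < p - 1" using deg dH by simp
  \<comment> \<open>Below i0 the factor p absorbs l^(p-1), and i0 - i < p - 1 leaves a positive
    power of l; above i0 a positive power of l remains anyway. Only the term i0 survives
    reduction.\<close>
  have term_in: "of_int (coeff H i) * l ^ i * inverse l ^ i0 \<in> R \<and>
     \<phi> (of_int (coeff H i) * l ^ i * inverse l ^ i0) = 0" if "i \<noteq> i0" for i
  proof (cases "i < i0")
    case True
    then obtain m where m: "coeff H i = int p * m" using i0(2) by blast
    have "(p - 1) = (i0 - i) + (p - 1 - (i0 - i))" using i0p by simp
    hence "inverse l ^ (p - 1) = inverse l ^ (i0 - i) * inverse l ^ (p - 1 - (i0 - i))"
      by (metis power_add)
    hence 1: "inverse l ^ (i0 - i) = inverse l ^ (p - 1) * l ^ (p - 1 - (i0 - i))"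
      using l0 by (simp add: power_inverse field_simps)
    have "inverse l ^ i0 = inverse l ^ i * inverse l ^ (i0 - i)"
      using True by (simp flip: power_add)
    hence "l ^ i * inverse l ^ i0 = inverse l ^ (i0 - i)"
      using l0 by (simp add: power_inverse)
    hence eq: "of_int (coeff H i) * l ^ i * inverse l ^ i0 =
        of_int m * (of_nat p * inverse l ^ (p - 1)) * l ^ (p - 1 - (i0 - i))"
      unfolding mult.assoc by (simp only: 1 m of_int_mult of_int_of_nat_eq mult_ac)
    have "p - 1 - (i0 - i) > 0" using i0p by simp
    thus ?thesis unfolding eq using l
      by (auto simp: hom_mult hom_power mult_in power_in power_0_left)
  next
    case False
    hence "i > i0" using that by simp
    hence "l ^ i * inverse l ^ i0 = l ^ (i - i0)"
      using l0 by (simp add: power_diff power_inverse divide_inverse)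
    hence eq: "of_int (coeff H i) * l ^ i * inverse l ^ i0 = of_int (coeff H i) * l ^ (i - i0)"
      by (simp add: mult.assoc)
    show ?thesis unfolding eq using l \<open>i > i0\<close>
      by (auto simp: hom_mult hom_power mult_in power_in power_0_left)
  qed
  let ?S = "\<Sum>i\<in>{..degree H} - {i0}. of_int (coeff H i) * l ^ i * inverse l ^ i0"
  have "0 = (\<Sum>i\<le>degree H. of_int (coeff H i) * l ^ i * inverse l ^ i0)"
    using rH by (simp flip: sum_distrib_right)
  also have "\<dots> = of_int (coeff H i0) * l ^ i0 * inverse l ^ i0 + ?S"
    using \<open>i0 \<le> degree H\<close> by (intro sum.remove) auto
  also have "of_int (coeff H i0) * l ^ i0 * inverse l ^ i0 = of_int (coeff H i0)"
    using l0 by (simp add: power_inverse)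
  finally have "\<phi> (of_int (coeff H i0) + ?S) = 0" using hom_zero by metis
  moreover have "?S \<in> R" using term_in by (intro sum_in) auto
  moreover have "\<phi> ?S = 0" using term_in by (subst hom_sum) auto
  ultimately have "(of_int (coeff H i0) :: 'a) = 0" by (simp add: hom_add)
  moreover have "(of_int (coeff H i0) :: 'a) \<noteq> 0"
  proof -
    have "\<not> int p dvd \<bar>coeff H i0\<bar>" using i0(1) by simp
    hence "\<not> int p dvd int (nat \<bar>coeff H i0\<bar>)" by simp
    hence "\<not> p dvd nat \<bar>coeff H i0\<bar>" unfolding int_dvd_int_iff .
    hence "(of_nat (nat \<bar>coeff H i0\<bar>) :: 'a) \<noteq> 0" by (rule hom_coprime)
    thus ?thesis by (cases "coeff H i0 \<ge> 0") auto
  qed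
  ultimately show False by simp
qed

text \<open>The powers of \<eta> below p satisfy, up to a factor, only the relation that their sum
  is zero. A relation is brought to degree below p - 1, made integral and rewritten in \<eta> - 1,
  where the Eisenstein argument forces it to vanish.\<close>

lemma rational_relation_constant:
  fixes d :: "nat \<Rightarrow> rat" and \<eta> :: complex
  assumes \<eta>: "\<eta> ^ p = 1" "\<eta> \<noteq> 1" and rel: "(\<Sum>j<p. of_rat (d j) * \<eta> ^ j) = 0"
    and "i < p" "j < p"
  shows "d i = d j"
proof -
  define m where "m = p - 1"
  have p: "p = Suc m" using p_gt_1 by (simp add: m_def)
  \<comment> \<open>Subtracting a multiple of the vanishing sum of all powers removes the term of
    degree p - 1.\<close>
  define f where "f = (\<lambda>j. d j - d m)"
  define e where "e = (\<Prod>j<p. snd (quotient_of (f j)))"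
  have den: "snd (quotient_of x) > 0" for x
    using quotient_of_denom_pos'[of x] by simp
  have e0: "e > 0" unfolding e_def by (intro prod_pos) (auto simp: den)
  have "\<exists>z. of_int e * f j = of_int z" if "j < p" for j
  proof -
    define s t r where "s = snd (quotient_of (f j))" and "t = fst (quotient_of (f j))"
      and "r = (\<Prod>i\<in>{..<p} - {j}. snd (quotient_of (f i)))"
    have e: "e = s * r"
      unfolding e_def s_def r_def using that by (intro prod.remove) auto
    have "f j = of_int t / of_int s"
      unfolding s_def t_def by (rule quotient_of_div) simp
    moreover have "(of_int s :: rat) \<noteq> 0" using den[of "f j"] by (simp add: s_def)
    ultimately have "of_int (s * r) * f j = of_int (t * r)" by simp
    thus ?thesis unfolding e by blast
  qed
  hence "\<forall>j\<in>{..<p}. \<exists>z. of_int e * f j = of_int z" by simp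
  then obtain g where g': "\<forall>j\<in>{..<p}. of_int e * f j = of_int (g j)" using bchoice by meson
  hence g: "of_int e * f j = of_int (g j)" if "j < p" for j using that by simp
  define G0 where "G0 = (\<Sum>j<m. monom (g j) j)"
  have cG0: "coeff G0 j = (if j < m then g j else 0)" for j by (simp add: G0_def coeff_sum)
  have "m > 0" using p_gt_1 by (simp add: m_def)
  have "degree G0 \<le> m - 1" by (intro degree_le) (auto simp: cG0)
  hence dG0: "degree G0 < m" using \<open>m > 0\<close> by simp
  have eval0: "poly (map_poly of_int G0) \<eta> = (0 :: complex)"
  proof -
    have "poly (map_poly of_int G0) \<eta> = (\<Sum>j<m. of_int (g j) * \<eta> ^ j)"
      by (simp add: G0_def of_int_poly_hom.hom_sum poly_sum poly_monom)
    also have "\<dots> = (\<Sum>j<p. of_int (g j) * \<eta> ^ j)"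
    proof -
      have "of_int (g m) = (0 :: rat)" using g[of m] by (simp add: p f_def)
      thus ?thesis by (simp add: p)
    qed
    also have "\<dots> = (\<Sum>j<p. of_int e * (of_rat (d j) * \<eta> ^ j - of_rat (d m) * \<eta> ^ j))"
    proof (intro sum.cong refl)
      fix j assume "j \<in> {..<p}"
      hence "(of_int (g j) :: complex) = of_rat (of_int e * f j)" using g by simp
      hence gj: "of_int (g j) = of_int e * (of_rat (d j) - of_rat (d m) :: complex)"
        by (simp add: f_def of_rat_mult of_rat_diff)
      show "of_int (g j) * \<eta> ^ j = of_int e * (of_rat (d j) * \<eta> ^ j - of_rat (d m) * \<eta> ^ j)"
        unfolding gj by (simp only: algebra_simps)
    qed
    also have "\<dots> = of_int e * ((\<Sum>j<p. of_rat (d j) * \<eta> ^ j) - of_rat (d m) * (\<Sum>j<p. \<eta> ^ j))"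
      by (simp add: sum_distrib_left[symmetric] sum_subtractf)
    also have "\<dots> = 0" using rel sum_powers_root_of_unity[OF \<eta>] by simp
    finally show ?thesis .
  qed
  define G where "G = pcompose G0 [:1, 1:]"
  have "degree G \<le> degree G0 * 1" unfolding G_def by (rule order.trans[OF degree_pcompose_le]) simp
  hence dG: "degree G < p - 1" using dG0 by (simp add: p)
  have "map_poly of_int G = pcompose (map_poly of_int G0) ([:1, 1:] :: complex poly)"
    unfolding G_def by (simp add: of_int_hom.map_poly_pcompose)
  hence "poly (map_poly of_int G) (\<eta> - 1) = 0" using eval0 by (simp add: poly_pcompose)
  hence "(\<Sum>i\<le>degree G. of_int (coeff G i) * (\<eta> - 1) ^ i) = 0"
    by (simp add: poly_altdef)
  hence "G = 0" using int_poly_no_small_relation[OF \<eta> dG] by simp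
  hence "G0 = 0" by (simp add: G_def pcompose_eq_0)
  have "f j = 0" if "j < p" for j
  proof -
    have "g j = 0 \<or> j = m" using cG0[of j] \<open>G0 = 0\<close> that by (auto simp: p less_Suc_eq)
    thus ?thesis using g[OF that] e0 by (auto simp: f_def)
  qed
  thus ?thesis using assms(4,5) by (simp add: f_def)
qed

end

text \<open>The absence of other relations is an assumption here, so that the Galois theory below
  does not mention the place; \<open>prime_cyclotomicI\<close> discharges it.\<close>

locale prime_cyclotomic =
  fixes p :: nat and \<zeta> :: complex
  assumes prime_p: "prime p" and root: "\<zeta> ^ p = 1" and nontrivial: "\<zeta> \<noteq> 1"
    and relation_constant: "\<And>(\<eta> :: complex) d i j. \<eta> ^ p = 1 \<Longrightarrow> \<eta> \<noteq> 1 \<Longrightarrow>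
      (\<Sum>j<p. of_rat (d j) * \<eta> ^ j) = 0 \<Longrightarrow> i < p \<Longrightarrow> j < p \<Longrightarrow> d i = d j"
begin

lemma p_pos: "p > 0"
  using prime_p by (rule prime_gt_0_nat)

lemma power_mod: "\<zeta> ^ (n mod p) = \<zeta> ^ n"
proof -
  have "\<zeta> ^ n = \<zeta> ^ (p * (n div p) + n mod p)" by simp
  also have "\<dots> = \<zeta> ^ (n mod p)" by (simp only: power_add power_mult root power_one mult_1_left)
  finally show ?thesis ..
qed

lemma power_cong: "[m = n] (mod p) \<Longrightarrow> \<zeta> ^ m = \<zeta> ^ n"
  using power_mod[of m] power_mod[of n] by (simp add: cong_def)

lemma unit_coprime: "\<not> p dvd n \<Longrightarrow> coprime n p"
  using prime_imp_coprime[OF prime_p] coprime_commute by blast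

lemma power_power_p: "(\<zeta> ^ n) ^ p = 1"
proof -
  have "(\<zeta> ^ n) ^ p = \<zeta> ^ (p * n)" by (simp only: power_mult[symmetric] mult.commute)
  also have "\<dots> = 1" by (simp only: power_mult root power_one)
  finally show ?thesis .
qed

lemma power_neq_1:
  assumes "\<not> p dvd n"
  shows "\<zeta> ^ n \<noteq> 1"
proof
  assume 1: "\<zeta> ^ n = 1"
  have "coprime n p" using assms by (rule unit_coprime)
  then obtain x where "[n * x = 1] (mod p)" using cong_solve_coprime_nat[of n p] by auto
  hence "\<zeta> ^ (n * x) = \<zeta> ^ 1" by (rule power_cong)
  thus False using 1 nontrivial by (simp add: power_mult)
qed

text \<open>
  The families \<open>s \<mapsto> \<sigma>\<^sub>s z\<close> of conjugates of an element \<open>z\<close> of the cyclotomic field, where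
  \<open>\<sigma>\<^sub>s \<zeta> = \<zeta>\<^sup>s\<close>.
\<close>

definition conjugates :: "(nat \<Rightarrow> complex) \<Rightarrow> bool" where
  "conjugates f \<longleftrightarrow> (\<exists>d. \<forall>s. f s = (\<Sum>j<p. of_rat (d j) * \<zeta> ^ (j * s)))"

lemma conjugatesI: "(\<And>s. f s = (\<Sum>j<p. of_rat (d j) * \<zeta> ^ (j * s))) \<Longrightarrow> conjugates f"
  unfolding conjugates_def by blast

lemma conjugates_monomial: "conjugates (\<lambda>s. of_rat c * \<zeta> ^ (a * s))"
proof (rule conjugatesI[where d = "\<lambda>j. if j = a mod p then c else 0"])
  fix s
  have "(\<Sum>j<p. of_rat (if j = a mod p then c else 0) * \<zeta> ^ (j * s)) =
      (\<Sum>j\<in>{a mod p}. of_rat c * \<zeta> ^ (j * s))"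
    using p_pos by (intro sum.mono_neutral_cong_right) auto
  also have "\<zeta> ^ ((a mod p) * s) = \<zeta> ^ (a * s)"
    by (rule power_cong) (simp add: cong_def mod_mult_left_eq)
  hence "(\<Sum>j\<in>{a mod p}. of_rat c * \<zeta> ^ (j * s)) = of_rat c * \<zeta> ^ (a * s)" by simp
  finally show "of_rat c * \<zeta> ^ (a * s) = (\<Sum>j<p. of_rat (if j = a mod p then c else 0) * \<zeta> ^ (j * s))" ..
qed

lemma conjugates_const: "c \<in> \<rat> \<Longrightarrow> conjugates (\<lambda>_. c)"
  using conjugates_monomial[of _ 0] by (auto elim!: Rats_cases)

lemma conjugates_add:
  assumes "conjugates f" "conjugates g"
  shows "conjugates (\<lambda>s. f s + g s)"
proof -
  obtain d e where "\<And>s. f s = (\<Sum>j<p. of_rat (d j) * \<zeta> ^ (j * s))"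
    "\<And>s. g s = (\<Sum>j<p. of_rat (e j) * \<zeta> ^ (j * s))"
    using assms by (auto simp: conjugates_def)
  thus ?thesis
    by (intro conjugatesI[where d = "\<lambda>j. d j + e j"]) (simp add: of_rat_add sum.distrib algebra_simps)
qed

lemma conjugates_sum: "(\<And>i. i \<in> I \<Longrightarrow> conjugates (f i)) \<Longrightarrow> conjugates (\<lambda>s. \<Sum>i\<in>I. f i s)"
  by (induction I rule: infinite_finite_induct) (auto intro: conjugates_add conjugates_const)

lemma conjugates_mult:
  assumes "conjugates f" "conjugates g"
  shows "conjugates (\<lambda>s. f s * g s)"
proof -
  obtain d e where de: "\<And>s. f s = (\<Sum>j<p. of_rat (d j) * \<zeta> ^ (j * s))"
    "\<And>s. g s = (\<Sum>j<p. of_rat (e j) * \<zeta> ^ (j * s))"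
    using assms by (auto simp: conjugates_def)
  have "f s * g s = (\<Sum>i<p. \<Sum>j<p. of_rat (d i * e j) * \<zeta> ^ ((i + j) * s))" for s
    unfolding de sum_product by (intro sum.cong) (auto simp: of_rat_mult algebra_simps power_add)
  moreover have "conjugates (\<lambda>s. \<Sum>i<p. \<Sum>j<p. of_rat (d i * e j) * \<zeta> ^ ((i + j) * s))"
    by (intro conjugates_sum conjugates_monomial)
  ultimately show ?thesis by simp
qed

lemma conjugates_minus: "conjugates f \<Longrightarrow> conjugates (\<lambda>s. - f s)"
  using conjugates_mult[OF conjugates_const[of "-1"], of f] by simp

lemma conjugates_diff: "conjugates f \<Longrightarrow> conjugates g \<Longrightarrow> conjugates (\<lambda>s. f s - g s)"
  using conjugates_add[OF _ conjugates_minus, of f g] by simp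

lemma conjugates_scale: "conjugates f \<Longrightarrow> conjugates (\<lambda>s. f (a * s))"
proof -
  assume "conjugates f"
  then obtain d where "\<And>s. f s = (\<Sum>j<p. of_rat (d j) * \<zeta> ^ (j * s))" by (auto simp: conjugates_def)
  moreover have "conjugates (\<lambda>s. \<Sum>j<p. of_rat (d j) * \<zeta> ^ ((j * a) * s))"
    by (intro conjugates_sum conjugates_monomial)
  ultimately show ?thesis by (simp add: mult.assoc)
qed

lemma conjugates_cong: "conjugates f \<Longrightarrow> [m = n] (mod p) \<Longrightarrow> f m = f n"
  by (auto simp: conjugates_def intro!: sum.cong power_cong cong_scalar_left)

text \<open>A zero at one unit s is a rational relation among the powers of \<zeta>^s, so all d j
  coincide, and then the sum vanishes at every unit. This lets equalities pass from one conjugate to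
  all others.\<close>

lemma conjugates_eq_0:
  assumes f: "conjugates f" and s: "\<not> p dvd s" "f s = 0" and t: "\<not> p dvd t"
  shows "f t = 0"
proof -
  obtain d where d: "\<And>s. f s = (\<Sum>j<p. of_rat (d j) * \<zeta> ^ (j * s))"
    using f by (auto simp: conjugates_def)
  have pw: "\<zeta> ^ (j * n) = (\<zeta> ^ n) ^ j" for j n
    by (simp only: power_mult[symmetric] mult.commute)
  have z: "(\<Sum>j<p. of_rat (d j) * (\<zeta> ^ s) ^ j) = 0"
    using s(2) unfolding d pw .
  have const: "d j = d 0" if "j < p" for j
    by (rule relation_constant[OF power_power_p power_neq_1[OF s(1)] z that p_pos])
  have "f t = (\<Sum>j<p. of_rat (d 0) * (\<zeta> ^ t) ^ j)"
    unfolding d pw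
    by (intro sum.cong refl arg_cong2[of _ _ _ _ "(*)"] arg_cong[of _ _ of_rat] const) auto
  hence "f t = of_rat (d 0) * (\<Sum>j<p. (\<zeta> ^ t) ^ j)"
    by (simp add: sum_distrib_left)
  thus ?thesis using sum_powers_root_of_unity[OF power_power_p power_neq_1[OF t]] by simp
qed

lemma conjugates_eq:
  assumes "conjugates f" "conjugates g" "\<not> p dvd s" "f s = g s" "\<not> p dvd t"
  shows "f t = g t"
  using conjugates_eq_0[OF conjugates_diff[OF assms(1,2)], of s t] assms(3-) by simp

lemma unit_iff: "s \<in> {1..<p} \<Longrightarrow> \<not> p dvd s"
  by (auto dest: dvd_imp_le)

text \<open>An invariant element is 1/(p - 1) times its trace, and the traces of the powers of
  \<zeta> are rational.\<close>

lemma conjugates_invariant_rational: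
  assumes f: "conjugates f" and inv: "\<And>s. s \<in> {1..<p} \<Longrightarrow> f s = f 1"
  shows "f 1 \<in> \<rat>"
proof -
  obtain d where d: "\<And>s. f s = (\<Sum>j<p. of_rat (d j) * \<zeta> ^ (j * s))"
    using f by (auto simp: conjugates_def)
  have p1: "p > 1" using prime_p by (rule prime_gt_1_nat)
  have "(\<Sum>s\<in>{1..<p}. \<zeta> ^ (j * s)) \<in> \<rat>" if "j < p" for j
  proof -
    have "{..<p} = insert 0 {1..<p}" using p1 by auto
    hence eq: "(\<Sum>s<p. (\<zeta> ^ j) ^ s) = 1 + (\<Sum>s\<in>{1..<p}. \<zeta> ^ (j * s))"
      by (simp add: power_mult)
    show ?thesis
    proof (cases "j = 0")
      case False
      hence "\<zeta> ^ j \<noteq> 1" using that by (intro power_neq_1) (auto dest: dvd_imp_le)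
      hence "(\<Sum>s\<in>{1..<p}. \<zeta> ^ (j * s)) = -1"
        using sum_powers_root_of_unity[OF power_power_p, of j] eq by (simp add: eq_neg_iff_add_eq_0 add.commute)
      thus ?thesis by simp
    qed simp
  qed
  hence "(\<Sum>j<p. of_rat (d j) * (\<Sum>s\<in>{1..<p}. \<zeta> ^ (j * s))) \<in> \<rat>"
    by - (rule Rats_sum, rule Rats_mult, auto)
  also have "(\<Sum>j<p. of_rat (d j) * (\<Sum>s\<in>{1..<p}. \<zeta> ^ (j * s))) = (\<Sum>s\<in>{1..<p}. f s)"
    unfolding d sum_distrib_left by (rule sum.swap)
  also have "\<dots> = (\<Sum>s\<in>{1..<p}. f 1)" by (intro sum.cong refl inv)
  also have "\<dots> = of_nat (p - 1) * f 1" by simp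
  finally have "of_nat (p - 1) * f 1 / of_nat (p - 1) \<in> \<rat>" by (rule Rats_divide) simp
  thus ?thesis using p1 by simp
qed

definition poly_conjugates :: "(nat \<Rightarrow> complex poly) \<Rightarrow> bool" where
  "poly_conjugates F \<longleftrightarrow> (\<forall>l. conjugates (\<lambda>s. coeff (F s) l))"

lemma poly_conjugates_sum:
  "(\<And>i. i \<in> I \<Longrightarrow> poly_conjugates (F i)) \<Longrightarrow> poly_conjugates (\<lambda>s. \<Sum>i\<in>I. F i s)"
  unfolding poly_conjugates_def coeff_sum by (auto intro: conjugates_sum)

lemma poly_conjugates_mult:
  "poly_conjugates F \<Longrightarrow> poly_conjugates G \<Longrightarrow> poly_conjugates (\<lambda>s. F s * G s)"
  unfolding poly_conjugates_def coeff_mult by (auto intro!: conjugates_sum conjugates_mult)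

lemma poly_conjugates_smult:
  "conjugates f \<Longrightarrow> poly_conjugates F \<Longrightarrow> poly_conjugates (\<lambda>s. smult (f s) (F s))"
  unfolding poly_conjugates_def coeff_smult by (auto intro: conjugates_mult)

lemma poly_conjugates_1: "poly_conjugates (\<lambda>_. 1)"
  by (auto simp: poly_conjugates_def intro: conjugates_const)

lemma poly_conjugates_prod:
  "(\<And>i. i \<in> I \<Longrightarrow> poly_conjugates (F i)) \<Longrightarrow> poly_conjugates (\<lambda>s. \<Prod>i\<in>I. F i s)"
  by (induction I rule: infinite_finite_induct) (auto intro: poly_conjugates_mult poly_conjugates_1)

lemma poly_conjugates_linear: "conjugates f \<Longrightarrow> poly_conjugates (\<lambda>s. [:- f s, 1:])"
  unfolding poly_conjugates_def
proof
  fix l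
  assume f: "conjugates f"
  show "conjugates (\<lambda>s. coeff [:- f s, 1:] l)"
  proof (cases l)
    case (Suc m)
    thus ?thesis by (cases m) (auto intro: conjugates_const)
  qed (use f in \<open>auto intro: conjugates_minus\<close>)
qed

lemma poly_conjugates_invariant_rational:
  assumes "poly_conjugates F" "\<And>s. s \<in> {1..<p} \<Longrightarrow> F s = F 1"
  shows "coeff (F 1) l \<in> \<rat>"
proof (rule conjugates_invariant_rational[of "\<lambda>s. coeff (F s) l"])
  show "conjugates (\<lambda>s. coeff (F s) l)" using assms(1) by (simp add: poly_conjugates_def)
  show "coeff (F s) l = coeff (F 1) l" if "s \<in> {1..<p}" for s
    unfolding assms(2)[OF that] ..
qed

text \<open>
  Lagrange interpolation of \<open>\<beta>\<^sub>s \<mapsto> \<alpha>\<^sub>s\<close> over the set of conjugates of \<open>\<beta>\<close>. The set \<open>I\<close>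
  selects one exponent for each conjugate.
\<close>

lemma rational_function_of_conjugate:
  assumes \<alpha>: "conjugates \<alpha>" and \<beta>: "conjugates \<beta>"
    and fixed: "\<And>c. c \<in> {1..<p} \<Longrightarrow> \<beta> c = \<beta> 1 \<Longrightarrow> \<alpha> c = \<alpha> 1"
  shows "\<exists>F D. (\<forall>l. coeff F l \<in> \<rat>) \<and> (\<forall>l. coeff D l \<in> \<rat>) \<and>
           poly D (\<beta> 1) \<noteq> 0 \<and> \<alpha> 1 * poly D (\<beta> 1) = poly F (\<beta> 1)"
proof -
  define B where "B = \<beta> ` {1..<p}"
  obtain I where I: "I \<subseteq> {1..<p}" "inj_on \<beta> I" "B = \<beta> ` I"
    using subset_image_inj[of B \<beta> "{1..<p}"] unfolding B_def by blast
  have fin: "finite I" using I(1) finite_subset by blast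
  have p1: "p > 1" using prime_p by (rule prime_gt_1_nat)
  have unit_mult: "\<not> p dvd a * s" if "a \<in> I" "s \<in> {1..<p}" for a s
    using that I(1) unit_iff prime_p by (auto simp: prime_dvd_mult_iff)
  have one: "1 \<in> {1..<p}" using p1 by simp
  \<comment> \<open>With c = n/m modulo p, the equality at m and n is the conjugate by
    \<open>\<sigma>\<^sub>m\<close> of \<beta> c = \<beta> 1. The hypothesis is applied there and
    the result conjugated back.\<close>
  have eq_transfer: "\<alpha> m = \<alpha> n" if "\<not> p dvd m" "\<not> p dvd n" "\<beta> m = \<beta> n" for m n
  proof -
    have "coprime m p" using that(1) by (rule unit_coprime)
    then obtain x where x: "[m * x = 1] (mod p)" using cong_solve_coprime_nat[of m p] by auto
    define c where "c = (x * n) mod p"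
    have cm: "[c * m = n] (mod p)"
    proof -
      have "[c * m = x * n * m] (mod p)" by (simp add: c_def cong_def mod_mult_left_eq)
      also have "x * n * m = (m * x) * n" by simp
      also have "[(m * x) * n = 1 * n] (mod p)" using x by (rule cong_scalar_right)
      finally show ?thesis by simp
    qed
    have "c \<noteq> 0"
    proof
      assume "c = 0"
      hence "p dvd n" using cm by (simp add: cong_def mod_eq_0_iff_dvd)
      thus False using that(2) by simp
    qed
    hence c: "c \<in> {1..<p}" using p1 by (auto simp: c_def)
    have "\<beta> m = \<beta> (c * m)" using that(3) conjugates_cong[OF \<beta> cm] by simp
    hence "\<beta> 1 = \<beta> (c * 1)"
      using conjugates_eq[OF \<beta> conjugates_scale[OF \<beta>, of c] that(1), of 1] p1 by simp
    hence "\<alpha> 1 = \<alpha> (c * 1)" using fixed[OF c] by simp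
    hence "\<alpha> m = \<alpha> (c * m)"
      using conjugates_eq[OF \<alpha> conjugates_scale[OF \<alpha>, of c] unit_iff[OF one], of m] that(1) by simp
    thus ?thesis using conjugates_cong[OF \<alpha> cm] by simp
  qed
  \<comment> \<open>Multiplication by s permutes the conjugates: injectivity is carried from s back
    to 1, and cardinalities do the rest.\<close>
  have bij: "bij_betw (\<lambda>a. \<beta> (a * s)) I B" if s: "s \<in> {1..<p}" for s
  proof -
    have inj: "inj_on (\<lambda>a. \<beta> (a * s)) I"
    proof (rule inj_onI)
      fix a b assume ab: "a \<in> I" "b \<in> I" "\<beta> (a * s) = \<beta> (b * s)"
      hence "\<beta> (a * 1) = \<beta> (b * 1)"
        using conjugates_eq[OF conjugates_scale[OF \<beta>, of a] conjugates_scale[OF \<beta>, of b] unit_iff[OF s], of 1]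
          p1 by simp
      thus "a = b" using ab I(2) by (auto dest: inj_onD)
    qed
    have sub: "(\<lambda>a. \<beta> (a * s)) ` I \<subseteq> B"
    proof (rule image_subsetI)
      fix a assume "a \<in> I"
      hence "(a * s) mod p \<in> {1..<p}"
        using unit_mult[OF _ s] p1 by (auto simp: mod_greater_zero_iff_not_dvd Suc_le_eq)
      moreover have "\<beta> (a * s) = \<beta> ((a * s) mod p)" by (rule conjugates_cong[OF \<beta>]) (simp add: cong_def)
      ultimately show "\<beta> (a * s) \<in> B" unfolding B_def by blast
    qed
    have "card ((\<lambda>a. \<beta> (a * s)) ` I) = card B" using I(2,3) inj by (simp add: card_image)
    moreover have "finite B" using I(3) fin by simp
    ultimately have "(\<lambda>a. \<beta> (a * s)) ` I = B" using sub by (intro card_subset_eq)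
    thus ?thesis using inj by (simp add: bij_betw_def)
  qed
  \<comment> \<open>The conjugate by \<open>\<sigma>\<^sub>s\<close> of the numerator of the
    Lagrange interpolation. For constant \<gamma> = 1 it is the derivative of the product of the X -
    \<beta> b over \<open>I\<close>; that case serves as denominator.\<close>
  define F where "F = (\<lambda>\<gamma> s. \<Sum>a\<in>I. smult (\<gamma> (a * s)) (\<Prod>b\<in>I - {a}. [:- \<beta> (b * s), 1:]))"
  have F_rat: "coeff (F \<gamma> 1) l \<in> \<rat>"
    if \<gamma>: "conjugates \<gamma>" "\<And>m n. \<not> p dvd m \<Longrightarrow> \<not> p dvd n \<Longrightarrow> \<beta> m = \<beta> n \<Longrightarrow> \<gamma> m = \<gamma> n" for \<gamma> l
  proof (rule poly_conjugates_invariant_rational)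
    show "poly_conjugates (F \<gamma>)"
      unfolding F_def
      by (intro poly_conjugates_sum poly_conjugates_smult poly_conjugates_prod poly_conjugates_linear
            conjugates_scale \<gamma> \<beta>)
    \<comment> \<open>Written as a sum over the set \<open>B\<close> of all conjugates, the
      polynomial no longer mentions s, so it is invariant.\<close>
    define A where "A = (\<lambda>b. \<gamma> (SOME n. \<not> p dvd n \<and> \<beta> n = b))"
    have A: "A (\<beta> n) = \<gamma> n" if "\<not> p dvd n" for n
      unfolding A_def using someI[of "\<lambda>m. \<not> p dvd m \<and> \<beta> m = \<beta> n" n] that by (intro \<gamma>(2)) auto
    have inv: "F \<gamma> s = (\<Sum>b\<in>B. smult (A b) (\<Prod>b'\<in>B - {b}. [:- b', 1:]))" if s: "s \<in> {1..<p}" for s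
    proof -
      have "(\<Prod>b\<in>I - {a}. [:- \<beta> (b * s), 1:]) = (\<Prod>b'\<in>B - {\<beta> (a * s)}. [:- b', 1:])" if "a \<in> I" for a
      proof (rule prod.reindex_bij_betw)
        show "bij_betw (\<lambda>b. \<beta> (b * s)) (I - {a}) (B - {\<beta> (a * s)})"
          using bij[OF s] that by (auto simp: bij_betw_def inj_on_def)
      qed
      hence "F \<gamma> s = (\<Sum>a\<in>I. smult (A (\<beta> (a * s))) (\<Prod>b'\<in>B - {\<beta> (a * s)}. [:- b', 1:]))"
        unfolding F_def using A[OF unit_mult[OF _ s]] by (intro sum.cong) auto
      also have "\<dots> = (\<Sum>b\<in>B. smult (A b) (\<Prod>b'\<in>B - {b}. [:- b', 1:]))"
        using bij[OF s] by (rule sum.reindex_bij_betw)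
      finally show ?thesis .
    qed
    show "F \<gamma> s = F \<gamma> 1" if "s \<in> {1..<p}" for s
      using inv[OF that] inv[OF one] by simp
  qed
  have "\<beta> 1 \<in> \<beta> ` I" using I(3) one unfolding B_def by blast
  then obtain a where a: "a \<in> I" "\<beta> 1 = \<beta> a" by blast
  have eval: "poly (F \<gamma> 1) (\<beta> 1) = \<gamma> a * (\<Prod>b\<in>I - {a}. \<beta> a - \<beta> b)" for \<gamma>
  proof -
    have "poly (F \<gamma> 1) (\<beta> 1) = (\<Sum>c\<in>I. \<gamma> c * (\<Prod>b\<in>I - {c}. \<beta> a - \<beta> b))"
      by (simp add: F_def poly_sum poly_prod flip: a(2))
    also have "\<dots> = (\<Sum>c\<in>{a}. \<gamma> c * (\<Prod>b\<in>I - {c}. \<beta> a - \<beta> b))"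
      using a(1) fin by (intro sum.mono_neutral_right) auto
    finally show ?thesis by simp
  qed
  have \<alpha>a: "\<alpha> a = \<alpha> 1" using a I(1) unit_iff one by (intro eq_transfer) auto
  show ?thesis
  proof (intro exI conjI allI)
    show "coeff (F \<alpha> 1) l \<in> \<rat>" "coeff (F (\<lambda>_. 1) 1) l \<in> \<rat>" for l
      by (rule F_rat[OF \<alpha> eq_transfer], assumption+) (rule F_rat[OF conjugates_const], simp_all)
    show "poly (F (\<lambda>_. 1) 1) (\<beta> 1) \<noteq> 0"
      unfolding eval using I(2) a(1) fin by (auto simp: inj_on_def)
    show "\<alpha> 1 * poly (F (\<lambda>_. 1) 1) (\<beta> 1) = poly (F \<alpha> 1) (\<beta> 1)"
      unfolding eval \<alpha>a by simp
  qed
qed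

end

section \<open>Simple extensions of the rationals and their degree\<close>

lemma rat_adjoin_field:
  shows "\<rat> \<subseteq> rat_adjoin \<beta>" "\<beta> \<in> rat_adjoin \<beta>"
    "x \<in> rat_adjoin \<beta> \<Longrightarrow> y \<in> rat_adjoin \<beta> \<Longrightarrow> x + y \<in> rat_adjoin \<beta>"
    "x \<in> rat_adjoin \<beta> \<Longrightarrow> y \<in> rat_adjoin \<beta> \<Longrightarrow> x * y \<in> rat_adjoin \<beta>"
    "x \<in> rat_adjoin \<beta> \<Longrightarrow> x \<noteq> 0 \<Longrightarrow> inverse x \<in> rat_adjoin \<beta>"
    and rat_adjoin_subset: "\<alpha> \<in> rat_adjoin \<beta> \<Longrightarrow> rat_adjoin \<alpha> \<subseteq> rat_adjoin \<beta>"
proof -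
  let ?R = "ring_of_type_algebra :: complex ring"
  interpret R: Ring.field ?R by (rule field_from_type_algebra)
  have car: "carrier ?R = UNIV" and [simp]: "\<one>\<^bsub>?R\<^esub> = 1" "\<zero>\<^bsub>?R\<^esub> = 0"
    "\<And>x y. x \<otimes>\<^bsub>?R\<^esub> y = x * y" "\<And>x y. x \<oplus>\<^bsub>?R\<^esub> y = x + y"
    by (simp_all add: ring_of_type_algebra_def)
  have minv: "inv\<^bsub>?R\<^esub> x = inverse x" if "x \<noteq> 0" for x
    by (rule R.inv_unique'[symmetric]) (use that in \<open>simp_all add: car\<close>)
  show rat: "\<rat> \<subseteq> rat_adjoin \<beta>" and "\<beta> \<in> rat_adjoin \<beta>"
    unfolding rat_adjoin_def by (auto intro: generate_field.incl)
  show "x \<in> rat_adjoin \<beta> \<Longrightarrow> y \<in> rat_adjoin \<beta> \<Longrightarrow> x + y \<in> rat_adjoin \<beta>"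
    "x \<in> rat_adjoin \<beta> \<Longrightarrow> y \<in> rat_adjoin \<beta> \<Longrightarrow> x * y \<in> rat_adjoin \<beta>"
    unfolding rat_adjoin_def
    using generate_field.eng_add[of x ?R _ y] generate_field.eng_mult[of x ?R _ y] by simp_all
  show "x \<in> rat_adjoin \<beta> \<Longrightarrow> x \<noteq> 0 \<Longrightarrow> inverse x \<in> rat_adjoin \<beta>"
    unfolding rat_adjoin_def using generate_field.m_inv[of x ?R] minv by simp
  show "rat_adjoin \<alpha> \<subseteq> rat_adjoin \<beta>" if "\<alpha> \<in> rat_adjoin \<beta>"
    unfolding rat_adjoin_def[of \<alpha>]
  proof (rule R.generate_field_min_subfield1)
    show "subfield (rat_adjoin \<beta>) ?R"
      unfolding rat_adjoin_def by (rule R.generate_field_is_subfield) (simp add: car)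
  qed (use that rat in \<open>auto simp: car\<close>)
qed

lemma poly_in_rat_adjoin:
  assumes "\<And>l. coeff F l \<in> \<rat>"
  shows "poly F \<beta> \<in> rat_adjoin \<beta>"
proof -
  have pw: "\<beta> ^ n \<in> rat_adjoin \<beta>" for n
    using rat_adjoin_field(1)[of \<beta>] by (induction n) (auto intro: rat_adjoin_field(2,4))
  have "(\<Sum>i\<in>I. coeff F i * \<beta> ^ i) \<in> rat_adjoin \<beta>" for I
    using rat_adjoin_field(1)[of \<beta>] assms pw
    by (induction I rule: infinite_finite_induct) (auto intro!: rat_adjoin_field(3,4))
  thus ?thesis by (simp add: poly_altdef)
qed

text \<open>Galois correspondence by interpolation: elements with the same stabiliser are rational
  functions of each other, so they generate the same field.\<close>

lemma (in prime_cyclotomic) alg_degree_eq: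
  assumes "conjugates \<alpha>" "conjugates \<beta>"
    and "\<And>c. c \<in> {1..<p} \<Longrightarrow> \<alpha> c = \<alpha> 1 \<longleftrightarrow> \<beta> c = \<beta> 1"
  shows "alg_degree (\<alpha> 1) = alg_degree (\<beta> 1)"
proof -
  have sub: "rat_adjoin (\<alpha> 1) \<subseteq> rat_adjoin (\<beta> 1)"
    if conj: "conjugates \<alpha>" "conjugates \<beta>" "\<And>c. c \<in> {1..<p} \<Longrightarrow> \<beta> c = \<beta> 1 \<Longrightarrow> \<alpha> c = \<alpha> 1" for \<alpha> \<beta>
  proof (rule rat_adjoin_subset)
    obtain F D where FD: "\<And>l. coeff F l \<in> \<rat>" "\<And>l. coeff D l \<in> \<rat>" "poly D (\<beta> 1) \<noteq> 0"
      "\<alpha> 1 * poly D (\<beta> 1) = poly F (\<beta> 1)"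
      using rational_function_of_conjugate[OF conj] by blast
    have "\<alpha> 1 = poly F (\<beta> 1) * inverse (poly D (\<beta> 1))"
      using FD(3,4) by (simp add: field_simps)
    also have "\<dots> \<in> rat_adjoin (\<beta> 1)"
      using FD by (intro rat_adjoin_field(4,5) poly_in_rat_adjoin)
    finally show "\<alpha> 1 \<in> rat_adjoin (\<beta> 1)" .
  qed
  have "rat_adjoin (\<alpha> 1) = rat_adjoin (\<beta> 1)"
    by (rule equalityI[OF sub[OF assms(1,2)] sub[OF assms(2,1)]])
       (use assms(3) in blast)+
  thus ?thesis by (simp add: alg_degree_def)
qed

section \<open>The trace formula\<close>

lemma sum_powers_roots_of_unity:
  assumes m: "m > 0"
  shows "(\<Sum>t\<in>{z::complex. z ^ m = 1}. t ^ w) = (if m dvd w then of_nat m else 0)"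
proof -
  define \<omega> where "\<omega> = cis (2 * pi / real m)"
  have eq: "cis (2 * pi * real k / real m) = \<omega> ^ k" for k
    by (simp add: \<omega>_def DeMoivre mult_ac)
  have bij: "bij_betw (\<lambda>k. \<omega> ^ k) {..<m} {z. z ^ m = 1}"
    using bij_betw_roots_unity[OF m] by (simp only: eq)
  have \<omega>: "\<omega> ^ m = 1" using m by (simp add: \<omega>_def DeMoivre)
  have mod: "\<omega> ^ w = \<omega> ^ (w mod m)" for w
  proof -
    have "\<omega> ^ w = \<omega> ^ (m * (w div m) + w mod m)" by simp
    also have "\<dots> = \<omega> ^ (w mod m)" by (simp only: power_add power_mult \<omega> power_one mult_1_left)
    finally show ?thesis .
  qed
  have "(\<Sum>t\<in>{z::complex. z ^ m = 1}. t ^ w) = (\<Sum>k<m. (\<omega> ^ k) ^ w)"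
    using bij by (rule sum.reindex_bij_betw[symmetric])
  also have "\<dots> = (\<Sum>k<m. (\<omega> ^ w) ^ k)" by (simp only: power_mult[symmetric] mult.commute)
  also have "\<dots> = (if m dvd w then of_nat m else 0)"
  proof (cases "m dvd w")
    case True
    hence "\<omega> ^ w = 1" using mod[of w] by (simp add: dvd_eq_mod_eq_0)
    thus ?thesis using True by simp
  next
    case False
    have "\<omega> ^ w \<noteq> 1"
    proof
      assume "\<omega> ^ w = 1"
      hence "\<omega> ^ (w mod m) = \<omega> ^ 0" using mod[of w] by simp
      moreover have "inj_on (\<lambda>k. \<omega> ^ k) {..<m}" using bij by (simp add: bij_betw_def)
      ultimately have "w mod m = 0" using m inj_onD[of "\<lambda>k. \<omega> ^ k" "{..<m}" "w mod m" 0] by simp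
      thus False using False by (simp add: dvd_eq_mod_eq_0)
    qed
    moreover have "(\<omega> ^ w) ^ m = 1"
    proof -
      have "(\<omega> ^ w) ^ m = (\<omega> ^ m) ^ w" by (simp only: power_mult[symmetric] mult.commute)
      thus ?thesis by (simp add: \<omega>)
    qed
    ultimately have "(\<Sum>k<m. (\<omega> ^ w) ^ k) = 0" by (simp add: geometric_sum)
    thus ?thesis using False by simp
  qed
  finally show ?thesis .
qed

text \<open>The point t = 0 adds the summand at w = 0, because 0^0 = 1.\<close>

lemma sum_powers_teichmueller:
  assumes q: "q > 1"
  shows "finite {z::complex. z ^ q = z}"
    "(\<Sum>t\<in>{z::complex. z ^ q = z}. t ^ w) =
       (if (q - 1) dvd w then of_nat (q - 1) else 0) + (if w = 0 then 1 else 0)"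
proof -
  have "z ^ q = z * z ^ (q - 1)" for z :: complex using q by (cases q) auto
  hence eq: "{z::complex. z ^ q = z} = insert 0 {z. z ^ (q - 1) = 1}"
    by (auto simp: mult_cancel_left2)
  have fin: "finite {z::complex. z ^ (q - 1) = 1}" using q by (intro finite_roots_unity) auto
  thus "finite {z::complex. z ^ q = z}" unfolding eq by simp
  have "(0::complex) \<notin> {z. z ^ (q - 1) = 1}" using q by (simp add: power_0_left)
  thus "(\<Sum>t\<in>{z::complex. z ^ q = z}. t ^ w) =
       (if (q - 1) dvd w then of_nat (q - 1) else 0) + (if w = 0 then 1 else 0)"
    unfolding eq using fin q sum_powers_roots_of_unity[of "q - 1" w]
    by (simp add: power_0_left)
qed

lemma prod_if_0:
  fixes a :: "'a::comm_semiring_1"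
  assumes "finite I"
  shows "(\<Prod>i\<in>I. if Q i then a else 0) = (if \<forall>i\<in>I. Q i then a ^ card I else 0)"
  using assms by (induction I rule: finite_induct) auto

lemma prod_sum_conditions:
  fixes a :: "'a::comm_semiring_1"
  assumes "finite A"
  shows "(\<Prod>i\<in>A. (if Q i then a else 0) + (if S i then 1 else 0)) =
     (\<Sum>I\<in>Pow A. if (\<forall>i\<in>I. Q i) \<and> (\<forall>i\<in>A - I. S i) then a ^ card I else 0)"
  unfolding prod_add[OF assms]
proof (intro sum.cong refl)
  fix I assume "I \<in> Pow A"
  hence fin: "finite I" "finite (A - I)" using assms finite_subset by auto
  show "(\<Prod>i\<in>I. if Q i then a else 0) * (\<Prod>i\<in>A - I. if S i then 1 else 0) =
      (if (\<forall>i\<in>I. Q i) \<and> (\<forall>i\<in>A - I. S i) then a ^ card I else 0)"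
    using fin by (simp add: prod_if_0)
qed

text \<open>
  The polynomial \<open>\<Sum>g\<in>G. c g * (\<Prod>i<n. x i ^ e g i)\<close> is given by its family of terms; a list of
  indices of length \<open>k\<close> stands for a term of \<open>F(x) F(x\<^sup>p) F(x\<^sup>p\<^sup>2) \<dots>\<close>.
\<close>

locale term_family =
  fixes G :: "'g set" and c :: "'g \<Rightarrow> complex" and e :: "'g \<Rightarrow> nat \<Rightarrow> nat" and n D p :: nat
  assumes finite_G: "finite G" and p_ge_2: "p \<ge> 2"
    and degree_bound: "\<And>g i. g \<in> G \<Longrightarrow> i < n \<Longrightarrow> e g i \<le> D * (p - 1)"
begin

definition eval :: "(nat \<Rightarrow> complex) \<Rightarrow> complex" where
  "eval x = (\<Sum>g\<in>G. c g * (\<Prod>i<n. x i ^ e g i))"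

definition words :: "nat \<Rightarrow> 'g list set" where
  "words k = {gs. set gs \<subseteq> G \<and> length gs = k}"

definition coef :: "'g list \<Rightarrow> complex" where
  "coef gs = (\<Prod>g\<leftarrow>gs. c g)"

primrec expo :: "'g list \<Rightarrow> nat \<Rightarrow> nat" where
  "expo [] i = 0"
| "expo (g # gs) i = e g i + p * expo gs i"

lemma words_0: "words 0 = {[]}"
  by (auto simp: words_def)

lemma sum_words_Suc: "(\<Sum>gs\<in>words (Suc k). h gs) = (\<Sum>g\<in>G. \<Sum>gs\<in>words k. h (g # gs))"
proof -
  have "words (Suc k) = (\<lambda>(g, gs). g # gs) ` (G \<times> words k)"
    by (auto simp: words_def length_Suc_conv image_iff)
  moreover have "inj_on (\<lambda>(g, gs). g # gs) (G \<times> words k)" by (auto simp: inj_on_def)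
  ultimately have "(\<Sum>gs\<in>words (Suc k). h gs) = (\<Sum>(g, gs)\<in>G \<times> words k. h (g # gs))"
    by (simp only: sum.reindex o_def case_prod_unfold)
  thus ?thesis by (simp only: sum.cartesian_product)
qed

text \<open>A geometric sum. If the exponent is a multiple of p^k - 1, the quotient is at most D and
  thus indexes a row of the finite matrix.\<close>

lemma expo_bound: "gs \<in> words k \<Longrightarrow> i < n \<Longrightarrow> expo gs i \<le> D * (p ^ k - 1)"
proof (induction gs arbitrary: k)
  case (Cons g gs)
  then obtain l where k: "k = Suc l" and gs: "gs \<in> words l" "g \<in> G" by (auto simp: words_def)
  have "p ^ l \<ge> 1" using p_ge_2 by simp
  have "expo (g # gs) i \<le> D * (p - 1) + p * (D * (p ^ l - 1))"
    using Cons.IH[OF gs(1) Cons.prems(2)] degree_bound[OF gs(2) Cons.prems(2)] by (auto intro: add_mono)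
  also have "\<dots> = D * ((p - 1) + p * (p ^ l - 1))" by (simp add: algebra_simps)
  also have "(p - 1) + p * (p ^ l - 1) = p ^ k - 1"
    using \<open>p ^ l \<ge> 1\<close> p_ge_2 by (simp add: k diff_mult_distrib2)
  finally show ?case .
qed simp

lemma eval_frobenius_product:
  "(\<Prod>j<k. eval (\<lambda>i. x i ^ p ^ j)) = (\<Sum>gs\<in>words k. coef gs * (\<Prod>i<n. x i ^ expo gs i))"
proof (induction k arbitrary: x)
  case 0
  show ?case by (simp add: words_0 coef_def)
next
  case (Suc k)
  have "(\<Prod>j<Suc k. eval (\<lambda>i. x i ^ p ^ j)) = eval x * (\<Prod>j<k. eval (\<lambda>i. (x i ^ p) ^ p ^ j))"
    unfolding prod.lessThan_Suc_shift by (simp add: power_mult)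
  also have "\<dots> = (\<Sum>g\<in>G. \<Sum>gs\<in>words k. coef (g # gs) * (\<Prod>i<n. x i ^ expo (g # gs) i))"
    unfolding Suc.IH[of "\<lambda>i. x i ^ p"]
    unfolding eval_def sum_product
    by (intro sum.cong refl) (simp add: coef_def prod.distrib power_add power_mult)
  also have "\<dots> = (\<Sum>gs\<in>words (Suc k). coef gs * (\<Prod>i<n. x i ^ expo gs i))"
    by (rule sum_words_Suc[symmetric])
  finally show ?case .
qed

text \<open>Points are sorted by the set \<open>I\<close> of their nonzero coordinates. A word
  survives summation over the (p^k - 1)-th roots of unity in \<open>I\<close> if its exponents there
  are divisible by p^k - 1, and survives zeros elsewhere if its other exponents are 0; the factor
  (p^k - 1)^|I| is left out.\<close>

definition torus_sum :: "nat set \<Rightarrow> nat \<Rightarrow> complex" where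
  "torus_sum I k = (\<Sum>gs\<in>words k.
     if (\<forall>i\<in>I. (p ^ k - 1) dvd expo gs i) \<and> (\<forall>i\<in>{..<n} - I. expo gs i = 0) then coef gs else 0)"

lemma eval_sum_teichmueller:
  assumes "k \<ge> 1"
  shows "(\<Sum>x\<in>{..<n} \<rightarrow>\<^sub>E {z. z ^ p ^ k = z}. \<Prod>j<k. eval (\<lambda>i. x i ^ p ^ j)) =
           (\<Sum>I\<in>Pow {..<n}. of_nat (p ^ k - 1) ^ card I * torus_sum I k)"
proof -
  let ?T = "{z::complex. z ^ p ^ k = z}"
  have q: "p ^ k > 1" using p_ge_2 assms by (intro one_less_power) auto
  note T = sum_powers_teichmueller[OF q]
  have "(\<Sum>x\<in>{..<n} \<rightarrow>\<^sub>E ?T. \<Prod>j<k. eval (\<lambda>i. x i ^ p ^ j)) =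
      (\<Sum>gs\<in>words k. coef gs * (\<Sum>x\<in>{..<n} \<rightarrow>\<^sub>E ?T. \<Prod>i<n. x i ^ expo gs i))"
    unfolding eval_frobenius_product sum_distrib_left by (rule sum.swap)
  also have "\<dots> = (\<Sum>gs\<in>words k. \<Sum>I\<in>Pow {..<n}. of_nat (p ^ k - 1) ^ card I *
      (if (\<forall>i\<in>I. (p ^ k - 1) dvd expo gs i) \<and> (\<forall>i\<in>{..<n} - I. expo gs i = 0) then coef gs else 0))"
  proof (intro sum.cong refl)
    fix gs assume "gs \<in> words k"
    have "(\<Sum>x\<in>{..<n} \<rightarrow>\<^sub>E ?T. \<Prod>i<n. x i ^ expo gs i) = (\<Prod>i<n. \<Sum>t\<in>?T. t ^ expo gs i)"
      using T(1) by (intro prod_sum_PiE[symmetric]) auto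
    also have "\<dots> = (\<Sum>I\<in>Pow {..<n}. if (\<forall>i\<in>I. (p ^ k - 1) dvd expo gs i) \<and>
        (\<forall>i\<in>{..<n} - I. expo gs i = 0) then of_nat (p ^ k - 1) ^ card I else 0)"
      unfolding T(2) by (rule prod_sum_conditions) simp
    finally have eq: "(\<Sum>x\<in>{..<n} \<rightarrow>\<^sub>E ?T. \<Prod>i<n. x i ^ expo gs i) =
        (\<Sum>I\<in>Pow {..<n}. if (\<forall>i\<in>I. (p ^ k - 1) dvd expo gs i) \<and>
        (\<forall>i\<in>{..<n} - I. expo gs i = 0) then of_nat (p ^ k - 1) ^ card I else 0)" .
    show "coef gs * (\<Sum>x\<in>{..<n} \<rightarrow>\<^sub>E ?T. \<Prod>i<n. x i ^ expo gs i) =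
        (\<Sum>I\<in>Pow {..<n}. of_nat (p ^ k - 1) ^ card I *
          (if (\<forall>i\<in>I. (p ^ k - 1) dvd expo gs i) \<and> (\<forall>i\<in>{..<n} - I. expo gs i = 0) then coef gs else 0))"
      unfolding eq unfolding sum_distrib_left by (intro sum.cong refl) simp
  qed
  also have "\<dots> = (\<Sum>I\<in>Pow {..<n}. of_nat (p ^ k - 1) ^ card I * torus_sum I k)"
    unfolding torus_sum_def sum_distrib_left by (rule sum.swap)
  finally show ?thesis .
qed

text \<open>Exponents of monomials in the variables of \<open>I\<close>, with a bound that
  reproduces itself under e + v = p z, since D (p - 1) + D = p D.\<close>

definition box :: "nat set \<Rightarrow> (nat \<Rightarrow> nat) set" where
  "box I = {u. (\<forall>i\<in>I. u i \<le> D) \<and> (\<forall>i. i \<notin> I \<longrightarrow> u i = 0)}"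

lemma finite_box: "finite I \<Longrightarrow> finite (box I)"
proof -
  assume "finite I"
  hence "finite {u. \<forall>i. (i \<in> I \<longrightarrow> u i \<in> {..D}) \<and> (i \<notin> I \<longrightarrow> u i = 0)}"
    by (intro finite_set_of_finite_funs) auto
  moreover have "box I = {u. \<forall>i. (i \<in> I \<longrightarrow> u i \<in> {..D}) \<and> (i \<notin> I \<longrightarrow> u i = 0)}"
    by (auto simp: box_def)
  ultimately show ?thesis by simp
qed

text \<open>
  Dwork's operator: multiplication by \<open>F\<close> followed by \<open>x\<^sup>p\<^sup>u \<mapsto> x\<^sup>u\<close>, conjugated by the diagonal
  matrix \<open>d\<close>.
\<close>

definition dwork_entry :: "((nat \<Rightarrow> nat) \<Rightarrow> complex) \<Rightarrow> (nat \<Rightarrow> nat) \<Rightarrow> (nat \<Rightarrow> nat) \<Rightarrow> complex" where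
  "dwork_entry d u v = d v * inverse (d u) *
     (\<Sum>g\<in>G. if \<forall>i<n. e g i + v i = p * u i then c g else 0)"

text \<open>The intermediate exponent is forced to be (e + v)/p. It stays in the box: below D by the
  bound on e, and zero outside \<open>I\<close> because u is zero there. So cutting the operator
  down to the box loses no path.\<close>

lemma sum_dwork_entry_intermediate:
  assumes I: "I \<subseteq> {..<n}" and u: "u \<in> box I" and v: "v \<in> box I" and g: "g \<in> G"
  shows "(\<Sum>z\<in>box I. if (\<forall>i<n. y i + z i = q * u i) \<and> (\<forall>i<n. e g i + v i = p * z i) then h else 0) =
           (if \<forall>i<n. e g i + p * y i + v i = p * q * u i then h else (0::complex))"
proof (cases "\<forall>i<n. e g i + p * y i + v i = p * q * u i")
  case True
  define z0 where "z0 = (\<lambda>i. if i < n then (e g i + v i) div p else 0)"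
  have dvd: "p * z0 i = e g i + v i" if "i < n" for i
  proof -
    have "p dvd (e g i + v i) + p * y i" using True that by (metis add.assoc add.commute dvd_triv_left mult.assoc)
    hence "p dvd e g i + v i" by (simp add: dvd_add_left_iff)
    thus ?thesis using that by (simp add: z0_def)
  qed
  have sol: "z0 \<in> box I"
    unfolding box_def
  proof (intro CollectI conjI ballI allI impI)
    fix i assume i: "i \<in> I"
    hence "i < n" using I by auto
    have "p * z0 i \<le> D * (p - 1) + D"
      unfolding dvd[OF \<open>i < n\<close>] using degree_bound[OF g \<open>i < n\<close>] v i
      by (intro add_mono) (auto simp: box_def)
    also have "\<dots> = p * D" using p_ge_2 by (cases p) auto
    finally show "z0 i \<le> D" using p_ge_2 by simp
  next
    fix i assume i: "i \<notin> I"
    show "z0 i = 0"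
    proof (cases "i < n")
      case True': True
      have "u i = 0" using u i by (simp add: box_def)
      hence "e g i + v i = 0" using True True' by auto
      thus ?thesis by (simp add: z0_def)
    qed (simp add: z0_def)
  qed
  have uniq: "z = z0" if "z \<in> box I" "\<forall>i<n. e g i + v i = p * z i" for z
  proof
    fix i
    show "z i = z0 i"
    proof (cases "i < n")
      case True
      hence "p * z i = e g i + v i" using that(2) by simp
      hence "p * z i = p * z0 i" using dvd[OF True] by (simp only:)
      thus ?thesis using p_ge_2 by simp
    next
      case False
      hence "i \<notin> I" using I by auto
      thus ?thesis using that(1) sol by (simp add: box_def)
    qed
  qed
  have first: "y i + z0 i = q * u i" if "i < n" for i
  proof -
    have "p * (y i + z0 i) = e g i + p * y i + v i" using dvd[OF that] by (simp add: algebra_simps)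
    also have "\<dots> = p * (q * u i)" using True that by (simp add: mult.assoc)
    finally show ?thesis using p_ge_2 by simp
  qed
  have sol_iff: "(\<forall>i<n. y i + z i = q * u i) \<and> (\<forall>i<n. e g i + v i = p * z i) \<longleftrightarrow> z = z0"
    if "z \<in> box I" for z
  proof
    assume z: "z = z0"
    show "(\<forall>i<n. y i + z i = q * u i) \<and> (\<forall>i<n. e g i + v i = p * z i)"
      unfolding z by (intro conjI allI impI first dvd[symmetric])
  qed (use uniq[OF that] in blast)
  have "(\<Sum>z\<in>box I. if (\<forall>i<n. y i + z i = q * u i) \<and> (\<forall>i<n. e g i + v i = p * z i) then h else 0) =
      (\<Sum>z\<in>box I. if z = z0 then h else 0)"
    by (intro sum.cong refl) (simp only: sol_iff)
  also have "\<dots> = h"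
    using sol finite_box[OF finite_subset[OF I]] by simp
  finally show ?thesis unfolding if_P[OF True] .
next
  case False
  have none: "\<not> ((\<forall>i<n. y i + z i = q * u i) \<and> (\<forall>i<n. e g i + v i = p * z i))" for z
  proof
    assume *: "(\<forall>i<n. y i + z i = q * u i) \<and> (\<forall>i<n. e g i + v i = p * z i)"
    have "e g i + p * y i + v i = p * q * u i" if "i < n" for i
    proof -
      have 1: "e g i + v i = p * z i" and 2: "y i + z i = q * u i" using * that by blast+
      have "e g i + p * y i + v i = p * (y i + z i)" unfolding distrib_left 1[symmetric] by simp
      thus ?thesis unfolding 2 by (simp add: mult.assoc)
    qed
    thus False using False by blast
  qed
  have "(\<Sum>z\<in>box I. if (\<forall>i<n. y i + z i = q * u i) \<and> (\<forall>i<n. e g i + v i = p * z i) then h else 0) =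
      (\<Sum>z\<in>box I. 0)"
    by (intro sum.cong refl if_not_P none)
  thus ?thesis unfolding if_not_P[OF False] by (simp only: sum.neutral_const)
qed

definition dwork_matrix :: "((nat \<Rightarrow> nat) \<Rightarrow> complex) \<Rightarrow> (nat \<Rightarrow> nat) list \<Rightarrow> complex mat" where
  "dwork_matrix d us = mat (length us) (length us) (\<lambda>(i, j). dwork_entry d (us ! i) (us ! j))"

text \<open>Matrix powers sum over paths; a word and the end points determine the exponents in
  between, and the scaling by \<open>d\<close> telescopes.\<close>

lemma dwork_matrix_power:
  assumes I: "I \<subseteq> {..<n}" and us: "set us = box I" "distinct us" and d: "\<And>u. d u \<noteq> 0"
    and ij: "i < length us" "j < length us"
  shows "(dwork_matrix d us ^\<^sub>m k) $$ (i, j) = d (us ! j) * inverse (d (us ! i)) *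
    (\<Sum>gs\<in>words k. if \<forall>l<n. expo gs l + (us ! j) l = p ^ k * (us ! i) l then coef gs else 0)"
  using ij
proof (induction k arbitrary: j)
  case 0
  have "(\<forall>l<n. (us ! j) l = (us ! i) l) \<longleftrightarrow> i = j"
  proof
    assume *: "\<forall>l<n. (us ! j) l = (us ! i) l"
    have "us ! i \<in> box I" "us ! j \<in> box I" using us(1) 0 nth_mem by blast+
    hence "us ! i = us ! j" using * I by (auto simp: box_def fun_eq_iff) (metis lessThan_iff subsetD)
    thus "i = j" using us(2) 0 by (simp add: nth_eq_iff_index_eq)
  qed auto
  thus ?case using 0 d by (auto simp: words_0 coef_def dwork_matrix_def)
next
  case (Suc k)
  let ?A = "dwork_matrix d us" and ?N = "length us"
  have A: "?A \<in> carrier_mat ?N ?N" by (simp add: dwork_matrix_def)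
  have box: "us ! i \<in> box I" "us ! j \<in> box I" using us(1) Suc.prems nth_mem by blast+
  let ?S = "\<lambda>z. \<Sum>gs\<in>words k. if \<forall>l<n. expo gs l + z l = p ^ k * (us ! i) l then coef gs else 0"
  let ?T = "\<lambda>z. \<Sum>g\<in>G. if \<forall>l<n. e g l + (us ! j) l = p * z l then c g else 0"
  have "(?A ^\<^sub>m Suc k) $$ (i, j) = (\<Sum>m<?N. (?A ^\<^sub>m k) $$ (i, m) * ?A $$ (m, j))"
    using A Suc.prems by (auto simp: scalar_prod_def atLeast0LessThan intro!: sum.cong)
  also have "\<dots> = (\<Sum>m<?N. (d (us ! j) * inverse (d (us ! i))) * (?S (us ! m) * ?T (us ! m)))"
  proof (intro sum.cong refl)
    fix m assume m: "m \<in> {..<?N}"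
    have "?A $$ (m, j) = d (us ! j) * inverse (d (us ! m)) * ?T (us ! m)"
      using m Suc.prems by (simp add: dwork_matrix_def dwork_entry_def)
    thus "(?A ^\<^sub>m k) $$ (i, m) * ?A $$ (m, j) = (d (us ! j) * inverse (d (us ! i))) * (?S (us ! m) * ?T (us ! m))"
      using Suc.IH[of m] m Suc.prems d[of "us ! m"] by simp
  qed
  also have "\<dots> = (d (us ! j) * inverse (d (us ! i))) * (\<Sum>z\<in>box I. ?S z * ?T z)"
    unfolding sum_distrib_left[symmetric]
    using sum.reindex_bij_betw[OF bij_betw_nth[OF us(2) refl us(1)[symmetric]], of "\<lambda>z. ?S z * ?T z"] by simp
  also have "(\<Sum>z\<in>box I. ?S z * ?T z) =
      (\<Sum>z\<in>box I. \<Sum>gs\<in>words k. \<Sum>g\<in>G. if (\<forall>l<n. expo gs l + z l = p ^ k * (us ! i) l) \<and>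
         (\<forall>l<n. e g l + (us ! j) l = p * z l) then coef (g # gs) else 0)"
    unfolding sum_product by (intro sum.cong refl) (auto simp: coef_def)
  also have "\<dots> = (\<Sum>gs\<in>words k. \<Sum>z\<in>box I. \<Sum>g\<in>G. if (\<forall>l<n. expo gs l + z l = p ^ k * (us ! i) l) \<and>
         (\<forall>l<n. e g l + (us ! j) l = p * z l) then coef (g # gs) else 0)"
    by (rule sum.swap)
  also have "\<dots> = (\<Sum>gs\<in>words k. \<Sum>g\<in>G. \<Sum>z\<in>box I. if (\<forall>l<n. expo gs l + z l = p ^ k * (us ! i) l) \<and>
         (\<forall>l<n. e g l + (us ! j) l = p * z l) then coef (g # gs) else 0)"
    by (intro sum.cong refl) (rule sum.swap)
  also have "\<dots> = (\<Sum>gs\<in>words k. \<Sum>g\<in>G. if \<forall>l<n. expo (g # gs) l + (us ! j) l = p ^ Suc k * (us ! i) l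
         then coef (g # gs) else 0)"
    using sum_dwork_entry_intermediate[OF I box] by (intro sum.cong refl) simp
  also have "\<dots> = (\<Sum>gs\<in>words (Suc k). if \<forall>l<n. expo gs l + (us ! j) l = p ^ Suc k * (us ! i) l
         then coef gs else 0)"
    unfolding sum_words_Suc by (rule sum.swap)
  finally show ?case .
qed

text \<open>A closed path at u carries a word of exponent (p^k - 1) u, so each word counted in
  \<open>torus_sum\<close> belongs to exactly one diagonal entry, and the diagonal scaling drops
  out.\<close>

lemma dwork_trace_formula:
  assumes I: "I \<subseteq> {..<n}" and us: "set us = box I" "distinct us" and d: "\<And>u. d u \<noteq> 0" and k: "k \<ge> 1"
  shows "mat_trace (dwork_matrix d us ^\<^sub>m k) = torus_sum I k"
proof -
  have q: "p ^ k > 1" using p_ge_2 k by (intro one_less_power) auto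
  have "mat_trace (dwork_matrix d us ^\<^sub>m k) = (\<Sum>i<length us. (dwork_matrix d us ^\<^sub>m k) $$ (i, i))"
    by (simp add: mat_trace_def dwork_matrix_def)
  also have "\<dots> = (\<Sum>i<length us. \<Sum>gs\<in>words k.
      if \<forall>l<n. expo gs l + (us ! i) l = p ^ k * (us ! i) l then coef gs else 0)"
    using d by (intro sum.cong refl) (simp add: dwork_matrix_power[OF I us d])
  also have "\<dots> = (\<Sum>u\<in>box I. \<Sum>gs\<in>words k. if \<forall>l<n. expo gs l + u l = p ^ k * u l then coef gs else 0)"
    by (rule sum.reindex_bij_betw[OF bij_betw_nth[OF us(2) refl us(1)[symmetric]]])
  also have "\<dots> = (\<Sum>gs\<in>words k. \<Sum>u\<in>box I. if \<forall>l<n. expo gs l + u l = p ^ k * u l then coef gs else 0)"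
    by (rule sum.swap)
  also have "\<dots> = torus_sum I k"
    unfolding torus_sum_def
  proof (intro sum.cong refl)
    fix gs assume gs: "gs \<in> words k"
    have cond: "expo gs l + u l = p ^ k * u l \<longleftrightarrow> expo gs l = (p ^ k - 1) * u l" for u :: "nat \<Rightarrow> nat" and l
    proof -
      have "p ^ k = (p ^ k - 1) + 1" using q by simp
      hence "p ^ k * u l = (p ^ k - 1) * u l + u l" by (metis distrib_right mult_1)
      thus ?thesis by linarith
    qed
    show "(\<Sum>u\<in>box I. if \<forall>l<n. expo gs l + u l = p ^ k * u l then coef gs else 0) =
        (if (\<forall>i\<in>I. p ^ k - 1 dvd expo gs i) \<and> (\<forall>i\<in>{..<n} - I. expo gs i = 0) then coef gs else 0)"
    proof (cases "(\<forall>i\<in>I. p ^ k - 1 dvd expo gs i) \<and> (\<forall>i\<in>{..<n} - I. expo gs i = 0)")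
      case True
      define u0 where "u0 = (\<lambda>i. if i \<in> I then expo gs i div (p ^ k - 1) else 0)"
      have u0: "expo gs l = (p ^ k - 1) * u0 l" if "l < n" for l
        using True that by (auto simp: u0_def)
      have "u0 i \<le> D" if "i \<in> I" for i
      proof -
        have "i < n" using that I by auto
        hence "(p ^ k - 1) * u0 i \<le> (p ^ k - 1) * D"
          using expo_bound[OF gs, of i] u0[of i] by (simp add: mult.commute)
        thus ?thesis using q by simp
      qed
      hence box: "u0 \<in> box I" by (auto simp: box_def u0_def)
      have uniq: "u = u0" if "u \<in> box I" "\<forall>l<n. expo gs l = (p ^ k - 1) * u l" for u
      proof
        fix i
        show "u i = u0 i"
        proof (cases "i \<in> I")
          case True
          hence "i < n" using I by auto
          hence "(p ^ k - 1) * u i = (p ^ k - 1) * u0 i"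
            using that(2)[rule_format, OF \<open>i < n\<close>] u0[OF \<open>i < n\<close>] by (simp only:)
          thus ?thesis using q by simp
        qed (use that(1) in \<open>simp add: box_def u0_def\<close>)
      qed
      have iff: "(\<forall>l<n. expo gs l = (p ^ k - 1) * u l) \<longleftrightarrow> u = u0" if "u \<in> box I" for u
        using uniq[OF that] u0 by blast
      have "(\<Sum>u\<in>box I. if \<forall>l<n. expo gs l + u l = p ^ k * u l then coef gs else 0) =
          (\<Sum>u\<in>box I. if u = u0 then coef gs else 0)"
        unfolding cond by (intro sum.cong refl) (simp only: iff)
      also have "\<dots> = coef gs" using box finite_box[OF finite_subset[OF I]] by simp
      finally show ?thesis unfolding if_P[OF True] .
    next
      case False
      have none: "\<not> (\<forall>l<n. expo gs l = (p ^ k - 1) * u l)" if u: "u \<in> box I" for u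
      proof
        assume *: "\<forall>l<n. expo gs l = (p ^ k - 1) * u l"
        hence "\<forall>i\<in>I. p ^ k - 1 dvd expo gs i" using I by auto
        moreover have "\<forall>i\<in>{..<n} - I. expo gs i = 0" using * u by (auto simp: box_def)
        ultimately show False using False by blast
      qed
      have "(\<Sum>u\<in>box I. if \<forall>l<n. expo gs l + u l = p ^ k * u l then coef gs else 0) = (\<Sum>u\<in>box I. 0)"
        unfolding cond by (intro sum.cong refl if_not_P none)
      thus ?thesis unfolding if_not_P[OF False] by (simp only: sum.neutral_const)
    qed
  qed
  finally show ?thesis .
qed

end

section \<open>Decay of Fredholm determinants\<close>

lemma finite_bounded_exponents: "finite {u :: nat \<Rightarrow> nat. (\<forall>i\<ge>n. u i = 0) \<and> (\<Sum>i<n. u i) \<le> K}"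
proof (rule finite_subset)
  show "finite {u :: nat \<Rightarrow> nat. \<forall>i. (i \<in> {..<n} \<longrightarrow> u i \<in> {..K}) \<and> (i \<notin> {..<n} \<longrightarrow> u i = 0)}"
    by (intro finite_set_of_finite_funs) auto
  show "{u. (\<forall>i\<ge>n. u i = 0) \<and> (\<Sum>i<n. u i) \<le> K} \<subseteq>
      {u. \<forall>i. (i \<in> {..<n} \<longrightarrow> u i \<in> {..K}) \<and> (i \<notin> {..<n} \<longrightarrow> u i = 0)}"
  proof (intro subsetI CollectI allI conjI impI)
    fix u :: "nat \<Rightarrow> nat" and i assume u: "u \<in> {u. (\<forall>i\<ge>n. u i = 0) \<and> (\<Sum>i<n. u i) \<le> K}"
    show "u i = 0" if "i \<notin> {..<n}" using u that by auto
    show "u i \<in> {..K}" if "i \<in> {..<n}"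
      using u member_le_sum[of i "{..<n}" u] that by auto
  qed
qed

context p_place
begin

definition decays :: "rat \<Rightarrow> rat \<Rightarrow> complex fps \<Rightarrow> bool" where
  "decays B C f \<longleftrightarrow> (\<forall>i. V (B * of_nat i - C) (fps_nth f i))"

lemma decays_mult:
  assumes "decays B C f" "decays B C' g"
  shows "decays B (C + C') (f * g)"
  unfolding decays_def fps_mult_nth
proof (intro allI V_sum)
  fix n i :: nat assume "i \<in> {0..n}"
  hence "B * of_nat n - (C + C') = (B * of_nat i - C) + (B * of_nat (n - i) - C')"
    by (simp add: of_nat_diff algebra_simps)
  moreover have "V ((B * of_nat i - C) + (B * of_nat (n - i) - C')) (fps_nth f i * fps_nth g (n - i))"
    using assms by (intro V_mult) (auto simp: decays_def)
  ultimately show "V (B * of_nat n - (C + C')) (fps_nth f i * fps_nth g (n - i))" by (simp only:)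
qed

lemma decays_add: "decays B C f \<Longrightarrow> decays B C g \<Longrightarrow> decays B C (f + g)"
  by (simp add: decays_def V_add)

lemma decays_0: "decays B C 0"
  by (simp add: decays_def)

lemma decays_1: "decays B 0 1"
  by (auto simp: decays_def V_0)

lemma decays_sum: "(\<And>i. i \<in> I \<Longrightarrow> decays B C (f i)) \<Longrightarrow> decays B C (sum f I)"
  by (induction I rule: infinite_finite_induct) (auto intro: decays_add decays_0)

lemma decays_prod: "(\<And>i. i \<in> I \<Longrightarrow> decays B C (f i)) \<Longrightarrow> decays B (of_nat (card I) * C) (prod f I)"
proof (induction I rule: infinite_finite_induct)
  case (insert i I)
  hence "decays B (C + of_nat (card I) * C) (f i * prod f I)" by (intro decays_mult) auto
  thus ?case using insert.hyps by (simp add: algebra_simps)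
qed (auto simp: decays_1)

lemma decays_mono: "decays B C f \<Longrightarrow> C \<le> C' \<Longrightarrow> decays B C' f"
  by (auto simp: decays_def intro: V_mono)

lemma decays_const_mult:
  assumes "V (- s) x" "decays B C f"
  shows "decays B (C + s) (fps_const x * f)"
  unfolding decays_def
proof
  fix i
  have "V (- s + (B * of_nat i - C)) (x * fps_nth f i)"
    using assms by (intro V_mult) (auto simp: decays_def)
  thus "V (B * of_nat i - (C + s)) (fps_nth (fps_const x * f) i)" by (simp add: algebra_simps)
qed

lemma decays_newton:
  assumes "decays B C f"
  shows "decays B C (of_nat m * f - fps_X * fps_deriv f)"
  unfolding decays_def
proof
  fix i
  have X: "fps_nth (fps_X * fps_deriv f) i = of_nat i * fps_nth f i"
    by (cases i) (simp_all add: fps_X_mult_nth)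
  have m: "fps_nth (of_nat m * f) i = of_nat m * fps_nth f i"
    by (simp add: fps_of_nat[symmetric])
  have "V (B * of_nat i - C) (of_nat m * fps_nth f i - of_nat i * fps_nth f i)"
    using assms by (intro V_diff V_mult_R(2)) (auto simp: decays_def)
  thus "V (B * of_nat i - C) (fps_nth (of_nat m * f - fps_X * fps_deriv f) i)"
    by (simp only: fps_sub_nth X m)
qed

text \<open>The rows whose weight does not reach B. Their number depends on the slope \<gamma> but
  not on the degree bound of the term family, hence not on a truncation.\<close>

definition small_exponents :: "rat \<Rightarrow> nat \<Rightarrow> rat \<Rightarrow> (nat \<Rightarrow> nat) set" where
  "small_exponents B n \<gamma> = {u. (\<forall>i\<ge>n. u i = 0) \<and> \<gamma> * of_nat (p - 1) * of_nat (\<Sum>i<n. u i) < B}"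

lemma finite_small_exponents:
  assumes "\<gamma> > 0"
  shows "finite (small_exponents B n \<gamma>)"
proof -
  have pos: "\<gamma> * of_nat (p - 1) > 0" using assms p_gt_1 by simp
  obtain K :: nat where K: "B / (\<gamma> * of_nat (p - 1)) \<le> of_nat K" using real_arch_simple by blast
  have "small_exponents B n \<gamma> \<subseteq> {u. (\<forall>i\<ge>n. u i = 0) \<and> (\<Sum>i<n. u i) \<le> K}"
  proof
    fix u assume u: "u \<in> small_exponents B n \<gamma>"
    hence "of_nat (\<Sum>i<n. u i) * (\<gamma> * of_nat (p - 1)) < B"
      by (simp only: small_exponents_def mem_Collect_eq mult.commute)
    hence "of_nat (\<Sum>i<n. u i) < B / (\<gamma> * of_nat (p - 1))" using pos by (simp only: pos_less_divide_eq)
    also have "\<dots> \<le> of_nat K" by (rule K)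
    finally have "(\<Sum>i<n. u i) < K" by (simp only: of_nat_less_iff)
    thus "u \<in> {u. (\<forall>i\<ge>n. u i = 0) \<and> (\<Sum>i<n. u i) \<le> K}"
      using u by (simp add: small_exponents_def)
  qed
  thus ?thesis using finite_bounded_exponents finite_subset by blast
qed

text \<open>After scaling, row u has weight proportional to |u|. With weights capped at B, the total
  falls short of B N by at most B for each small exponent, so the coefficient of index i, which is
  the coefficient N - i of the characteristic polynomial, loses only a constant free of
  \<open>G\<close> and \<open>D\<close>.\<close>

lemma fredholm_determinant:
  assumes fam: "term_family G e n D p" and B: "B \<ge> 0" and \<gamma>: "\<gamma> > 0"
    and V: "\<And>g. g \<in> G \<Longrightarrow> V (\<gamma> * of_nat (\<Sum>i<n. e g i)) (c g)"
    and I: "I \<subseteq> {..<n}"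
  shows "\<exists>as. decays B (B * of_nat (card (small_exponents B n \<gamma>))) (rev_char as) \<and>
           (\<forall>k. (\<Sum>a\<leftarrow>as. a ^ k) \<in> R) \<and>
           (\<forall>k\<ge>1. (\<Sum>a\<leftarrow>as. a ^ k) = term_family.torus_sum G c e n p I k)"
proof -
  interpret term_family G c e n D p by (rule fam)
  define sz :: "(nat \<Rightarrow> nat) \<Rightarrow> rat" where "sz = (\<lambda>u. of_nat (\<Sum>i<n. u i))"
  \<comment> \<open>An entry with e + v = p u has valuation \<gamma>(p|u| - |v|); the scaling adds
    \<gamma>(|v| - |u|), which leaves \<gamma>(p - 1)|u|, constant along the row.\<close>
  define d where "d = (\<lambda>u. P (\<gamma> * sz u))"
  have "finite (box I)" using I finite_box finite_subset by blast
  then obtain us where us: "set us = box I" "distinct us" using finite_distinct_list by blast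
  define N where "N = length us"
  define A where "A = dwork_matrix d us"
  have A: "A \<in> carrier_mat N N" by (simp add: A_def N_def dwork_matrix_def)
  obtain as where as: "length as = N" "char_poly A = (\<Prod>a\<leftarrow>as. [:-a, 1:])"
    "\<And>k. mat_trace (A ^\<^sub>m k) = (\<Sum>a\<leftarrow>as. a ^ k)"
    using trace_powers_eigenvalues[OF A] by blast
  \<comment> \<open>The cap at B meets the requirement of \<open>V_coeff_char_poly\<close>.\<close>
  define w where "w = (\<lambda>i. min B (\<gamma> * of_nat (p - 1) * sz (us ! i)))"
  have cg: "c g \<in> R" if "g \<in> G" for g
    using \<gamma> by (intro V_in[OF V[OF that]] mult_nonneg_nonneg of_nat_0_le_iff) simp
  have entry: "V (w i) (A $$ (i, j))" if ij: "i < N" "j < N" for i j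
  proof -
    let ?u = "us ! i" and ?v = "us ! j"
    have "V (\<gamma> * (of_nat p * sz ?u - sz ?v)) (\<Sum>g\<in>G. if \<forall>i<n. e g i + ?v i = p * ?u i then c g else 0)"
    proof (intro V_sum)
      fix g assume g: "g \<in> G"
      show "V (\<gamma> * (of_nat p * sz ?u - sz ?v)) (if \<forall>i<n. e g i + ?v i = p * ?u i then c g else 0)"
      proof (cases "\<forall>i<n. e g i + ?v i = p * ?u i")
        case True
        hence "(\<Sum>i<n. e g i + ?v i) = (\<Sum>i<n. p * ?u i)" by (intro sum.cong) auto
        hence "(\<Sum>i<n. e g i) + (\<Sum>i<n. ?v i) = p * (\<Sum>i<n. ?u i)"
          by (simp only: sum.distrib sum_distrib_left)
        hence "of_nat (\<Sum>i<n. e g i) + sz ?v = of_nat p * sz ?u"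
          unfolding sz_def of_nat_add[symmetric] of_nat_mult[symmetric] by (rule arg_cong)
        hence "of_nat p * sz ?u - sz ?v = of_nat (\<Sum>i<n. e g i)" by linarith
        thus ?thesis unfolding if_P[OF True] using V[OF g] by (simp only:)
      next
        case False
        thus ?thesis unfolding if_not_P[OF False] by simp
      qed
    qed
    hence "V (\<gamma> * sz ?v + - (\<gamma> * sz ?u) + \<gamma> * (of_nat p * sz ?u - sz ?v))
        (d ?v * inverse (d ?u) * (\<Sum>g\<in>G. if \<forall>i<n. e g i + ?v i = p * ?u i then c g else 0))"
      unfolding d_def P_minus[symmetric] by (intro V_mult V_P)
    also have "d ?v * inverse (d ?u) * (\<Sum>g\<in>G. if \<forall>i<n. e g i + ?v i = p * ?u i then c g else 0) = A $$ (i, j)"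
      using ij by (simp add: A_def N_def dwork_matrix_def dwork_entry_def)
    also have "\<gamma> * sz ?v + - (\<gamma> * sz ?u) + \<gamma> * (of_nat p * sz ?u - sz ?v) = \<gamma> * of_nat (p - 1) * sz ?u"
      using p_gt_1 by (simp add: of_nat_diff algebra_simps)
    finally show ?thesis by (rule V_mono) (simp add: w_def)
  qed
  have coef_bound: "V ((\<Sum>i<N. w i) - B * of_nat l) (coeff (char_poly A) l)" for l
    by (rule V_coeff_char_poly[OF A]) (use entry in \<open>auto simp: w_def\<close>)
  let ?C = "B * of_nat (card (small_exponents B n \<gamma>))"
  have "decays B ?C (rev_char as)"
    unfolding decays_def
  proof
    fix i
    show "V (B * of_nat i - ?C) (fps_nth (rev_char as) i)"
    proof (cases "i \<le> N")
      case True
      have "B * of_nat N - (\<Sum>i<N. w i) = (\<Sum>i<N. B - w i)" by (simp add: sum_subtractf)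
      also have "\<dots> \<le> (\<Sum>i<N. if us ! i \<in> small_exponents B n \<gamma> then B else 0)"
      proof (intro sum_mono)
        fix i assume "i \<in> {..<N}"
        hence "us ! i \<in> box I" using us(1) nth_mem N_def by blast
        hence z: "\<forall>j\<ge>n. (us ! i) j = 0" using I by (auto simp: box_def)
        have "\<gamma> * of_nat (p - 1) * sz (us ! i) \<ge> 0"
          unfolding sz_def using \<gamma> by (intro mult_nonneg_nonneg of_nat_0_le_iff) simp
        thus "B - w i \<le> (if us ! i \<in> small_exponents B n \<gamma> then B else 0)"
          using z B by (auto simp: w_def small_exponents_def sz_def)
      qed
      also have "\<dots> = (\<Sum>u\<in>box I. if u \<in> small_exponents B n \<gamma> then B else 0)"
        unfolding N_def by (rule sum.reindex_bij_betw[OF bij_betw_nth[OF us(2) refl us(1)[symmetric]]])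
      also have "\<dots> = (\<Sum>u\<in>box I \<inter> small_exponents B n \<gamma>. B)"
        using \<open>finite (box I)\<close> by (rule sum.inter_restrict[symmetric])
      also have "\<dots> = of_nat (card (box I \<inter> small_exponents B n \<gamma>)) * B" by simp
      also have "\<dots> \<le> of_nat (card (small_exponents B n \<gamma>)) * B"
        using B finite_small_exponents[OF \<gamma>] by (intro mult_right_mono of_nat_mono card_mono) auto
      finally have "B * of_nat i - ?C \<le> (\<Sum>i<N. w i) - B * of_nat (N - i)"
        using True by (simp add: of_nat_diff algebra_simps)
      thus ?thesis
        using coef_bound[of "N - i"] True by (auto simp: rev_char_nth as intro: V_mono)
    qed (simp add: rev_char_nth as)
  qed
  moreover have tr: "(\<Sum>a\<leftarrow>as. a ^ k) = torus_sum I k" if "k \<ge> 1" for k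
    using dwork_trace_formula[OF I us _ that, of d] as(3)[of k] by (simp add: A_def d_def)
  moreover have "(\<Sum>a\<leftarrow>as. a ^ k) \<in> R" for k
  proof (cases "k = 0")
    case True
    have "(\<Sum>a\<leftarrow>as. a ^ 0) = of_nat (length as)" by (induction as) auto
    thus ?thesis using True by simp
  next
    case False
    have "coef gs \<in> R" if "set gs \<subseteq> G" for gs
      using that cg by (induction gs) (auto simp: coef_def intro: mult_in)
    hence "torus_sum I k \<in> R"
      unfolding torus_sum_def by (intro sum_in) (auto simp: words_def)
    thus ?thesis using tr[of k] False by simp
  qed
  ultimately show ?thesis by blast
qed

end

section \<open>Products of truncated splitting functions as term families\<close>

context dwork
begin

text \<open>A term of the product over \<open>K\<close> is a choice of a degree g m in each
  truncated factor.\<close>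

definition theta_coef :: "(nat \<Rightarrow> nat) set \<Rightarrow> ((nat \<Rightarrow> nat) \<Rightarrow> complex) \<Rightarrow> ((nat \<Rightarrow> nat) \<Rightarrow> nat) \<Rightarrow> complex" where
  "theta_coef K \<alpha> g = (\<Prod>m\<in>K. fps_nth \<Theta> (g m) * \<alpha> m ^ g m)"

definition theta_expo :: "(nat \<Rightarrow> nat) set \<Rightarrow> ((nat \<Rightarrow> nat) \<Rightarrow> nat) \<Rightarrow> nat \<Rightarrow> nat" where
  "theta_expo K g i = (\<Sum>m\<in>K. g m * m i)"

lemma theta_term_family:
  assumes "finite K"
  shows "term_family (K \<rightarrow>\<^sub>E {..J}) (theta_expo K) n (J * (\<Sum>m\<in>K. \<Sum>i<n. m i)) p"
proof
  show "finite (K \<rightarrow>\<^sub>E {..J})" using assms by (intro finite_PiE) auto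
  show "p \<ge> 2" using p_gt_1 by simp
  fix g i assume g: "g \<in> K \<rightarrow>\<^sub>E {..J}" and i: "i < n"
  have "theta_expo K g i \<le> (\<Sum>m\<in>K. J * (\<Sum>i<n. m i))"
    unfolding theta_expo_def
  proof (intro sum_mono mult_mono)
    fix m assume "m \<in> K"
    thus "g m \<le> J" using g by auto
    show "m i \<le> (\<Sum>i<n. m i)" using i by (intro member_le_sum) auto
  qed auto
  also have "\<dots> = J * (\<Sum>m\<in>K. \<Sum>i<n. m i) * 1" by (simp add: sum_distrib_left)
  also have "\<dots> \<le> J * (\<Sum>m\<in>K. \<Sum>i<n. m i) * (p - 1)"
    using p_gt_1 by (intro mult_left_mono) auto
  finally show "theta_expo K g i \<le> J * (\<Sum>m\<in>K. \<Sum>i<n. m i) * (p - 1)" .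
qed

lemma theta_eval:
  assumes "finite K"
  shows "term_family.eval (K \<rightarrow>\<^sub>E {..J}) (theta_coef K \<alpha>) (theta_expo K) n x =
           (\<Prod>m\<in>K. trunc_eval J \<Theta> (\<alpha> m * (\<Prod>i<n. x i ^ m i)))"
proof -
  interpret term_family "K \<rightarrow>\<^sub>E {..J}" "theta_coef K \<alpha>" "theta_expo K" n "J * (\<Sum>m\<in>K. \<Sum>i<n. m i)" p
    by (rule theta_term_family[OF assms])
  have "(\<Prod>m\<in>K. trunc_eval J \<Theta> (\<alpha> m * (\<Prod>i<n. x i ^ m i))) =
      (\<Sum>g\<in>K \<rightarrow>\<^sub>E {..J}. \<Prod>m\<in>K. fps_nth \<Theta> (g m) * (\<alpha> m * (\<Prod>i<n. x i ^ m i)) ^ g m)"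
    unfolding trunc_eval_def using assms by (intro prod_sum_PiE) auto
  also have "\<dots> = eval x"
    unfolding eval_def
  proof (intro sum.cong refl)
    fix g
    have "(\<Prod>m\<in>K. (\<Prod>i<n. x i ^ m i) ^ g m) = (\<Prod>m\<in>K. \<Prod>i<n. x i ^ (g m * m i))"
      by (intro prod.cong refl) (simp add: prod_power_distrib power_mult[symmetric] mult.commute)
    also have "\<dots> = (\<Prod>i<n. \<Prod>m\<in>K. x i ^ (g m * m i))" by (rule prod.swap)
    also have "\<dots> = (\<Prod>i<n. x i ^ theta_expo K g i)" by (simp add: theta_expo_def power_sum)
    finally show "(\<Prod>m\<in>K. fps_nth \<Theta> (g m) * (\<alpha> m * (\<Prod>i<n. x i ^ m i)) ^ g m) =
        theta_coef K \<alpha> g * (\<Prod>i<n. x i ^ theta_expo K g i)"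
      by (simp add: theta_coef_def prod.distrib power_mult_distrib mult.assoc)
  qed
  finally show ?thesis ..
qed

text \<open>Valuation per unit of degree: a choice g has valuation at least \<epsilon> times the sum
  of the g m, and degree at most the sum of the degrees in \<open>K\<close> times as much. The
  truncation level J does not enter; the summand 1 keeps the denominator positive.\<close>

definition slope :: "(nat \<Rightarrow> nat) set \<Rightarrow> nat \<Rightarrow> rat" where
  "slope K n = \<epsilon> / of_nat (1 + (\<Sum>m\<in>K. \<Sum>i<n. m i))"

lemma slope_pos: "slope K n > 0"
  unfolding slope_def using eps_pos by (intro divide_pos_pos) (auto simp del: of_nat_add of_nat_sum of_nat_Suc)

lemma theta_coef_V:
  assumes K: "finite K" and \<alpha>: "\<And>m. m \<in> K \<Longrightarrow> \<alpha> m \<in> R"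
  shows "V (slope K n * of_nat (\<Sum>i<n. theta_expo K g i)) (theta_coef K \<alpha> g)"
proof -
  let ?d = "1 + (\<Sum>m\<in>K. \<Sum>i<n. m i)"
  have "V (\<Sum>m\<in>K. \<epsilon> * of_nat (g m)) (theta_coef K \<alpha> g)"
    unfolding theta_coef_def using \<alpha> by (intro V_prod V_mult_R(1) theta_V power_in) auto
  moreover have "slope K n * of_nat (\<Sum>i<n. theta_expo K g i) \<le> (\<Sum>m\<in>K. \<epsilon> * of_nat (g m))"
  proof -
    have "(\<Sum>i<n. theta_expo K g i) = (\<Sum>m\<in>K. g m * (\<Sum>i<n. m i))"
      unfolding theta_expo_def sum_distrib_left by (rule sum.swap)
    also have "\<dots> \<le> (\<Sum>m\<in>K. g m * ?d)"
    proof (intro sum_mono mult_left_mono)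
      fix m assume "m \<in> K"
      hence "(\<Sum>i<n. m i) \<le> (\<Sum>m\<in>K. \<Sum>i<n. m i)" using K by (intro member_le_sum) auto
      thus "(\<Sum>i<n. m i) \<le> ?d" by simp
    qed auto
    also have "\<dots> = (\<Sum>m\<in>K. g m) * ?d" by (rule sum_distrib_right[symmetric])
    finally have "of_nat (\<Sum>i<n. theta_expo K g i) \<le> (of_nat ((\<Sum>m\<in>K. g m) * ?d) :: rat)"
      unfolding of_nat_le_iff .
    hence "slope K n * of_nat (\<Sum>i<n. theta_expo K g i) \<le> slope K n * of_nat ((\<Sum>m\<in>K. g m) * ?d)"
      using slope_pos by (intro mult_left_mono) (auto intro: less_imp_le)
    also have "\<dots> = (slope K n * of_nat ?d) * of_nat (\<Sum>m\<in>K. g m)"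
      by (simp only: of_nat_mult mult_ac)
    also have "slope K n * of_nat ?d = \<epsilon>"
    proof -
      have cancel: "\<epsilon> / x * x = \<epsilon>" if "x \<noteq> 0" for x using that by simp
      show ?thesis unfolding slope_def by (rule cancel) (unfold of_nat_eq_0_iff, simp)
    qed
    finally show ?thesis by (simp add: sum_distrib_left)
  qed
  ultimately show ?thesis by (rule V_mono)
qed

end

section \<open>Exponential sums as combinations of power sums\<close>

lemma bij_betw_PiE_compose:
  assumes f: "bij_betw f S T"
  shows "bij_betw (\<lambda>x. \<lambda>i\<in>A. f (x i)) (A \<rightarrow>\<^sub>E S) (A \<rightarrow>\<^sub>E T)"
proof (rule bij_betw_byWitness[where f' = "\<lambda>y. \<lambda>i\<in>A. inv_into S f (y i)"])
  have inv: "inv_into S f (f s) = s" if "s \<in> S" for s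
    using f that by (auto simp: bij_betw_def)
  have inv': "f (inv_into S f t) = t" "inv_into S f t \<in> S" if "t \<in> T" for t
    using f that by (auto simp: bij_betw_def f_inv_into_f inv_into_into)
  show "\<forall>x\<in>A \<rightarrow>\<^sub>E S. (\<lambda>i\<in>A. inv_into S f ((\<lambda>i\<in>A. f (x i)) i)) = x"
    using inv by (auto simp: fun_eq_iff PiE_iff extensional_def restrict_def)
  show "\<forall>y\<in>A \<rightarrow>\<^sub>E T. (\<lambda>i\<in>A. f ((\<lambda>i\<in>A. inv_into S f (y i)) i)) = y"
    using inv' by (auto simp: fun_eq_iff PiE_iff extensional_def restrict_def)
  show "(\<lambda>x. \<lambda>i\<in>A. f (x i)) ` (A \<rightarrow>\<^sub>E S) \<subseteq> A \<rightarrow>\<^sub>E T"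
    using f by (auto simp: bij_betw_def)
  show "(\<lambda>y. \<lambda>i\<in>A. inv_into S f (y i)) ` (A \<rightarrow>\<^sub>E T) \<subseteq> A \<rightarrow>\<^sub>E S"
    using inv'(2) by (intro image_subsetI) (simp add: PiE_iff)
qed

lemma of_nat_eq_alg_closure_iff:
  "(of_nat a :: 'p::prime_card mod_ring alg_closure) = of_nat b \<longleftrightarrow> [a = b] (mod CARD('p))"
  by (simp add: of_nat_eq_iff_cong_CHAR)

lemma of_nat_to_int_mod_ring:
  "(of_nat (nat (to_int_mod_ring z)) :: 'p::prime_card mod_ring alg_closure) = to_ac z"
proof -
  have "to_int_mod_ring z \<in> {0..<int CARD('p)}"
    unfolding range_to_int_mod_ring[symmetric] by simp
  hence nn: "to_int_mod_ring z \<ge> 0" by simp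
  have "(of_nat (nat (to_int_mod_ring z)) :: 'p mod_ring) = of_int (to_int_mod_ring z)"
    using nn by simp
  also have "\<dots> = z" by (simp add: of_int_of_int_mod_ring)
  finally show ?thesis by (metis to_ac_of_nat)
qed

definition trace_index :: "nat \<Rightarrow> 'p::prime_card mod_ring alg_closure \<Rightarrow> nat" where
  "trace_index k y = nat (to_int_mod_ring (GF_trace k y))"

lemma trace_index_less: "trace_index k (y :: 'p::prime_card mod_ring alg_closure) < CARD('p)"
proof -
  have "to_int_mod_ring (GF_trace k y) \<in> {0..<int CARD('p)}"
    unfolding range_to_int_mod_ring[symmetric] by simp
  thus ?thesis by (auto simp: trace_index_def nat_less_iff)
qed

lemma of_nat_trace_index:
  "y \<in> GF k \<Longrightarrow> of_nat (trace_index k y) = (\<Sum>i<k. y ^ (CARD('p) ^ i))"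
  for y :: "'p::prime_card mod_ring alg_closure"
  by (simp add: trace_index_def of_nat_to_int_mod_ring to_ac_GF_trace)

lemma GF_sum: "(\<And>i. i \<in> I \<Longrightarrow> f i \<in> GF k) \<Longrightarrow> sum f I \<in> GF k"
  for f :: "'i \<Rightarrow> 'p::prime_card mod_ring alg_closure"
  by (induction I rule: infinite_finite_induct) (auto intro: GF_add GF_0)

lemma GF_prod: "(\<And>i. i \<in> I \<Longrightarrow> f i \<in> GF k) \<Longrightarrow> prod f I \<in> GF k"
  for f :: "'i \<Rightarrow> 'p::prime_card mod_ring alg_closure"
  by (induction I rule: infinite_finite_induct) (auto intro: GF_mult GF_1)

lemma GF_power: "x \<in> GF k \<Longrightarrow> x ^ m \<in> GF k" for x :: "'p::prime_card mod_ring alg_closure"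
  by (induction m) (auto intro: GF_mult GF_1)

lemma trace_index_sum_cong:
  fixes f :: "'i \<Rightarrow> 'p::prime_card mod_ring alg_closure"
  assumes "\<And>i. i \<in> I \<Longrightarrow> f i \<in> GF k"
  shows "[(\<Sum>i\<in>I. trace_index k (f i)) = trace_index k (\<Sum>i\<in>I. f i)] (mod CARD('p))"
proof -
  have "(of_nat (\<Sum>i\<in>I. trace_index k (f i)) :: 'p mod_ring alg_closure) =
      (\<Sum>i\<in>I. \<Sum>j<k. f i ^ (CARD('p) ^ j))"
    using assms by (simp add: of_nat_trace_index)
  also have "\<dots> = (\<Sum>j<k. \<Sum>i\<in>I. f i ^ (CARD('p) ^ j))" by (rule sum.swap)
  also have "\<dots> = (\<Sum>j<k. (\<Sum>i\<in>I. f i) ^ (CARD('p) ^ j))"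
    using prime_card[where 'a = 'p]
    by (intro sum.cong refl) (subst freshmans_dream_sum', simp_all)
  also have "\<dots> = of_nat (trace_index k (\<Sum>i\<in>I. f i))"
    using assms by (simp add: of_nat_trace_index GF_sum)
  finally show ?thesis by (simp only: of_nat_eq_alg_closure_iff)
qed

lemma eval_ac_expand:
  assumes "f \<in> mpolys n"
  shows "eval_ac f x = (\<Sum>w\<in>Poly_Mapping.lookup ` Poly_Mapping.keys f.
           to_ac (Poly_Mapping.lookup f (Abs_poly_mapping w)) * (\<Prod>i<n. x i ^ w i))"
proof -
  have inj: "inj_on Poly_Mapping.lookup (Poly_Mapping.keys f)"
    by (simp add: inj_on_def poly_mapping_eqI)
  have "(\<Prod>i\<in>Poly_Mapping.keys m. x i ^ Poly_Mapping.lookup m i) = (\<Prod>i<n. x i ^ Poly_Mapping.lookup m i)"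
    if "m \<in> Poly_Mapping.keys f" for m
    using assms that by (intro prod.mono_neutral_left) (auto simp: mpolys_def in_keys_iff)
  thus ?thesis
    unfolding eval_ac_def sum.reindex[OF inj] by (simp add: lookup_inverse)
qed

section \<open>Teichmueller points and the additive character\<close>

locale gf_dwork = dwork R \<phi> p \<pi>
  for R :: "complex set" and \<phi> :: "complex \<Rightarrow> 'p::prime_card mod_ring alg_closure" and p \<pi> +
  assumes p_card: "p = CARD('p)"
begin

lemmas GF_def' = GF_def[where 'p = 'p, folded p_card]

lemma teichmueller_in:
  assumes "z ^ (p ^ k) = z" "k \<ge> 1"
  shows "z \<in> R"
proof (cases "z = 0")
  case False
  have q: "p ^ k > 1" using p_gt_1 assms(2) by (intro one_less_power) auto
  have "p ^ k = Suc (p ^ k - 1)" using q by simp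
  hence "z * z ^ (p ^ k - 1) = z" using assms(1) by (metis power_Suc)
  hence "z ^ (p ^ k - 1) = 1" using False by simp
  thus ?thesis using q by (intro root_in[where x = z and n = "p ^ k - 1"]) auto
qed simp

text \<open>The ratio z of two nonzero lifts of one residue is a root of unity of order dividing p^k
  - 1 that reduces to 1. If z were not 1, the geometric sum of its powers would be 0, yet it reduces
  to p^k - 1 = -1.\<close>

lemma teichmueller_inj:
  assumes "k \<ge> 1" "x ^ (p ^ k) = x" "y ^ (p ^ k) = y" "\<phi> x = \<phi> y"
  shows "x = y"
proof (rule ccontr)
  assume "x \<noteq> y"
  have q: "p ^ k > 1" using p_gt_1 assms(1) by (intro one_less_power) auto
  note inR = teichmueller_in[OF assms(2,1)] teichmueller_in[OF assms(3,1)]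
  have rt: "z ^ (p ^ k - 1) = 1" if "z ^ (p ^ k) = z" "z \<noteq> 0" for z :: complex
  proof -
    have "p ^ k = Suc (p ^ k - 1)" using q by simp
    hence "z * z ^ (p ^ k - 1) = z" using that(1) by (metis power_Suc)
    thus ?thesis using that(2) by simp
  qed
  have nz: "\<phi> z \<noteq> 0" if "z ^ (p ^ k) = z" "z \<noteq> 0" for z
  proof
    assume "\<phi> z = 0"
    moreover have "\<phi> z ^ (p ^ k - 1) = 1"
      using rt[OF that] teichmueller_in[OF that(1) assms(1)] by (metis hom_power hom_one)
    ultimately show False using q by (simp add: power_0_left)
  qed
  have xy: "x \<noteq> 0" "y \<noteq> 0" using nz[OF assms(2)] nz[OF assms(3)] assms(4) \<open>x \<noteq> y\<close> by auto
  define z where "z = x * inverse y"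
  have iy: "inverse y \<in> R" using inR nz[OF assms(3)] xy by (intro inverse_in) auto
  have z_in: "z \<in> R" using inR iy by (simp add: z_def mult_in)
  have "\<phi> z = \<phi> y * \<phi> (inverse y)" using inR iy assms(4) by (simp add: z_def hom_mult)
  also have "\<dots> = \<phi> (y * inverse y)" using inR iy by (simp add: hom_mult)
  finally have z1: "\<phi> z = 1" using xy by simp
  have "z ^ (p ^ k - 1) = 1"
    using rt assms xy by (simp add: z_def power_mult_distrib power_inverse)
  moreover have "z \<noteq> 1" using \<open>x \<noteq> y\<close> xy by (auto simp: z_def field_simps)
  ultimately have "(\<Sum>j<p ^ k - 1. z ^ j) = 0" by (simp add: geometric_sum)
  hence "\<phi> (\<Sum>j<p ^ k - 1. z ^ j) = 0" by simp
  hence "(of_nat (p ^ k - 1) :: 'p mod_ring alg_closure) = 0"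
    using z_in z1 by (simp add: hom_sum power_in hom_power)
  hence "(of_nat (p ^ k - 1) :: 'p mod_ring alg_closure) + 1 = 1" by simp
  moreover have "p ^ k = p ^ k - 1 + 1" using q by simp
  ultimately have "(of_nat (p ^ k) :: 'p mod_ring alg_closure) = 1"
    by (metis of_nat_add of_nat_1)
  moreover have "(of_nat (p ^ k) :: 'p mod_ring alg_closure) = 0"
    using assms(1) by (simp add: of_nat_p power_0_left)
  ultimately show False by simp
qed

text \<open>Injectivity together with equal cardinalities p^k; no lifting argument of Hensel type is
  used.\<close>

lemma teichmueller_bij:
  assumes k: "k \<ge> 1"
  shows "bij_betw \<phi> {z. z ^ p ^ k = z} (GF k)"
proof -
  let ?T = "{z::complex. z ^ p ^ k = z}"
  have q: "p ^ k > 1" using p_gt_1 k by (intro one_less_power) auto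
  have inj: "inj_on \<phi> ?T" using teichmueller_inj[OF k] by (auto simp: inj_on_def)
  have sub: "\<phi> ` ?T \<subseteq> GF k"
  proof (rule image_subsetI)
    fix z assume z: "z \<in> ?T"
    hence "z \<in> R" using teichmueller_in[of z k] k by simp
    hence "\<phi> z ^ p ^ k = \<phi> (z ^ p ^ k)" by (simp add: hom_power)
    thus "\<phi> z \<in> GF k" using z by (simp add: GF_def')
  qed
  have "card ?T = p ^ k"
  proof -
    have fin: "finite {z::complex. z ^ (p ^ k - 1) = 1}" using q by (intro finite_roots_unity) auto
    have "p ^ k = Suc (p ^ k - 1)" using q by simp
    hence "z ^ p ^ k = z * z ^ (p ^ k - 1)" for z :: complex by (metis power_Suc)
    hence eq: "?T = insert 0 {z. z ^ (p ^ k - 1) = 1}" by (auto simp: mult_cancel_left2)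
    have "(0::complex) \<notin> {z. z ^ (p ^ k - 1) = 1}" using q by (simp add: power_0_left)
    thus ?thesis unfolding eq using fin q by (simp add: card_roots_unity_eq)
  qed
  hence "card (\<phi> ` ?T) = p ^ k" using inj by (simp add: card_image)
  moreover have "card (GF k :: 'p mod_ring alg_closure set) = p ^ k" unfolding p_card using k by (intro card_GF) simp
  moreover from this have "finite (GF k :: 'p mod_ring alg_closure set)"
    using p_gt_1 by (intro card_ge_0_finite) simp
  ultimately have "\<phi> ` ?T = GF k" using sub by (intro card_subset_eq) auto
  thus ?thesis using inj by (simp add: bij_betw_def)
qed

definition teichmueller :: "'p mod_ring \<Rightarrow> complex" where
  "teichmueller a = (SOME z. z ^ p = z \<and> \<phi> z = to_ac a)"

lemma teichmueller:
  "teichmueller a ^ p = teichmueller a" "\<phi> (teichmueller a) = to_ac a" "teichmueller a \<in> R"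
proof -
  have "to_ac a \<in> \<phi> ` {z. z ^ p ^ 1 = z}"
    using teichmueller_bij[of 1] to_ac_in_GF[of a 1] by (simp add: bij_betw_def)
  hence "\<exists>z. z ^ p = z \<and> \<phi> z = to_ac a" by auto
  from someI_ex[OF this] show 1: "teichmueller a ^ p = teichmueller a" "\<phi> (teichmueller a) = to_ac a"
    by (simp_all add: teichmueller_def)
  show "teichmueller a \<in> R" using 1 by (intro teichmueller_in[of _ 1]) auto
qed

lemma teichmueller_power: "teichmueller a ^ p ^ j = teichmueller a"
  by (induction j) (simp_all add: power_mult teichmueller)

definition twisted_sum :: "complex \<Rightarrow> nat \<Rightarrow> 'p mod_ring mpoly \<Rightarrow> nat \<Rightarrow> nat \<Rightarrow> complex" where
  "twisted_sum \<xi> n f b k = (\<Sum>x\<in>{..<n} \<rightarrow>\<^sub>E GF k. \<xi> ^ (b * trace_index k (eval_ac f x)))"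

text \<open>One choice for all J, k and twists. It need not be the \<zeta> of the exponential sum,
  as only the integers \<open>trace_count\<close> are extracted from it.\<close>

definition splitting_root :: complex where
  "splitting_root = (SOME \<xi>. \<xi> ^ p = 1 \<and> \<xi> \<noteq> 1 \<and> (\<forall>J k x t. of_nat p * (\<kappa> + \<epsilon>) \<le> \<epsilon> * of_nat J \<longrightarrow>
     x \<in> R \<longrightarrow> x ^ (p ^ k) = x \<longrightarrow> of_nat t = (\<Sum>i<k. \<phi> x ^ p ^ i) \<longrightarrow>
     V (\<epsilon> * of_nat J / of_nat p) ((\<Prod>i<k. trunc_eval J \<Theta> (x ^ p ^ i)) - \<xi> ^ t)))"

lemma splitting_root: "splitting_root ^ p = 1" "splitting_root \<noteq> 1"
  and splitting_root_V: "of_nat p * (\<kappa> + \<epsilon>) \<le> \<epsilon> * of_nat J \<Longrightarrow> x \<in> R \<Longrightarrow> x ^ (p ^ k) = x \<Longrightarrow>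
    of_nat t = (\<Sum>i<k. \<phi> x ^ p ^ i) \<Longrightarrow>
    V (\<epsilon> * of_nat J / of_nat p) ((\<Prod>i<k. trunc_eval J \<Theta> (x ^ p ^ i)) - splitting_root ^ t)"
  using someI_ex[OF splitting] unfolding splitting_root_def[symmetric] by blast+

lemma splitting_root_power_cong:
  assumes "[a = b] (mod p)"
  shows "splitting_root ^ a = splitting_root ^ b"
proof -
  have "splitting_root ^ a = splitting_root ^ (a mod p)" for a
  proof -
    have "splitting_root ^ a = splitting_root ^ (p * (a div p) + a mod p)" by simp
    also have "\<dots> = splitting_root ^ (a mod p)"
      by (simp only: power_add power_mult splitting_root(1) power_one mult_1_left)
    finally show ?thesis .
  qed
  thus ?thesis using assms by (metis cong_def)
qed

context
  fixes f :: "'p mod_ring mpoly" and n :: nat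
  assumes f: "f \<in> mpolys n"
begin

definition supp :: "(nat \<Rightarrow> nat) set" where
  "supp = Poly_Mapping.lookup ` Poly_Mapping.keys f"

definition lift_coef :: "nat \<Rightarrow> (nat \<Rightarrow> nat) \<Rightarrow> complex" where
  "lift_coef b w = teichmueller (of_nat b * Poly_Mapping.lookup f (Abs_poly_mapping w))"

lemma finite_supp: "finite supp"
  by (simp add: supp_def)

text \<open>Each monomial of b f, with Teichmueller coefficient and argument, is again a
  Teichmueller point, so \<open>splitting_root_V\<close> applies to it. Additivity of the trace
  multiplies the characters of the monomials into that of f(x).\<close>

lemma theta_near_character:
  assumes k: "k \<ge> 1" and J: "of_nat p * (\<kappa> + \<epsilon>) \<le> \<epsilon> * of_nat J"
    and x: "x \<in> {..<n} \<rightarrow>\<^sub>E {z. z ^ p ^ k = z}"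
  shows "V (\<epsilon> * of_nat J / of_nat p)
    ((\<Prod>j<k. \<Prod>w\<in>supp. trunc_eval J \<Theta> (lift_coef b w * (\<Prod>i<n. (x i ^ p ^ j) ^ w i)))
      - splitting_root ^ (b * trace_index k (eval_ac f (\<lambda>i\<in>{..<n}. \<phi> (x i)))))"
proof -
  define a where "a = (\<lambda>w. Poly_Mapping.lookup f (Abs_poly_mapping w))"
  define y where "y = (\<lambda>i\<in>{..<n}. \<phi> (x i))"
  define z where "z = (\<lambda>w. lift_coef b w * (\<Prod>i<n. x i ^ w i))"
  define T where "T = (\<lambda>w. to_ac (a w) * (\<Prod>i<n. y i ^ w i))"
  have xi: "x i \<in> R" "x i ^ p ^ k = x i" if "i < n" for i
    using x that teichmueller_in[of "x i" k] k by auto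
  have y: "y i \<in> GF k" if "i < n" for i
    using teichmueller_bij[OF k] x that by (auto simp: y_def bij_betw_def)
  have T: "T w \<in> GF k" for w
    unfolding T_def by (intro GF_mult to_ac_in_GF GF_prod GF_power y) simp
  have z_in: "z w \<in> R" for w
    unfolding z_def lift_coef_def using xi by (intro mult_in prod_in power_in teichmueller) auto
  have zp: "z w ^ p ^ j = lift_coef b w * (\<Prod>i<n. (x i ^ p ^ j) ^ w i)" for w j
  proof -
    have "(x i ^ w i) ^ p ^ j = (x i ^ p ^ j) ^ w i" for i
      by (simp only: power_mult[symmetric] mult.commute)
    thus ?thesis
      by (simp add: z_def power_mult_distrib prod_power_distrib lift_coef_def teichmueller_power)
  qed
  have zq: "z w ^ p ^ k = z w" for w
    unfolding zp using xi(2) by (simp add: z_def)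
  have hz: "\<phi> (z w) = of_nat b * T w" for w
  proof -
    have "\<phi> (z w) = \<phi> (lift_coef b w) * (\<Prod>i<n. \<phi> (x i) ^ w i)"
    proof -
      have in_R: "x i ^ w i \<in> R" if "i \<in> {..<n}" for i using that xi(1) by (intro power_in) simp
      have "\<phi> (z w) = \<phi> (lift_coef b w) * \<phi> (\<Prod>i<n. x i ^ w i)"
        unfolding z_def by (rule hom_mult) (auto simp: lift_coef_def teichmueller intro!: prod_in in_R)
      also have "\<phi> (\<Prod>i<n. x i ^ w i) = (\<Prod>i<n. \<phi> (x i ^ w i))" by (rule hom_prod[OF in_R])
      also have "\<dots> = (\<Prod>i<n. \<phi> (x i) ^ w i)" using xi(1) by (intro prod.cong) (auto simp: hom_power)
      finally show ?thesis .
    qed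
    thus ?thesis by (simp add: T_def y_def a_def lift_coef_def teichmueller)
  qed
  have bp: "(of_nat b :: 'p mod_ring alg_closure) ^ p ^ j = of_nat b" for j
    using to_ac_in_GF[of "of_nat b :: 'p mod_ring" j] by (simp add: GF_def')
  have t: "of_nat (b * trace_index k (T w)) = (\<Sum>i<k. \<phi> (z w) ^ p ^ i)" for w
    by (simp add: hz power_mult_distrib bp of_nat_trace_index[OF T, folded p_card] sum_distrib_left)
  let ?s = "\<epsilon> * of_nat J / of_nat p"
  have s0: "?s \<ge> 0" using eps_pos by simp
  have "V ?s ((\<Prod>w\<in>supp. \<Prod>j<k. trunc_eval J \<Theta> (z w ^ p ^ j))
      - (\<Prod>w\<in>supp. splitting_root ^ (b * trace_index k (T w))))"
  proof (rule V_prod_cong)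
    fix w
    show "(\<Prod>j<k. trunc_eval J \<Theta> (z w ^ p ^ j)) \<in> R"
      by (intro prod_in trunc_eval_in overconvergent_theta power_in z_in)
    have "splitting_root \<in> R"
      using splitting_root(1) p_gt_1 by (intro root_in[where x = splitting_root and n = p]) auto
    thus "splitting_root ^ (b * trace_index k (T w)) \<in> R" by (rule power_in)
    show "V ?s ((\<Prod>j<k. trunc_eval J \<Theta> (z w ^ p ^ j)) - splitting_root ^ (b * trace_index k (T w)))"
      by (intro splitting_root_V J z_in zq t)
  qed
  also have "(\<Prod>w\<in>supp. \<Prod>j<k. trunc_eval J \<Theta> (z w ^ p ^ j)) =
      (\<Prod>j<k. \<Prod>w\<in>supp. trunc_eval J \<Theta> (lift_coef b w * (\<Prod>i<n. (x i ^ p ^ j) ^ w i)))"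
    unfolding zp by (rule prod.swap)
  also have "(\<Prod>w\<in>supp. splitting_root ^ (b * trace_index k (T w))) =
      splitting_root ^ (b * (\<Sum>w\<in>supp. trace_index k (T w)))"
    by (simp add: sum_distrib_left power_sum)
  also have "\<dots> = splitting_root ^ (b * trace_index k (\<Sum>w\<in>supp. T w))"
    by (intro splitting_root_power_cong cong_scalar_left trace_index_sum_cong[of supp T k, folded p_card] T)
  also have "(\<Sum>w\<in>supp. T w) = eval_ac f y"
    by (simp add: eval_ac_expand[OF f] T_def supp_def a_def)
  finally show ?thesis unfolding y_def .
qed

text \<open>The precision M determines the truncation J and so the length of the lists
  \<open>as\<close>; the decay constant is the same for all M.\<close>

lemma twisted_sum_approximation:
  assumes B: "B \<ge> 0"
  shows "\<exists>as. (\<forall>I\<in>Pow {..<n}. decays B (B * of_nat (card (small_exponents B n (slope supp n)))) (rev_char (as I)) \<and>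
             (\<forall>k. (\<Sum>a\<leftarrow>as I. a ^ k) \<in> R)) \<and>
           (\<forall>k\<ge>1. V M (twisted_sum splitting_root n f b k -
             (\<Sum>I\<in>Pow {..<n}. of_nat (p ^ k - 1) ^ card I * (\<Sum>a\<leftarrow>as I. a ^ k))))"
proof -
  obtain J where J: "max (of_nat p * (\<kappa> + \<epsilon>)) (of_nat p * M) \<le> \<epsilon> * of_nat J"
    using large_J_exists by blast
  hence J1: "of_nat p * (\<kappa> + \<epsilon>) \<le> \<epsilon> * of_nat J" and J2: "of_nat p * M \<le> \<epsilon> * of_nat J" by auto
  have "(of_nat p :: rat) > 0" using p_gt_1 by simp
  hence M: "M \<le> \<epsilon> * of_nat J / of_nat p" using J2 by (simp add: pos_le_divide_eq mult.commute)
  let ?\<alpha> = "lift_coef b"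
  have \<alpha>: "?\<alpha> w \<in> R" for w by (simp add: lift_coef_def teichmueller)
  interpret tf: term_family "supp \<rightarrow>\<^sub>E {..J}" "theta_coef supp ?\<alpha>" "theta_expo supp" n
    "J * (\<Sum>m\<in>supp. \<Sum>i<n. m i)" p
    by (rule theta_term_family[OF finite_supp])
  have "\<exists>as. decays B (B * of_nat (card (small_exponents B n (slope supp n)))) (rev_char as) \<and>
      (\<forall>k. (\<Sum>a\<leftarrow>as. a ^ k) \<in> R) \<and> (\<forall>k\<ge>1. (\<Sum>a\<leftarrow>as. a ^ k) = tf.torus_sum I k)"
    if "I \<in> Pow {..<n}" for I
    using that
    by (intro fredholm_determinant[OF theta_term_family[OF finite_supp] B slope_pos]
          theta_coef_V[OF finite_supp \<alpha>]) simp
  then obtain as where as: "\<And>I. I \<in> Pow {..<n} \<Longrightarrow>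
      decays B (B * of_nat (card (small_exponents B n (slope supp n)))) (rev_char (as I)) \<and>
      (\<forall>k. (\<Sum>a\<leftarrow>as I. a ^ k) \<in> R) \<and> (\<forall>k\<ge>1. (\<Sum>a\<leftarrow>as I. a ^ k) = tf.torus_sum I k)"
    by metis
  have "V M (twisted_sum splitting_root n f b k -
      (\<Sum>I\<in>Pow {..<n}. of_nat (p ^ k - 1) ^ card I * (\<Sum>a\<leftarrow>as I. a ^ k)))" if k: "k \<ge> 1" for k
  proof -
    have "(\<Sum>I\<in>Pow {..<n}. of_nat (p ^ k - 1) ^ card I * (\<Sum>a\<leftarrow>as I. a ^ k)) =
        (\<Sum>I\<in>Pow {..<n}. of_nat (p ^ k - 1) ^ card I * tf.torus_sum I k)"
      using as k by (intro sum.cong refl) auto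
    also have "\<dots> = (\<Sum>x\<in>{..<n} \<rightarrow>\<^sub>E {z. z ^ p ^ k = z}. \<Prod>j<k. tf.eval (\<lambda>i. x i ^ p ^ j))"
      using tf.eval_sum_teichmueller[OF k] by simp
    also have "\<dots> = (\<Sum>x\<in>{..<n} \<rightarrow>\<^sub>E {z. z ^ p ^ k = z}. \<Prod>j<k. \<Prod>w\<in>supp.
        trunc_eval J \<Theta> (lift_coef b w * (\<Prod>i<n. (x i ^ p ^ j) ^ w i)))"
      unfolding theta_eval[OF finite_supp] ..
    finally have eq: "(\<Sum>I\<in>Pow {..<n}. of_nat (p ^ k - 1) ^ card I * (\<Sum>a\<leftarrow>as I. a ^ k)) = \<dots>" .
    have S: "twisted_sum splitting_root n f b k = (\<Sum>x\<in>{..<n} \<rightarrow>\<^sub>E {z. z ^ p ^ k = z}.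
        splitting_root ^ (b * trace_index k (eval_ac f (\<lambda>i\<in>{..<n}. \<phi> (x i)))))"
      unfolding twisted_sum_def
      by (rule sum.reindex_bij_betw[OF bij_betw_PiE_compose[OF teichmueller_bij[OF k]], symmetric])
    have "V (\<epsilon> * of_nat J / of_nat p) ((\<Sum>x\<in>{..<n} \<rightarrow>\<^sub>E {z. z ^ p ^ k = z}. \<Prod>j<k. \<Prod>w\<in>supp.
        trunc_eval J \<Theta> (lift_coef b w * (\<Prod>i<n. (x i ^ p ^ j) ^ w i))) - twisted_sum splitting_root n f b k)"
      unfolding S sum_subtractf[symmetric] by (intro V_sum theta_near_character k J1)
    hence "V M (twisted_sum splitting_root n f b k - (\<Sum>x\<in>{..<n} \<rightarrow>\<^sub>E {z. z ^ p ^ k = z}. \<Prod>j<k. \<Prod>w\<in>supp.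
        trunc_eval J \<Theta> (lift_coef b w * (\<Prod>i<n. (x i ^ p ^ j) ^ w i))))"
      using M by (subst V_minus_commute) (rule V_mono)
    thus ?thesis unfolding eq .
  qed
  thus ?thesis using as by (intro exI[of _ as] conjI ballI allI impI) simp_all
qed

end

end

section \<open>Vanishing of Hankel determinants\<close>

context p_place
begin

lemma V_det:
  assumes A: "A \<in> carrier_mat m m" and V: "\<And>i j. i < m \<Longrightarrow> j < m \<Longrightarrow> V (w j) (A $$ (i, j))"
  shows "V (\<Sum>j<m. w j) (det A)"
  unfolding det_def'[OF A]
proof (rule V_sum)
  fix \<sigma> assume "\<sigma> \<in> {\<sigma>. \<sigma> permutes {0..<m}}"
  hence \<sigma>: "\<sigma> permutes {0..<m}" by simp
  have "V (\<Sum>i = 0..<m. w (\<sigma> i)) (\<Prod>i = 0..<m. A $$ (i, \<sigma> i))"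
    using permutes_in_image[OF \<sigma>] by (intro V_prod V) auto
  moreover have "(\<Sum>i = 0..<m. w (\<sigma> i)) = (\<Sum>j<m. w j)"
    using sum.permute[OF \<sigma>, of w] by (simp add: atLeast0LessThan)
  ultimately show "V (\<Sum>j<m. w j) (signof \<sigma> * (\<Prod>i = 0..<m. A $$ (i, \<sigma> i)))"
    by (intro V_mult_R(2)) (auto simp: sign_def intro: one_in diff_in zero_in simp flip: diff_0)
qed

text \<open>Along any permutation the numbers i + \<sigma> i + 1 add up to m^2; the m! terms of the
  expansion cost at most another p^(m^2).\<close>

lemma hankel_det_bound:
  fixes b :: "nat \<Rightarrow> int"
  assumes b: "\<And>k. \<bar>b k\<bar> \<le> int p ^ (n * (k + 1))"
  shows "\<bar>det (hankel b m)\<bar> \<le> int p ^ ((n + 1) * m ^ 2)"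
proof -
  have A: "hankel b m \<in> carrier_mat m m" by (simp add: hankel_def)
  have "\<bar>det (hankel b m)\<bar> \<le>
      (\<Sum>\<sigma> | \<sigma> permutes {0..<m}. \<bar>signof \<sigma> * (\<Prod>i = 0..<m. hankel b m $$ (i, \<sigma> i))\<bar>)"
    unfolding det_def'[OF A] by (rule sum_abs)
  also have "\<dots> \<le> (\<Sum>\<sigma> | \<sigma> permutes {0..<m}. int p ^ (n * m ^ 2))"
  proof (rule sum_mono)
    fix \<sigma> assume "\<sigma> \<in> {\<sigma>. \<sigma> permutes {0..<m}}"
    hence \<sigma>: "\<sigma> permutes {0..<m}" by simp
    have s: "\<bar>signof \<sigma> :: int\<bar> = 1" by (simp add: sign_def)
    have "\<bar>\<Prod>i = 0..<m. hankel b m $$ (i, \<sigma> i)\<bar> = (\<Prod>i = 0..<m. \<bar>hankel b m $$ (i, \<sigma> i)\<bar>)"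
      by (rule abs_prod)
    also have "\<dots> \<le> (\<Prod>i = 0..<m. int p ^ (n * (i + \<sigma> i + 1)))"
      using permutes_in_image[OF \<sigma>] b by (intro prod_mono) (auto simp: hankel_def)
    also have "\<dots> = int p ^ (\<Sum>i = 0..<m. n * (i + \<sigma> i + 1))" by (simp only: power_sum)
    also have "(\<Sum>i = 0..<m. n * (i + \<sigma> i + 1)) = n * (\<Sum>i = 0..<m. i + i + 1)"
      using sum.permute[OF \<sigma>, of "\<lambda>i. i"]
      unfolding sum_distrib_left[symmetric] sum.distrib by (simp add: comp_def)
    also have "(\<Sum>i = 0..<m. i + i + 1) = m ^ 2"
      by (induction m) (simp_all add: power2_eq_square)
    finally show "\<bar>signof \<sigma> * (\<Prod>i = 0..<m. hankel b m $$ (i, \<sigma> i))\<bar> \<le> int p ^ (n * m ^ 2)"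
      by (simp only: abs_mult s mult_1_left)
  qed
  also have "\<dots> = fact m * int p ^ (n * m ^ 2)"
    using card_permutations[of "{0..<m}" m] by simp
  also have "\<dots> \<le> int p ^ (m ^ 2) * int p ^ (n * m ^ 2)"
  proof (rule mult_right_mono)
    have "m < 2 ^ m" by (rule less_exp)
    also have "\<dots> \<le> p ^ m" using p_gt_1 by (intro power_mono) auto
    finally have "m ^ m \<le> (p ^ m) ^ m" by (intro power_mono) auto
    hence "fact m \<le> (p ^ m) ^ m" using fact_le_power[of m, where 'a = nat] by simp
    hence "int (fact m) \<le> int ((p ^ m) ^ m)" by (simp only: of_nat_le_iff)
    thus "fact m \<le> int p ^ (m ^ 2)" by (simp add: power2_eq_square power_mult)
  qed simp
  also have "\<dots> = int p ^ ((n + 1) * m ^ 2)" by (simp add: power_add[symmetric] algebra_simps)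
  finally show ?thesis .
qed

text \<open>
  Multiplying the Hankel matrix by a unipotent matrix built from \<open>Q\<close> turns its \<open>j\<close>-th column into
  coefficients of \<open>Q * h\<close> of index at least \<open>j\<close>. The determinant is then divisible by a power of
  \<open>p\<close> exceeding its archimedean size.
\<close>

lemma hankel_det_eq_0:
  fixes b :: "nat \<Rightarrow> int" and n :: nat
  defines "B \<equiv> 2 * (of_nat n + 2) :: rat"
  assumes bound: "\<And>k. \<bar>b k\<bar> \<le> int p ^ (n * (k + 1))"
    and C: "C \<ge> 0"
    and approx: "\<And>M. \<exists>Q h. fps_nth Q 0 = 1 \<and> decays B C Q \<and> decays B C (Q * h) \<and>
                   (\<forall>k. V M (of_int (b k) - fps_nth h (k + 1)))"
    and m: "of_nat m > of_nat n + 2 + 2 * C"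
  shows "det (hankel b m) = 0"
proof (rule ccontr)
  assume nz: "det (hankel b m) \<noteq> 0"
  have B: "B \<ge> 0" by (simp add: B_def)
  \<comment> \<open>Precision B m is enough, since column j asks for at most B j and j < m.\<close>
  obtain Q h where Q0: "fps_nth Q 0 = 1" and Q: "decays B C Q" and Qh: "decays B C (Q * h)"
    and h: "\<And>k. V (B * of_nat m) (of_int (b k) - fps_nth h (k + 1))"
    using approx by meson
  \<comment> \<open>Coefficients of positive index are close to integers; the one of index 0
    approximates no integer and is bounded through \<open>Q * h\<close>, as Q starts with 1.\<close>
  have h_V: "V (- C) (fps_nth h k)" for k
  proof (cases k)
    case 0
    have "V (B * of_nat 0 - C) (fps_nth (Q * h) 0)" using Qh by (simp only: decays_def)
    thus ?thesis using Q0 0 by simp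
  next
    case (Suc l)
    have "of_int (b l) - fps_nth h (l + 1) \<in> R" using V_in[OF h[of l]] B by simp
    hence "of_int (b l) - (of_int (b l) - fps_nth h (l + 1)) \<in> R" by (rule diff_in[OF of_int_in])
    also have "of_int (b l) - (of_int (b l) - fps_nth h (l + 1)) = fps_nth h k" by (simp add: Suc)
    finally have "V 0 (fps_nth h k)" by (simp add: V_0)
    thus ?thesis by (rule V_mono) (use C in simp)
  qed
  define H :: "complex mat" where "H = mat m m (\<lambda>(i, j). of_int (b (i + j)))"
  define T :: "complex mat" where "T = mat m m (\<lambda>(l, j). if l \<le> j then fps_nth Q (j - l) else 0)"
  have H: "H \<in> carrier_mat m m" and T: "T \<in> carrier_mat m m" by (simp_all add: H_def T_def)
  have entry: "V (B * of_nat j - 2 * C) ((H * T) $$ (r, j))" if "r < m" "j < m" for r j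
  proof -
    have "(H * T) $$ (r, j) = (\<Sum>l = 0..<m. of_int (b (r + l)) * (if l \<le> j then fps_nth Q (j - l) else 0))"
      using that by (simp add: H_def T_def scalar_prod_def)
    also have "\<dots> = (\<Sum>l = 0..j. of_int (b (r + l)) * fps_nth Q (j - l))"
      using that by (intro sum.mono_neutral_cong_right) auto
    also have "\<dots> = (\<Sum>i = 0..j. of_int (b (r + (j - i))) * fps_nth Q i)"
      by (rule sum.reindex_bij_witness[of _ "\<lambda>i. j - i" "\<lambda>i. j - i"]) auto
    finally have e1: "(H * T) $$ (r, j) = (\<Sum>i = 0..j. of_int (b (r + (j - i))) * fps_nth Q i)" .
    have "V (B * of_nat j - 2 * C) (\<Sum>i = 0..j. (of_int (b (r + (j - i))) - fps_nth h (r + (j - i) + 1)) * fps_nth Q i)"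
    proof (rule V_sum)
      fix i assume "i \<in> {0..j}"
      have "V (B * of_nat m + (B * of_nat i - C))
          ((of_int (b (r + (j - i))) - fps_nth h (r + (j - i) + 1)) * fps_nth Q i)"
        using h Q by (intro V_mult) (auto simp: decays_def)
      moreover have "B * of_nat j \<le> B * of_nat m" using that B by (intro mult_left_mono) auto
      moreover have "0 \<le> B * of_nat i" using B by simp
      ultimately show "V (B * of_nat j - 2 * C)
          ((of_int (b (r + (j - i))) - fps_nth h (r + (j - i) + 1)) * fps_nth Q i)"
        using C by (elim V_mono) linarith
    qed
    hence v1: "V (B * of_nat j - 2 * C) ((H * T) $$ (r, j) - (\<Sum>i = 0..j. fps_nth h (r + (j - i) + 1) * fps_nth Q i))"
      by (simp add: e1 sum_subtractf left_diff_distrib)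
    \<comment> \<open>The terms up to j of the convolution are the matrix entry; the later ones
      contain a coefficient of Q of index above j, already small enough.\<close>
    have split: "sum g {0..r + j + 1} = sum g {0..j} + sum g {Suc j..r + j + 1}" for g :: "nat \<Rightarrow> complex"
      using sum.ub_add_nat[of 0 j g "r + 1"] by (simp add: add_ac)
    have "fps_nth (Q * h) (r + j + 1) = (\<Sum>i = 0..r + j + 1. fps_nth Q i * fps_nth h (r + j + 1 - i))"
      by (simp only: fps_mult_nth)
    also have "\<dots> = (\<Sum>i = 0..j. fps_nth Q i * fps_nth h (r + j + 1 - i)) +
        (\<Sum>i = Suc j..r + j + 1. fps_nth Q i * fps_nth h (r + j + 1 - i))"
      by (rule split)
    also have "(\<Sum>i = 0..j. fps_nth Q i * fps_nth h (r + j + 1 - i)) =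
        (\<Sum>i = 0..j. fps_nth h (r + (j - i) + 1) * fps_nth Q i)"
      by (intro sum.cong refl) (simp add: mult.commute Suc_diff_le)
    finally have e2: "(\<Sum>i = 0..j. fps_nth h (r + (j - i) + 1) * fps_nth Q i) = fps_nth (Q * h) (r + j + 1) -
        (\<Sum>i = Suc j..r + j + 1. fps_nth Q i * fps_nth h (r + j + 1 - i))" by simp
    have "V (B * of_nat (r + j + 1) - C) (fps_nth (Q * h) (r + j + 1))" using Qh by (simp only: decays_def)
    moreover have "B * of_nat j \<le> B * of_nat (r + j + 1)" using B by (intro mult_left_mono) auto
    ultimately have v2: "V (B * of_nat j - 2 * C) (fps_nth (Q * h) (r + j + 1))"
      using C by (elim V_mono) linarith
    have v3: "V (B * of_nat j - 2 * C) (\<Sum>i = Suc j..r + j + 1. fps_nth Q i * fps_nth h (r + j + 1 - i))"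
    proof (rule V_sum)
      fix i assume i: "i \<in> {Suc j..r + j + 1}"
      have "V ((B * of_nat i - C) + (- C)) (fps_nth Q i * fps_nth h (r + j + 1 - i))"
        using Q h_V by (intro V_mult) (auto simp: decays_def)
      moreover have "B * of_nat j \<le> B * of_nat i" using B i by (intro mult_left_mono) auto
      ultimately show "V (B * of_nat j - 2 * C) (fps_nth Q i * fps_nth h (r + j + 1 - i))"
        by (elim V_mono) linarith
    qed
    show ?thesis using V_add[OF v1 V_diff[OF v2 v3]] unfolding e2[symmetric] by (simp only: diff_add_cancel)
  qed
  have "upper_triangular T" by (auto simp: T_def upper_triangular_def)
  hence "det T = prod_list (diag_mat T)" using T by (rule det_upper_triangular)
  also have "\<dots> = 1" by (simp add: prod_list_diag_prod T_def Q0)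
  finally have "det (H * T) = det H" by (simp add: det_mult[OF H T])
  moreover have "H = map_mat of_int (hankel b m)" by (auto simp: H_def hankel_def)
  ultimately have det: "det (H * T) = of_int (det (hankel b m))" by (simp add: of_int_hom.hom_det)
  define r where "r = (\<Sum>j<m. B * of_nat j - 2 * C)"
  have "V r (of_int (det (hankel b m)))"
    unfolding det[symmetric] r_def using entry H T by (intro V_det) auto
  hence "real p powr of_rat r \<le> \<bar>of_int (det (hankel b m))\<bar>" using nz by (rule V_int_bound)
  also have "\<dots> \<le> of_int (int p ^ ((n + 1) * m ^ 2))"
    using hankel_det_bound[OF bound, of m] by (simp only: of_int_abs[symmetric] of_int_le_iff)
  also have "\<dots> = real p powr of_rat (of_nat ((n + 1) * m ^ 2))"
    using p_gt_1 by (simp add: powr_realpow of_rat_of_nat_eq del: of_nat_mult of_nat_add of_nat_Suc)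
  finally have "of_rat r \<le> (of_rat (of_nat ((n + 1) * m ^ 2)) :: real)" using p_gt_1 by simp
  hence le: "r \<le> of_nat ((n + 1) * m ^ 2)" by (simp only: of_rat_less_eq)
  \<comment> \<open>The slope B = 2(n + 2) pays off here: the weights add up to (n + 2) m (m - 1) -
    2 C m, which beats (n + 1) m^2 exactly when m > n + 2 + 2 C.\<close>
  have "(\<Sum>j<l. B * of_nat j - 2 * C) = (of_nat n + 2) * (of_nat l * (of_nat l - 1)) - 2 * C * of_nat l" for l
    unfolding B_def by (induction l) (simp_all add: algebra_simps)
  hence r: "r = (of_nat n + 2) * (of_nat m * (of_nat m - 1)) - 2 * C * of_nat m" unfolding r_def .
  hence "of_nat m * ((of_nat n + 2) * (of_nat m - 1) - 2 * C) \<le> of_nat m * ((of_nat n + 1) * of_nat m)"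
    using le unfolding r by (simp add: algebra_simps power2_eq_square)
  moreover have "of_nat m > (0 :: rat)" using m C by linarith
  ultimately have "(of_nat n + 2) * (of_nat m - 1) - 2 * C \<le> (of_nat n + 1) * of_nat m"
    by (simp only: mult_le_cancel_left_pos)
  thus False using m by (simp add: algebra_simps)
qed

text \<open>The quantifiers matter: C is fixed before M, because the precision used grows with the
  size of the Hankel matrix while the threshold for that size depends on C.\<close>

theorem hankel_virtually_periodic:
  fixes b :: "nat \<Rightarrow> int" and n :: nat
  assumes "\<And>k. \<bar>b k\<bar> \<le> int p ^ (n * (k + 1))" "C \<ge> 0"
    and "\<And>M. \<exists>Q h. fps_nth Q 0 = 1 \<and> decays (2 * (of_nat n + 2)) C Q \<and>
           decays (2 * (of_nat n + 2)) C (Q * h) \<and> (\<forall>k. V M (of_int (b k) - fps_nth h (k + 1)))"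
  shows "virtually_periodic (\<lambda>k. b k = 0)"
proof -
  obtain m0 :: nat where m0: "of_nat n + 2 + 2 * C < of_nat m0" using reals_Archimedean2 by blast
  have "det (hankel (\<lambda>k. of_int (b k) :: rat) m) = 0" if "m \<ge> m0" for m
  proof -
    have "of_nat m0 \<le> (of_nat m :: rat)" using that by simp
    hence "det (hankel b m) = 0" using m0 assms by (intro hankel_det_eq_0[of b n C m]) auto
    moreover have "hankel (\<lambda>k. of_int (b k) :: rat) m = map_mat of_int (hankel b m)"
      by (auto simp: hankel_def)
    ultimately show ?thesis by (simp add: of_int_hom.hom_det)
  qed
  thus ?thesis using kronecker_hankel[of m0 "\<lambda>k. of_int (b k) :: rat"] skolem_mahler_lech by blast
qed

end

section \<open>Counting points by trace\<close>

text \<open>Allows a factor x^k in front of a power sum to be absorbed into the eigenvalues; for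
  integral x the decay is not harmed.\<close>

lemma rev_char_map_scale:
  "fps_nth (rev_char (map ((*) x) as)) k = x ^ k * fps_nth (rev_char as) k"
proof (induction as arbitrary: k)
  case (Cons a as)
  have rec: "fps_nth (rev_char (c # cs)) k = fps_nth (rev_char cs) k -
      (if k = 0 then 0 else c * fps_nth (rev_char cs) (k - 1))" for c :: 'a and cs
  proof -
    have "rev_char (c # cs) = rev_char cs - fps_X * (fps_const c * rev_char cs)"
      by (simp add: rev_char_def algebra_simps)
    thus ?thesis by (cases k) (simp_all add: fps_X_mult_nth)
  qed
  show ?case
    unfolding list.map rec Cons.IH by (cases k) (simp_all add: algebra_simps)
qed (auto simp: rev_char_def fps_one_nth)

context p_place
begin

text \<open>The product of all \<open>rev_char\<close> is a common denominator, and
  \<open>newton_identity\<close> handles the one factor that meets its own power sum. The added 1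
  pays for weights x of valuation -1.\<close>

lemma decays_power_sum_combination:
  fixes bs :: "'s \<Rightarrow> complex list"
  assumes S: "finite S" and dec: "\<forall>s\<in>S. decays B C (rev_char (bs s))"
    and x: "\<forall>s\<in>S. V (-1) (x s)" and C: "C \<ge> 0"
  shows "\<exists>Q h. fps_nth Q 0 = 1 \<and> decays B (of_nat (card S) * C + 1) Q \<and>
           decays B (of_nat (card S) * C + 1) (Q * h) \<and>
           (\<forall>k. fps_nth h k = (\<Sum>s\<in>S. x s * (\<Sum>a\<leftarrow>bs s. a ^ k)))"
proof (intro exI conjI allI)
  let ?Q = "\<Prod>s\<in>S. rev_char (bs s)"
  let ?h = "\<Sum>s\<in>S. fps_const (x s) * power_sums (bs s)"
  have "fps_nth (\<Prod>s\<in>I. rev_char (bs s)) 0 = 1" for I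
    by (induction I rule: infinite_finite_induct) simp_all
  thus "fps_nth ?Q 0 = 1" .
  have "decays B (of_nat (card S) * C) ?Q" using dec by (intro decays_prod) simp
  thus "decays B (of_nat (card S) * C + 1) ?Q" by (rule decays_mono) simp
  have "decays B (of_nat (card S) * C + 1) (?Q * (fps_const (x s) * power_sums (bs s)))" if s: "s \<in> S" for s
  proof -
    have "decays B C (rev_char (bs s) * power_sums (bs s))"
      unfolding newton_identity using bspec[OF dec s] by (rule decays_newton)
    moreover have "decays B (of_nat (card (S - {s})) * C) (\<Prod>t\<in>S - {s}. rev_char (bs t))"
      using dec by (intro decays_prod) auto
    ultimately have "decays B (of_nat (card (S - {s})) * C + C)
        ((\<Prod>t\<in>S - {s}. rev_char (bs t)) * (rev_char (bs s) * power_sums (bs s)))"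
      by (intro decays_mult)
    hence "decays B ((of_nat (card (S - {s})) * C + C) + 1) (fps_const (x s) *
        ((\<Prod>t\<in>S - {s}. rev_char (bs t)) * (rev_char (bs s) * power_sums (bs s))))"
      using bspec[OF x s] by (rule decays_const_mult[rotated])
    moreover have "of_nat (card (S - {s})) * C + C = of_nat (card S) * C"
      unfolding card_Suc_Diff1[OF S s, symmetric] of_nat_Suc by (simp only: distrib_right mult_1_left add.commute)
    moreover have "fps_const (x s) * ((\<Prod>t\<in>S - {s}. rev_char (bs t)) * (rev_char (bs s) * power_sums (bs s))) =
        ?Q * (fps_const (x s) * power_sums (bs s))"
      using prod.remove[OF S s, of "\<lambda>s. rev_char (bs s)"] by (simp add: mult_ac)
    ultimately show ?thesis by (simp only:)
  qed
  hence "decays B (of_nat (card S) * C + 1) (\<Sum>s\<in>S. ?Q * (fps_const (x s) * power_sums (bs s)))"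
    by (rule decays_sum)
  thus "decays B (of_nat (card S) * C + 1) (?Q * ?h)" by (simp only: sum_distrib_left)
  show "fps_nth ?h k = (\<Sum>s\<in>S. x s * (\<Sum>a\<leftarrow>bs s. a ^ k))" for k
    by (simp add: fps_sum_nth power_sums_def)
qed

lemma prime_cyclotomicI: "\<zeta> ^ p = 1 \<Longrightarrow> \<zeta> \<noteq> 1 \<Longrightarrow> prime_cyclotomic p \<zeta>"
  by (unfold_locales) (auto intro: prime_p rational_relation_constant)

lemma V_inverse_p: "V (-1) (inverse (of_nat p))"
  using V_P[of "-1"] by (simp add: P_minus P_1)

end

lemma power_diff_1_expand:
  fixes q :: "'a::comm_ring_1"
  assumes "c \<le> n"
  shows "(q - 1) ^ c = (\<Sum>i\<le>n. of_nat (c choose i) * (- 1) ^ (c - i) * q ^ i)"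
proof -
  have "(q - 1) ^ c = (q + (- 1)) ^ c" by simp
  also have "\<dots> = (\<Sum>i\<le>c. of_nat (c choose i) * q ^ i * (- 1) ^ (c - i))" by (rule binomial_ring)
  also have "\<dots> = (\<Sum>i\<le>n. of_nat (c choose i) * q ^ i * (- 1) ^ (c - i))"
    using assms by (intro sum.mono_neutral_left) (auto simp: not_le binomial_eq_0)
  finally show ?thesis by (simp add: mult_ac)
qed

context gf_dwork
begin

text \<open>The factors (p^k - 1)^|I| are expanded binomially, and each p^(i k) is absorbed into the
  eigenvalues, which become p^i a. Approximating to precision M + 1 compensates for the valuation -1
  of \<gamma>.\<close>

lemma twisted_sum_combination_approximation:
  assumes f: "f \<in> mpolys n" and B: "B \<ge> 0" and \<gamma>: "\<And>b. b < p \<Longrightarrow> V (-1) (\<gamma> b)"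
  shows "\<exists>C\<ge>0. \<forall>M. \<exists>Q h. fps_nth Q 0 = 1 \<and> decays B C Q \<and> decays B C (Q * h) \<and>
    (\<forall>k\<ge>1. V M ((\<Sum>b<p. \<gamma> b * twisted_sum splitting_root n f b k) - fps_nth h k))"
proof -
  define C where "C = B * of_nat (card (small_exponents B n (slope (supp f) n)))"
  have C: "C \<ge> 0" using B by (simp add: C_def)
  define S where "S = {..<p} \<times> Pow {..<n} \<times> {..n}"
  have S: "finite S" by (simp add: S_def)
  show ?thesis
  proof (intro exI[of _ "of_nat (card S) * C + 1"] conjI allI)
    show "of_nat (card S) * C + 1 \<ge> 0" using C by (intro add_nonneg_nonneg mult_nonneg_nonneg) auto
    fix M
    let ?P = "\<lambda>b as. (\<forall>I\<in>Pow {..<n}. decays B C (rev_char (as I)) \<and> (\<forall>k. (\<Sum>a\<leftarrow>as I. a ^ k) \<in> R)) \<and>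
        (\<forall>k\<ge>1. V (M + 1) (twisted_sum splitting_root n f b k -
          (\<Sum>I\<in>Pow {..<n}. of_nat (p ^ k - 1) ^ card I * (\<Sum>a\<leftarrow>as I. a ^ k))))"
    define as where "as = (\<lambda>b. SOME as. ?P b as)"
    have P: "?P b (as b)" for b
      unfolding as_def C_def by (rule someI_ex[OF twisted_sum_approximation[OF f B]])
    have as: "decays B C (rev_char (as b I))" if "I \<in> Pow {..<n}" for b I
      using P[of b] that by simp
    have approx: "V (M + 1) (twisted_sum splitting_root n f b k -
          (\<Sum>I\<in>Pow {..<n}. of_nat (p ^ k - 1) ^ card I * (\<Sum>a\<leftarrow>as b I. a ^ k)))" if "k \<ge> 1" for b k
      using P[of b] that by simp
    define bs where "bs = (\<lambda>(b, I, i). map ((*) (of_nat p ^ i)) (as b I))"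
    define x :: "nat \<times> nat set \<times> nat \<Rightarrow> complex"
      where "x = (\<lambda>(b, I, i). \<gamma> b * (of_nat (card I choose i) * (- 1) ^ (card I - i)))"
    have dec: "\<forall>s\<in>S. decays B C (rev_char (bs s))"
      using as
      by (auto simp: decays_def S_def bs_def rev_char_map_scale intro!: V_mult_R(2) power_in of_nat_in)
    have x: "\<forall>s\<in>S. V (-1) (x s)"
    proof
      fix s assume "s \<in> S"
      moreover obtain b I i where s: "s = (b, I, i)" by (cases s)
      ultimately have b: "b < p" by (simp add: S_def)
      have "of_int (int (card I choose i) * (- 1) ^ (card I - i)) \<in> R" by (rule of_int_in)
      hence "of_nat (card I choose i) * (- 1) ^ (card I - i) \<in> R" by simp
      from V_mult_R(1)[OF \<gamma>[OF b] this] show "V (-1) (x s)" by (simp add: s x_def)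
    qed
    obtain Q h where Qh: "fps_nth Q 0 = 1" "decays B (of_nat (card S) * C + 1) Q"
        "decays B (of_nat (card S) * C + 1) (Q * h)"
      and h: "\<forall>k. fps_nth h k = (\<Sum>s\<in>S. x s * (\<Sum>a\<leftarrow>bs s. a ^ k))"
      using decays_power_sum_combination[OF S dec x C] by (elim exE conjE)
    have h': "fps_nth h k = (\<Sum>b<p. \<gamma> b * (\<Sum>I\<in>Pow {..<n}. of_nat (p ^ k - 1) ^ card I * (\<Sum>a\<leftarrow>as b I. a ^ k)))" for k
    proof -
      have inner: "of_nat (p ^ k - 1) ^ card I * (\<Sum>a\<leftarrow>as b I. a ^ k) =
          (\<Sum>i\<le>n. of_nat (card I choose i) * (- 1) ^ (card I - i) * (\<Sum>a\<leftarrow>bs (b, I, i). a ^ k))"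
        if I: "I \<in> Pow {..<n}" for b I
      proof -
        have "card I \<le> n" using I card_mono[of "{..<n}" I] by auto
        moreover have "(of_nat (p ^ k - 1) :: complex) = of_nat p ^ k - 1"
          using p_gt_1 by (simp add: of_nat_diff)
        ultimately have "of_nat (p ^ k - 1) ^ card I = (\<Sum>i\<le>n. of_nat (card I choose i) * (- 1) ^ (card I - i) * (of_nat p ^ k) ^ i :: complex)"
          using power_diff_1_expand[of "card I" n "of_nat p ^ k :: complex"] by (simp only:)
        moreover have "(\<Sum>a\<leftarrow>bs (b, I, i). a ^ k) = (of_nat p ^ k) ^ i * (\<Sum>a\<leftarrow>as b I. a ^ k)" for i
        proof -
          have "((of_nat p :: complex) ^ i) ^ k = (of_nat p ^ k) ^ i"
            by (simp only: power_mult[symmetric] mult.commute)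
          thus ?thesis by (simp add: bs_def comp_def power_mult_distrib sum_list_const_mult)
        qed
        ultimately show ?thesis by (simp only: sum_distrib_right mult.assoc)
      qed
      have "fps_nth h k = (\<Sum>b<p. \<Sum>I\<in>Pow {..<n}. \<Sum>i\<le>n. x (b, I, i) * (\<Sum>a\<leftarrow>bs (b, I, i). a ^ k))"
        unfolding h[rule_format] S_def by (simp only: sum.cartesian_product' case_prod_unfold fst_conv snd_conv)
      also have "\<dots> = (\<Sum>b<p. \<Sum>I\<in>Pow {..<n}. \<gamma> b * (of_nat (p ^ k - 1) ^ card I * (\<Sum>a\<leftarrow>as b I. a ^ k)))"
        by (intro sum.cong refl, subst inner) (simp_all only: x_def prod.case sum_distrib_left mult.assoc)
      finally show ?thesis by (simp only: sum_distrib_left)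
    qed
    have "V M ((\<Sum>b<p. \<gamma> b * twisted_sum splitting_root n f b k) - fps_nth h k)" if k: "k \<ge> 1" for k
    proof -
      have "V ((-1) + (M + 1)) (\<gamma> b * (twisted_sum splitting_root n f b k -
          (\<Sum>I\<in>Pow {..<n}. of_nat (p ^ k - 1) ^ card I * (\<Sum>a\<leftarrow>as b I. a ^ k))))" if "b < p" for b
        using \<gamma>[OF that] approx[OF k] by (rule V_mult)
      hence "V M (\<Sum>b<p. \<gamma> b * (twisted_sum splitting_root n f b k -
          (\<Sum>I\<in>Pow {..<n}. of_nat (p ^ k - 1) ^ card I * (\<Sum>a\<leftarrow>as b I. a ^ k))))"
        by (intro V_sum) simp
      thus ?thesis by (simp only: h' right_diff_distrib sum_subtractf)
    qed
    thus "\<exists>Q h. fps_nth Q 0 = 1 \<and> decays B (of_nat (card S) * C + 1) Q \<and>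
        decays B (of_nat (card S) * C + 1) (Q * h) \<and>
        (\<forall>k\<ge>1. V M ((\<Sum>b<p. \<gamma> b * twisted_sum splitting_root n f b k) - fps_nth h k))"
      using Qh by (intro exI[of _ Q] exI[of _ h]) simp
  qed
qed

definition trace_count :: "nat \<Rightarrow> 'p mod_ring mpoly \<Rightarrow> nat \<Rightarrow> nat \<Rightarrow> nat" where
  "trace_count n f k j = card {x \<in> {..<n} \<rightarrow>\<^sub>E GF k. trace_index k (eval_ac f x) = j}"

lemma points:
  assumes "k > 0"
  shows "finite ({..<n} \<rightarrow>\<^sub>E (GF k :: 'p mod_ring alg_closure set))"
    and "card ({..<n} \<rightarrow>\<^sub>E (GF k :: 'p mod_ring alg_closure set)) = p ^ (n * k)"
proof -
  have c: "card (GF k :: 'p mod_ring alg_closure set) = p ^ k" using card_GF[OF assms] by (simp add: p_card)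
  hence "finite (GF k :: 'p mod_ring alg_closure set)" using p_gt_1 by (intro card_ge_0_finite) simp
  thus "finite ({..<n} \<rightarrow>\<^sub>E (GF k :: 'p mod_ring alg_closure set))" by (intro finite_PiE) auto
  show "card ({..<n} \<rightarrow>\<^sub>E (GF k :: 'p mod_ring alg_closure set)) = p ^ (n * k)"
    by (simp add: card_PiE c power_mult[symmetric] mult.commute)
qed

text \<open>Orthogonality of the characters of Z/p; p - j stands for -j.\<close>

lemma trace_count_fourier:
  assumes j: "j < p" and k: "k > 0"
  shows "of_nat (trace_count n f k j) =
    (\<Sum>b<p. inverse (of_nat p) * splitting_root ^ (b * (p - j)) * twisted_sum splitting_root n f b k)"
proof -
  let ?T = "{..<n} \<rightarrow>\<^sub>E (GF k :: 'p mod_ring alg_closure set)"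
  let ?t = "\<lambda>x. trace_index k (eval_ac f x)"
  have inner: "(\<Sum>b<p. splitting_root ^ (b * (p - j)) * splitting_root ^ (b * ?t x)) =
      (if ?t x = j then of_nat p else 0)" for x
  proof -
    have t: "?t x < p" using trace_index_less p_card by simp
    let ?\<eta> = "splitting_root ^ (p - j + ?t x)"
    have eq: "(\<Sum>b<p. splitting_root ^ (b * (p - j)) * splitting_root ^ (b * ?t x)) = (\<Sum>b<p. ?\<eta> ^ b)"
      by (intro sum.cong refl)
        (simp only: power_add[symmetric] power_mult[symmetric] distrib_left[symmetric] mult.commute)
    show ?thesis
    proof (cases "?t x = j")
      case True
      thus ?thesis unfolding eq using j splitting_root(1) by simp
    next
      case False
      have "\<not> p dvd p - j + ?t x"
      proof
        assume "p dvd p - j + ?t x"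
        then obtain c where c: "p - j + ?t x = p * c" ..
        have "0 < p * c" "p * c < p * 2" using c j t by linarith+
        hence "c = 1" by (cases c) auto
        thus False using c j False by simp
      qed
      hence "?\<eta> \<noteq> 1" by (rule prime_cyclotomic.power_neq_1[OF prime_cyclotomicI[OF splitting_root]])
      moreover have "?\<eta> ^ p = 1" by (metis power_mult mult.commute splitting_root(1) power_one)
      ultimately show ?thesis unfolding eq using False by (simp add: sum_powers_root_of_unity)
    qed
  qed
  have "(\<Sum>b<p. splitting_root ^ (b * (p - j)) * twisted_sum splitting_root n f b k) =
      (\<Sum>x\<in>?T. \<Sum>b<p. splitting_root ^ (b * (p - j)) * splitting_root ^ (b * ?t x))"
    unfolding twisted_sum_def sum_distrib_left by (rule sum.swap)
  also have "\<dots> = (\<Sum>x\<in>?T. if ?t x = j then of_nat p else 0)" unfolding inner ..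
  also have "\<dots> = of_nat p * of_nat (trace_count n f k j)"
    using points(1)[OF k] by (simp add: trace_count_def sum.If_cases Int_def)
  finally show ?thesis using p_gt_1 by (simp add: mult.assoc sum_distrib_left[symmetric])
qed

lemma trace_count_le: "k > 0 \<Longrightarrow> trace_count n f k j \<le> p ^ (n * k)"
  unfolding trace_count_def points(2)[symmetric] by (intro card_mono points(1)) auto

theorem trace_count_eq_virtually_periodic:
  assumes f: "f \<in> mpolys n" and ij: "i < p" "j < p"
  shows "virtually_periodic (\<lambda>k. trace_count n f k i = trace_count n f k j)"
proof -
  \<comment> \<open>The shift by one excludes k = 0, where \<open>GF 0\<close> is the whole
    algebraic closure.\<close>
  define b where "b = (\<lambda>k. int (trace_count n f (1 + k) i) - int (trace_count n f (1 + k) j))"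
  define \<gamma> where "\<gamma> = (\<lambda>b. inverse (of_nat p) * splitting_root ^ (b * (p - i)) -
      inverse (of_nat p) * splitting_root ^ (b * (p - j)))"
  have "splitting_root \<in> R"
    using splitting_root(1) p_gt_1 by (intro root_in[where x = splitting_root and n = p]) auto
  hence \<gamma>: "V (-1) (\<gamma> c)" for c
    unfolding \<gamma>_def by (intro V_diff V_mult_R(1) V_inverse_p power_in)
  have b: "of_int (b k) = (\<Sum>c<p. \<gamma> c * twisted_sum splitting_root n f c (k + 1))" for k
    by (simp add: b_def trace_count_fourier ij \<gamma>_def left_diff_distrib sum_subtractf)
  have B: "2 * (of_nat n + 2) \<ge> (0 :: rat)" by simp
  obtain C where C: "C \<ge> 0" and approx: "\<forall>M. \<exists>Q h. fps_nth Q 0 = 1 \<and> decays (2 * (of_nat n + 2)) C Q \<and>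
      decays (2 * (of_nat n + 2)) C (Q * h) \<and>
      (\<forall>k\<ge>1. V M ((\<Sum>b<p. \<gamma> b * twisted_sum splitting_root n f b k) - fps_nth h k))"
    using twisted_sum_combination_approximation[where \<gamma> = \<gamma>, OF f B \<gamma>] by (elim exE conjE)
  have "virtually_periodic (\<lambda>k. b k = 0)"
  proof (rule hankel_virtually_periodic[OF _ C])
    fix k M
    have le: "int (trace_count n f (1 + k) l) \<le> int p ^ (n * (k + 1))" for l
    proof -
      have "int (trace_count n f (1 + k) l) \<le> int (p ^ (n * (1 + k)))"
        unfolding of_nat_le_iff by (rule trace_count_le) simp
      thus ?thesis by (simp only: of_nat_power add.commute)
    qed
    show "\<bar>b k\<bar> \<le> int p ^ (n * (k + 1))"
      unfolding b_def abs_le_iff using le[of i] le[of j] by linarith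
    obtain Q h where "fps_nth Q 0 = 1" "decays (2 * (of_nat n + 2)) C Q" "decays (2 * (of_nat n + 2)) C (Q * h)"
      "\<forall>k\<ge>1. V M ((\<Sum>b<p. \<gamma> b * twisted_sum splitting_root n f b k) - fps_nth h k)"
      using spec[OF approx, of M] by (elim exE conjE)
    thus "\<exists>Q h. fps_nth Q 0 = 1 \<and> decays (2 * (of_nat n + 2)) C Q \<and>
        decays (2 * (of_nat n + 2)) C (Q * h) \<and> (\<forall>k. V M (of_int (b k) - fps_nth h (k + 1)))"
      by (intro exI[of _ Q] exI[of _ h] conjI allI) (simp_all add: b)
  qed
  hence "virtually_periodic (\<lambda>k. trace_count n f (1 + k) i = trace_count n f (1 + k) j)"
    by (simp add: b_def)
  thus ?thesis by (rule virtually_periodic_shift)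
qed

end

section \<open>Automorphisms fixing an exponential sum\<close>

context prime_cyclotomic
begin

lemma bij_betw_mult_mod:
  assumes "\<not> p dvd c"
  shows "bij_betw (\<lambda>j. c * j mod p) {..<p} {..<p}"
proof -
  have "inj_on (\<lambda>j. c * j mod p) {..<p}"
  proof (rule inj_onI)
    fix i j assume ij: "i \<in> {..<p}" "j \<in> {..<p}" "c * i mod p = c * j mod p"
    hence "[c * i = c * j] (mod p)" by (simp add: cong_def)
    hence "[i = j] (mod p)" using cong_mult_lcancel_nat[OF unit_coprime[OF assms]] by blast
    thus "i = j" using ij by (simp add: cong_def)
  qed
  moreover have "(\<lambda>j. c * j mod p) ` {..<p} \<subseteq> {..<p}" using p_pos by auto
  ultimately show ?thesis by (simp add: bij_betw_def endo_inj_surj)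
qed

text \<open>Reindexing by multiplication with c turns the equality into a rational relation among
  the powers of \<zeta>^c, so its coefficients are all equal; the one at j = 0 is zero because
  multiplication by c fixes 0.\<close>

lemma conjugate_fixed_iff:
  assumes c: "\<not> p dvd c"
  shows "(\<Sum>j<p. of_rat (d j) * \<zeta> ^ (j * c)) = (\<Sum>j<p. of_rat (d j) * \<zeta> ^ j) \<longleftrightarrow>
    (\<forall>j<p. d (c * j mod p) = d j)"
proof -
  have pw: "\<zeta> ^ (j * c) = (\<zeta> ^ c) ^ j" for j
    by (simp only: power_mult[symmetric] mult.commute)
  have "(\<Sum>j<p. of_rat (d j) * \<zeta> ^ j) = (\<Sum>j<p. of_rat (d (c * j mod p)) * \<zeta> ^ (c * j mod p))"
    by (rule sum.reindex_bij_betw[OF bij_betw_mult_mod[OF c], symmetric])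
  also have "\<dots> = (\<Sum>j<p. of_rat (d (c * j mod p)) * (\<zeta> ^ c) ^ j)"
    by (simp only: power_mod power_mult)
  finally have eq: "(\<Sum>j<p. of_rat (d j) * \<zeta> ^ j) = \<dots>" .
  show ?thesis
  proof
    assume "(\<Sum>j<p. of_rat (d j) * \<zeta> ^ (j * c)) = (\<Sum>j<p. of_rat (d j) * \<zeta> ^ j)"
    hence "(\<Sum>j<p. of_rat (d j) * (\<zeta> ^ c) ^ j) - (\<Sum>j<p. of_rat (d (c * j mod p)) * (\<zeta> ^ c) ^ j) = 0"
      unfolding eq pw by simp
    hence rel: "(\<Sum>j<p. of_rat (d j - d (c * j mod p)) * (\<zeta> ^ c) ^ j) = 0"
      by (simp only: of_rat_diff left_diff_distrib sum_subtractf)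
    show "\<forall>j<p. d (c * j mod p) = d j"
    proof (intro allI impI)
      fix j assume "j < p"
      have "d j - d (c * j mod p) = d 0 - d (c * 0 mod p)"
        by (rule relation_constant[OF power_power_p power_neq_1[OF c] rel \<open>j < p\<close> p_pos])
      also have "\<dots> = 0" by simp
      finally show "d (c * j mod p) = d j" by simp
    qed
  next
    assume "\<forall>j<p. d (c * j mod p) = d j"
    thus "(\<Sum>j<p. of_rat (d j) * \<zeta> ^ (j * c)) = (\<Sum>j<p. of_rat (d j) * \<zeta> ^ j)"
      unfolding eq pw by simp
  qed
qed

end

context gf_dwork
begin

lemma exp_sum_eq:
  assumes k: "k > 0"
  shows "exp_sum \<zeta> n f k = (\<Sum>j<p. of_nat (trace_count n f k j) * \<zeta> ^ j)"
proof -
  let ?T = "{..<n} \<rightarrow>\<^sub>E (GF k :: 'p mod_ring alg_closure set)"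
  let ?t = "\<lambda>x. trace_index k (eval_ac f x)"
  have powi: "\<zeta> powi to_int_mod_ring z = \<zeta> ^ nat (to_int_mod_ring z)" for z :: "'p mod_ring"
  proof -
    have "to_int_mod_ring z \<in> {0..<int CARD('p)}"
      unfolding range_to_int_mod_ring[symmetric] by simp
    thus ?thesis by (simp add: power_int_def)
  qed
  have "exp_sum \<zeta> n f k = (\<Sum>x\<in>?T. \<zeta> ^ ?t x)"
    by (simp add: exp_sum_def trace_index_def powi)
  also have "\<dots> = (\<Sum>j<p. \<Sum>x | x \<in> ?T \<and> ?t x = j. \<zeta> ^ ?t x)"
    by (rule sum.group[symmetric]) (use points(1)[OF k] trace_index_less p_card in auto)
  also have "\<dots> = (\<Sum>j<p. \<Sum>x | x \<in> ?T \<and> ?t x = j. \<zeta> ^ j)"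
    by (intro sum.cong) auto
  finally show ?thesis by (simp add: trace_count_def)
qed

theorem alg_degree_exp_sum_periodic:
  fixes f :: "'p mod_ring mpoly"
  assumes \<zeta>: "\<zeta> ^ p = 1" "\<zeta> \<noteq> 1" and f: "f \<in> mpolys n"
  shows "virtually_periodic (\<lambda>k. alg_degree (exp_sum \<zeta> n f k))"
proof -
  interpret prime_cyclotomic p \<zeta> using \<zeta> by (rule prime_cyclotomicI)
  \<comment> \<open>All coincidences among the p counts in one value, so that a single period and
    threshold govern every automorphism at once.\<close>
  define pattern where "pattern = (\<lambda>k. \<lambda>ij\<in>{..<p} \<times> {..<p}. trace_count n f k (fst ij) = trace_count n f k (snd ij))"
  have "virtually_periodic pattern"
    unfolding pattern_def by (intro virtually_periodic_family) (auto intro: trace_count_eq_virtually_periodic f)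
  then obtain N r where r: "r > 0" and per: "\<And>k. k \<ge> N \<Longrightarrow> pattern (k + r) = pattern k"
    unfolding virtually_periodic_def by blast
  have pat: "trace_count n f k i = trace_count n f k j \<longleftrightarrow> pattern k (i, j)" if "i < p" "j < p" for k i j
    using that by (simp add: pattern_def)
  define \<alpha> where "\<alpha> = (\<lambda>k s. \<Sum>j<p. of_rat (of_nat (trace_count n f k j)) * \<zeta> ^ (j * s))"
  have \<alpha>: "conjugates (\<alpha> k)" for k
    unfolding \<alpha>_def by (rule conjugatesI) (rule refl)
  have \<alpha>1: "\<alpha> k 1 = exp_sum \<zeta> n f k" if "k > 0" for k
    using that by (simp add: \<alpha>_def exp_sum_eq)
  have fixed: "\<alpha> k c = \<alpha> k 1 \<longleftrightarrow> (\<forall>j<p. pattern k (c * j mod p, j))" if "c \<in> {1..<p}" for k c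
    using conjugate_fixed_iff[OF unit_iff[OF that], of "\<lambda>j. of_nat (trace_count n f k j)"] p_pos
    by (simp add: \<alpha>_def pat[symmetric])
  show ?thesis
  \<comment> \<open>The threshold N + 1 keeps k positive, as the expansion of the exponential sum in
    counts requires.\<close>
  proof (rule virtually_periodicI[OF r, of "N + 1"])
    fix k assume k: "k \<ge> N + 1"
    have "alg_degree (\<alpha> (k + r) 1) = alg_degree (\<alpha> k 1)"
    proof (rule alg_degree_eq[OF \<alpha> \<alpha>])
      have "pattern (k + r) = pattern k" using per k by simp
      thus "\<alpha> (k + r) c = \<alpha> (k + r) 1 \<longleftrightarrow> \<alpha> k c = \<alpha> k 1" if "c \<in> {1..<p}" for c
        by (simp only: fixed[OF that])
    qed
    thus "alg_degree (exp_sum \<zeta> n f (k + r)) = alg_degree (exp_sum \<zeta> n f k)"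
      using \<alpha>1[of k] \<alpha>1[of "k + r"] k by simp
  qed
qed

end

lemma gf_dwork_exists:
  "\<exists>R (\<phi> :: complex \<Rightarrow> 'p::prime_card mod_ring alg_closure) \<pi>. gf_dwork R \<phi> CARD('p) \<pi>"
proof -
  obtain R and \<phi> :: "complex \<Rightarrow> 'p mod_ring alg_closure" where place: "place R \<phi>"
    using place_exists by blast
  have pr: "prime CARD('p)" by (rule prime_card)
  hence "CARD('p) - 1 > 0" using prime_gt_1_nat by simp
  then obtain \<pi> :: complex where "\<pi> ^ (CARD('p) - 1) = - of_nat CARD('p)"
    using complex_nth_root_exists by blast
  moreover have "(of_nat CARD('p) :: 'p mod_ring alg_closure) = 0"
    unfolding of_nat_eq_0_iff_char_dvd by simp
  ultimately have "gf_dwork R \<phi> CARD('p) \<pi>"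
    using place pr by (simp add: gf_dwork_def gf_dwork_axioms_def dwork_def dwork_axioms_def
        p_place_def p_place_axioms_def)
  thus ?thesis by blast
qed

theorem theorem1:
  fixes \<zeta> :: complex
    and n :: nat
    and f :: "'p::prime_card mod_ring mpoly"
  assumes "primitive_root_of_unity CARD('p) \<zeta>"
    and "f \<in> mpolys n"
  shows "\<exists>N r :: nat. N > 0 \<and> r > 0 \<and>
           (\<forall>k > N. alg_degree (exp_sum \<zeta> n f (k + r)) = alg_degree (exp_sum \<zeta> n f k))"
proof -
  obtain R and \<phi> :: "complex \<Rightarrow> 'p mod_ring alg_closure" and \<pi> where "gf_dwork R \<phi> CARD('p) \<pi>"
    using gf_dwork_exists by blast
  then interpret gf_dwork R \<phi> "CARD('p)" \<pi> .
  have "\<zeta> ^ CARD('p) = 1" "\<zeta> ^ 1 \<noteq> 1"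
    using assms(1) p_gt_1 by (auto simp: primitive_root_of_unity_def simp del: power_one_right)
  hence "virtually_periodic (\<lambda>k. alg_degree (exp_sum \<zeta> n f k))"
    using assms(2) by (intro alg_degree_exp_sum_periodic) auto
  then obtain N r where "r > 0"
      "\<forall>k\<ge>N. alg_degree (exp_sum \<zeta> n f (k + r)) = alg_degree (exp_sum \<zeta> n f k)"
    unfolding virtually_periodic_def by (elim exE conjE)
  thus ?thesis by (intro exI[of _ "N + 1"] exI[of _ r]) simp
qed

end
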